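(* There is an algorithm that, given an $n$-vertex graph $G$ with maximum degree $\Delta$ and an integer $k$, decides in time $O^*\bigl((2^{\Delta+1}-\Delta-1)^{n/(\Delta+1)}\bigr)$ whether the vertex set of $G$ can be covered by $k$ independent sets (equivalently, whether the chromatic number of $G$ is at most $k$).
   Context: A set of vertices is independent if no two of its vertices are adjacent. The notation $O^*(\cdot)$ suppresses factors polynomial in $n$. *)

theory Defs
  imports "HOL-Library.Log_Nat" "HOL-Computational_Algebra.Polynomial"
begin

section \<open>Graphs\<close>

definition simple_graph :: "'a set \<Rightarrow> 'a set set \<Rightarrow> bool" where
  "simple_graph V E \<longleftrightarrow> finite V \<and> E \<subseteq> {{u, v} |u v. u \<in> V \<and> v \<in> V \<and> u \<noteq> v}"

definition degree_of :: "'a set \<Rightarrow> 'a set set \<Rightarrow> 'a \<Rightarrow> nat" where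
  "degree_of V E v = card {u \<in> V. {u, v} \<in> E}"

text \<open>The \<open>insert 0\<close> only matters for the graph without vertices, whose maximum degree is 0.\<close>

definition max_degree :: "'a set \<Rightarrow> 'a set set \<Rightarrow> nat" where
  "max_degree V E = Max (insert 0 (degree_of V E ` V))"

definition independent_set :: "'a set \<Rightarrow> 'a set set \<Rightarrow> 'a set \<Rightarrow> bool" where
  "independent_set V E S \<longleftrightarrow> S \<subseteq> V \<and> (\<forall>u\<in>S. \<forall>v\<in>S. {u, v} \<notin> E)"

definition coverable :: "'a set \<Rightarrow> 'a set set \<Rightarrow> nat \<Rightarrow> bool" where
  "coverable V E k \<longleftrightarrow>
     (\<exists>S :: nat \<Rightarrow> 'a set. (\<forall>i<k. independent_set V E (S i)) \<and> V = (\<Union>i<k. S i))"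

definition proper_colouring :: "'a set \<Rightarrow> 'a set set \<Rightarrow> nat \<Rightarrow> ('a \<Rightarrow> nat) \<Rightarrow> bool" where
  "proper_colouring V E k f \<longleftrightarrow>
     (\<forall>v\<in>V. f v < k) \<and> (\<forall>u\<in>V. \<forall>v\<in>V. {u, v} \<in> E \<longrightarrow> f u \<noteq> f v)"

definition chromatic_number :: "'a set \<Rightarrow> 'a set set \<Rightarrow> nat" where
  "chromatic_number V E = (LEAST k. \<exists>f. proper_colouring V E k f)"


section \<open>The machine model\<close>

text \<open>
  Algorithms are programs of a random access machine under the logarithmic cost criterion,
  written as structured (while) programs. The machine has registers and a random access
  memory, both holding natural numbers of unbounded size. Subtraction is truncated, and
  \<open>Load a\<close> is the content of the memory cell whose address is the value of \<open>a\<close>.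
\<close>

datatype expr =
    Const nat
  | Reg nat
  | Load expr
  | Add expr expr
  | Sub expr expr
  | Mul expr expr
  | Div expr expr

datatype prog =
    Skip
  | Assign nat expr
  | Store expr expr
  | Seq prog prog
  | If expr prog prog
  | While expr prog

type_synonym state = "(nat \<Rightarrow> nat) \<times> (nat \<Rightarrow> nat)"

fun val :: "expr \<Rightarrow> state \<Rightarrow> nat" where
  "val (Const m) s = m"
| "val (Reg r) s = fst s r"
| "val (Load a) s = snd s (val a s)"
| "val (Add a b) s = val a s + val b s"
| "val (Sub a b) s = val a s - val b s"
| "val (Mul a b) s = val a s * val b s"
| "val (Div a b) s = val a s div val b s"

text \<open>The number of binary digits of \<open>m\<close>, where 0 counts as having one digit.\<close>

definition bits :: "nat \<Rightarrow> nat" where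
  "bits m = max 1 (floorlog 2 m)"

text \<open>
  Every node of an expression is charged the length of its value. So an operation pays for
  its operands and its result, and a load pays for the address and the content.
\<close>

fun expr_cost :: "expr \<Rightarrow> state \<Rightarrow> nat" where
  "expr_cost (Const m) s = bits m"
| "expr_cost (Reg r) s = bits (fst s r)"
| "expr_cost (Load a) s = expr_cost a s + bits (val (Load a) s)"
| "expr_cost (Add a b) s = expr_cost a s + expr_cost b s + bits (val (Add a b) s)"
| "expr_cost (Sub a b) s = expr_cost a s + expr_cost b s + bits (val (Sub a b) s)"
| "expr_cost (Mul a b) s = expr_cost a s + expr_cost b s + bits (val (Mul a b) s)"
| "expr_cost (Div a b) s = expr_cost a s + expr_cost b s + bits (val (Div a b) s)"

text \<open>
  \<open>exec c s t s'\<close>: started in \<open>s\<close>, the program \<open>c\<close> halts in \<open>s'\<close> after time \<open>t\<close>.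
  The guards of \<open>If\<close> and \<open>While\<close> count as true iff they are nonzero.
\<close>

inductive exec :: "prog \<Rightarrow> state \<Rightarrow> nat \<Rightarrow> state \<Rightarrow> bool" where
  Skip: "exec Skip s 1 s"
| Assign: "exec (Assign r e) s (1 + expr_cost e s) ((fst s)(r := val e s), snd s)"
| Store: "exec (Store a e) s (1 + expr_cost a s + expr_cost e s)
            (fst s, (snd s)(val a s := val e s))"
| Seq: "exec c s t s' \<Longrightarrow> exec d s' t' s'' \<Longrightarrow> exec (Seq c d) s (t + t') s''"
| IfTrue: "val e s \<noteq> 0 \<Longrightarrow> exec c s t s' \<Longrightarrow> exec (If e c d) s (1 + expr_cost e s + t) s'"
| IfFalse: "val e s = 0 \<Longrightarrow> exec d s t s' \<Longrightarrow> exec (If e c d) s (1 + expr_cost e s + t) s'"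
| WhileFalse: "val e s = 0 \<Longrightarrow> exec (While e c) s (1 + expr_cost e s) s"
| WhileTrue: "val e s \<noteq> 0 \<Longrightarrow> exec c s t s' \<Longrightarrow> exec (While e c) s' t' s'' \<Longrightarrow>
    exec (While e c) s (1 + expr_cost e s + t + t') s''"

lemma exec_deterministic:
  "exec c s t s' \<Longrightarrow> exec c s u s'' \<Longrightarrow> t = u \<and> s' = s''"
proof (induction arbitrary: u s'' rule: exec.induct)
  case Skip
  then show ?case by (auto elim: exec.cases)
next
  case Assign
  then show ?case by (auto elim: exec.cases)
next
  case Store
  then show ?case by (auto elim: exec.cases)
next
  case Seq
  from Seq.prems show ?case by cases (use Seq.IH in blast)+
next
  case IfTrue
  from IfTrue.prems show ?case by cases (use IfTrue in blast)+
next
  case IfFalse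
  from IfFalse.prems show ?case by cases (use IfFalse in blast)+
next
  case WhileFalse
  from WhileFalse.prems show ?case by cases (use WhileFalse in blast)+
next
  case WhileTrue
  from WhileTrue.prems show ?case by cases (use WhileTrue in blast)+
qed

text \<open>The input word occupies the first memory cells; everything else is initially 0.\<close>

definition initial_state :: "nat list \<Rightarrow> state" where
  "initial_state w = (\<lambda>_. 0, \<lambda>i. if i < length w then w ! i else 0)"

text \<open>The answer is read off register 0: nonzero means yes.\<close>

definition decides_within :: "prog \<Rightarrow> nat list \<Rightarrow> bool \<Rightarrow> real \<Rightarrow> bool" where
  "decides_within c w answer T \<longleftrightarrow>
     (\<exists>t s. exec c (initial_state w) t s \<and> real t \<le> T \<and> (fst s 0 \<noteq> 0 \<longleftrightarrow> answer))"


section \<open>Encoding of the instances\<close>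

text \<open>
  A graph on the vertices \<open>0, \<dots>, n - 1\<close> is given by \<open>n\<close> and its adjacency matrix in row-major
  order. Then follow the binary digits of \<open>k\<close>, one per cell, least significant first. Digit 0
  is written as 1 and digit 1 as 2, so that the first cell containing 0 marks the end.
  As \<open>k\<close> is not stored in a single cell, a program can recognise a large \<open>k\<close> without paying
  for its whole length, and so time bounds in terms of \<open>n\<close> alone are possible for all \<open>k\<close>.
\<close>

definition adjacency_word :: "nat \<Rightarrow> nat set set \<Rightarrow> nat list" where
  "adjacency_word n E = map (\<lambda>i. if {i div n, i mod n} \<in> E then 1 else 0) [0..<n * n]"

definition binary_word :: "nat \<Rightarrow> nat list" where
  "binary_word k = map (\<lambda>i. if bit k i then 2 else 1) [0..<floorlog 2 k]"

definition instance_word :: "nat \<Rightarrow> nat set set \<Rightarrow> nat \<Rightarrow> nat list" where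
  "instance_word n E k = n # adjacency_word n E @ binary_word k"

end

theory Submission
  imports Defs "HOL-Analysis.Convex" "HOL-Library.Nat_Bijection"
begin

text \<open>
  In a \<open>k\<close>-colouring that minimises the sum of the colours, every vertex that has neither of the
  first two colours has a neighbour of each of them. So the set \<open>Y\<close> of these vertices is
  \<^emph>\<open>residual\<close>: every \<open>v \<in> Y\<close> has at least two neighbours outside \<open>Y\<close>. Conversely, \<open>G\<close> is
  \<open>k\<close>-colourable as soon as some residual \<open>Y\<close> is coverable by \<open>k - 2\<close> independent sets and its
  complement is bipartite.

  Residual sets are closed under subsets. Hence they can be enumerated vertex by vertex, and the
  number of covers of each of them by \<open>k - 2\<close> independent sets results from counting independent
  subsets, taking powers, and a Moebius transform, all within the family and with polynomially many
  steps per set. In the Moebius transform the intermediate values count the tuples that cover a part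
  of \<open>Y\<close>, so they never become negative.

  Of the \<open>2 ^ (\<Delta> + 1)\<close> traces on a closed neighbourhood of size \<open>\<Delta> + 1\<close> a residual set
  avoids \<open>\<Delta> + 1\<close>: the full one and those that lack only one neighbour of the centre. Shearer's
  inequality then bounds the number of residual sets.
\<close>

section \<open>Counting residual sets\<close>

text \<open>Why two colours are split off: with \<open>c\<close> of them, a vertex of
  \<open>Y\<close> would need \<open>c\<close> outside neighbours. One colour would exclude only the
  full trace. More colours would exclude more traces, but the complement would then have to be
  tested for \<open>c\<close>-colourability, which is polynomial for \<open>c = 2\<close> and
  NP-complete from \<open>c = 3\<close> on.

  The machine model adds two obstacles. A pass over a table of all subsets would already cost
  \<open>2 ^ n\<close>. So the value of a set is kept at an address computed from its code: any
  subset is found by one load, only cells of residual sets are ever used, nothing has to be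
  initialised, and a long address costs only its polynomially many digits. The other obstacle is
  \<open>k\<close>, which may be arbitrarily long. At most \<open>n + 1\<close> of its digits are
  looked at, and \<open>k \<ge> n\<close> is accepted at once. Hence the exponents stay below
  \<open>n\<close>, and all numbers have a polynomial number of digits.\<close>

lemma root_prod_add_le:
  fixes a b :: "'i \<Rightarrow> real"
  assumes "finite J" "J \<noteq> {}" and nonneg: "\<And>i. i \<in> J \<Longrightarrow> 0 \<le> a i" "\<And>i. i \<in> J \<Longrightarrow> 0 \<le> b i"
  shows "root (card J) (\<Prod>i\<in>J. a i) + root (card J) (\<Prod>i\<in>J. b i) \<le> root (card J) (\<Prod>i\<in>J. a i + b i)"
proof -
  have d: "card J > 0" using assms by (simp add: card_gt_0_iff)
  show ?thesis
  proof (cases "\<exists>i\<in>J. a i + b i = 0")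
    case True
    then obtain i where i: "i \<in> J" "a i + b i = 0" by blast
    then have "a i = 0" "b i = 0" using nonneg[of i] by auto
    then have "prod a J = 0" "prod b J = 0" "(\<Prod>i\<in>J. a i + b i) = 0"
      using assms(1) i by (auto intro!: prod_zero bexI[of _ i])
    then show ?thesis using d by simp
  next
    case False
    then have pos: "a i + b i > 0" if "i \<in> J" for i
      using nonneg[OF that] that by (smt (verit))
    let ?P = "\<Prod>i\<in>J. a i + b i"
    have P: "?P > 0" using pos by (intro prod_pos) auto
    \<comment> \<open>AM-GM for the ratios \<open>c i / (a i + b i)\<close>. For
      \<open>c = a\<close> and \<open>c = b\<close> the two arithmetic means add up to 1, which is
      the claim divided by the geometric mean of the \<open>a i + b i\<close>.\<close>
    have amgm: "root (card J) (\<Prod>i\<in>J. c i / (a i + b i)) \<le> (\<Sum>i\<in>J. c i / (a i + b i)) / card J"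
      if "\<And>i. i \<in> J \<Longrightarrow> 0 \<le> c i" for c :: "'i \<Rightarrow> real"
    proof -
      have "root (card J) (\<Prod>i\<in>J. c i / (a i + b i))
          = (\<Prod>i\<in>J. c i / (a i + b i)) powr (1 / card J)"
        using d that pos by (intro root_powr_inverse prod_nonneg) (auto simp: less_imp_le)
      also have "\<dots> \<le> (\<Sum>i\<in>J. c i / (a i + b i) / card J)"
        using assms(1,2) that pos by (intro arith_geom_mean) (auto simp: less_imp_le)
      finally show ?thesis by (simp add: sum_divide_distrib)
    qed
    have div: "root (card J) (\<Prod>i\<in>J. c i) / root (card J) ?P = root (card J) (\<Prod>i\<in>J. c i / (a i + b i))"
      for c :: "'i \<Rightarrow> real"
      by (simp add: prod_dividef real_root_divide)
    have "(root (card J) (prod a J) + root (card J) (prod b J)) / root (card J) ?P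
        \<le> (\<Sum>i\<in>J. a i / (a i + b i)) / card J + (\<Sum>i\<in>J. b i / (a i + b i)) / card J"
      unfolding add_divide_distrib div by (intro add_mono amgm nonneg)
    also have "\<dots> = (\<Sum>i\<in>J. (a i + b i) / (a i + b i)) / card J"
      by (simp only: sum.distrib add_divide_distrib)
    also have "(\<Sum>i\<in>J. (a i + b i) / (a i + b i)) = card J"
      using pos by (subst sum.cong[where h = "\<lambda>_. 1"]) fastforce+
    finally show ?thesis using d P by (simp add: divide_le_eq)
  qed
qed


text \<open>Induction on the ground set instead of entropy. Splitting \<open>F\<close> by membership
  of a new element \<open>x\<close> makes the trace counts add up on the \<open>A i\<close> that
  contain \<open>x\<close>; on the others each half has at most as many traces as \<open>F\<close>.
  As exactly \<open>d\<close> of the sets contain \<open>x\<close>, superadditivity of the geometric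
  mean of \<open>d\<close> numbers joins the two induction hypotheses.\<close>

lemma shearer:
  fixes A :: "'i \<Rightarrow> 'a set"
  assumes "finite U" "finite I" "d > 0" "\<And>x. x \<in> U \<Longrightarrow> card {i\<in>I. x \<in> A i} = d" "F \<subseteq> Pow U"
  shows "card F ^ d \<le> (\<Prod>i\<in>I. card ((\<lambda>X. X \<inter> A i) ` F))"
  using assms(1,4,5)
proof (induction U arbitrary: F rule: finite_induct)
  case empty
  then have "F = {} \<or> F = {{}}" by auto
  then show ?case using \<open>d > 0\<close> by (auto simp: zero_power)
next
  case (insert x U)
  define F0 where "F0 = {X\<in>F. x \<notin> X}"
  define F1 where "F1 = (\<lambda>X. X - {x}) ` {X\<in>F. x \<in> X}"
  define t a b where "t i = card ((\<lambda>X. X \<inter> A i) ` F)" and "a i = card ((\<lambda>X. X \<inter> A i) ` F0)"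
    and "b i = card ((\<lambda>X. X \<inter> A i) ` F1)" for i
  define J where "J = {i\<in>I. x \<in> A i}"
  have J: "finite J" "card J = d" "J \<subseteq> I" "J \<noteq> {}"
    using \<open>finite I\<close> insert.prems(1)[of x] \<open>d > 0\<close> card_gt_0_iff[of "{i\<in>I. x \<in> A i}"]
    unfolding J_def by auto
  have "finite F" using insert.prems(2) \<open>finite U\<close> by (meson finite_Pow_iff finite_insert finite_subset)
  then have fin: "finite F0" "finite F1" by (auto simp: F0_def F1_def)
  have F01: "F0 \<subseteq> Pow U" "F1 \<subseteq> Pow U" using insert.prems(2) by (auto simp: F0_def F1_def)
  have "inj_on (\<lambda>X. X - {x}) {X\<in>F. x \<in> X}" by (auto simp: inj_on_def)
  then have "card F1 = card {X\<in>F. x \<in> X}" by (simp add: F1_def card_image)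
  moreover have "card F = card {X\<in>F. x \<notin> X} + card {X\<in>F. x \<in> X}"
    using \<open>finite F\<close> by (subst card_Un_disjoint[symmetric]) (auto intro: arg_cong[where f = card])
  ultimately have cardF: "card F = card F0 + card F1" by (simp add: F0_def)
  have at: "a i \<le> t i" for i
    unfolding a_def t_def by (intro card_mono image_mono) (auto simp: F0_def \<open>finite F\<close>)
  have bt: "b i \<le> t i" if "x \<notin> A i" for i
  proof -
    have "(\<lambda>X. X \<inter> A i) ` F1 \<subseteq> (\<lambda>X. X \<inter> A i) ` F"
    proof
      fix Y assume "Y \<in> (\<lambda>X. X \<inter> A i) ` F1"
      then obtain X where X: "X \<in> F" "Y = (X - {x}) \<inter> A i" by (auto simp: F1_def)
      then have "Y = X \<inter> A i" using that by auto
      then show "Y \<in> (\<lambda>X. X \<inter> A i) ` F" using X by auto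
    qed
    then show ?thesis unfolding b_def t_def using \<open>finite F\<close> by (intro card_mono) auto
  qed
  \<comment> \<open>Putting \<open>x\<close> back into the traces of \<open>F1\<close> makes them
    different from all traces of \<open>F0\<close>.\<close>
  have abt: "a i + b i \<le> t i" if "x \<in> A i" for i
  proof -
    let ?f = "\<lambda>X. X \<inter> A i"
    have "inj_on (insert x) (?f ` F1)" by (auto simp: inj_on_def F1_def)
    then have "b i = card (insert x ` ?f ` F1)" by (simp add: b_def card_image)
    moreover have "card (?f ` F0 \<union> insert x ` ?f ` F1) = card (?f ` F0) + card (insert x ` ?f ` F1)"
      using fin by (intro card_Un_disjoint) (auto simp: F0_def)
    moreover have "?f ` F0 \<union> insert x ` ?f ` F1 \<subseteq> ?f ` F"
    proof -
      have "insert x ((X - {x}) \<inter> A i) = ?f X" if "x \<in> X" for X using that \<open>x \<in> A i\<close> by auto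
      then show ?thesis by (auto simp: F0_def F1_def)
    qed
    ultimately show ?thesis unfolding a_def t_def using \<open>finite F\<close> by (metis card_mono finite_imageI)
  qed
  have IH: "card F0 ^ d \<le> prod a I" "card F1 ^ d \<le> prod b I"
    unfolding a_def b_def using insert.IH F01 insert.prems(1) by auto
  define T where "T = (\<Prod>i\<in>I-J. real (t i))"
  have split: "prod f I = prod f (I - J) * prod f J" for f :: "'i \<Rightarrow> real"
    using prod.subset_diff[OF J(3) \<open>finite I\<close>] .
  \<comment> \<open>\<open>T\<close> collects the factors of the sets without \<open>x\<close>. It
    serves both halves and can be pulled out of the sum of the two roots.\<close>
  have part: "real x \<le> root d T * root d (\<Prod>i\<in>J. real (c i))"
    if "x ^ d \<le> prod c I" "\<And>i. i \<in> I - J \<Longrightarrow> c i \<le> t i" for x and c :: "'i \<Rightarrow> nat"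
  proof -
    have "real x ^ d \<le> (\<Prod>i\<in>I. real (c i))"
      using that(1) by (metis of_nat_le_iff of_nat_power of_nat_prod)
    also have "\<dots> = (\<Prod>i\<in>I-J. real (c i)) * (\<Prod>i\<in>J. real (c i))" by (rule split)
    also have "\<dots> \<le> T * (\<Prod>i\<in>J. real (c i))"
      unfolding T_def using that(2) by (intro mult_right_mono prod_mono prod_nonneg) auto
    finally have "root d (real x ^ d) \<le> root d (T * (\<Prod>i\<in>J. real (c i)))" using \<open>d > 0\<close> by simp
    then show ?thesis using \<open>d > 0\<close> by (simp add: real_root_mult real_root_power_cancel)
  qed
  have "real (card F) \<le> root d T * (root d (\<Prod>i\<in>J. real (a i)) + root d (\<Prod>i\<in>J. real (b i)))"
    unfolding cardF distrib_left of_nat_add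
    by (intro add_mono part IH at bt) (auto simp: J_def)
  also have "\<dots> \<le> root d T * root d (\<Prod>i\<in>J. real (a i) + real (b i))"
    using root_prod_add_le[of J a b] J \<open>d > 0\<close>
    by (intro mult_left_mono) (auto simp: T_def prod_nonneg)
  also have "\<dots> = root d (T * (\<Prod>i\<in>J. real (a i) + real (b i)))" by (simp add: real_root_mult)
  also have "\<dots> \<le> root d (T * (\<Prod>i\<in>J. real (t i)))"
    using abt \<open>d > 0\<close>
    by (intro real_root_le_mono mult_left_mono prod_mono) (fastforce simp: J_def T_def intro!: prod_nonneg)+
  also have "\<dots> = root d (\<Prod>i\<in>I. real (t i))" by (simp add: T_def split[symmetric])
  finally have "real (card F) ^ d \<le> root d (\<Prod>i\<in>I. real (t i)) ^ d" by (intro power_mono) auto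
  also have "\<dots> = (\<Prod>i\<in>I. real (t i))" using \<open>d > 0\<close> by (intro real_root_pow_pos2 prod_nonneg) auto
  finally have "real (card F ^ d) \<le> real (\<Prod>i\<in>I. t i)" by simp
  then show ?case unfolding t_def by (simp only: of_nat_le_iff)
qed

definition residual :: "'a set \<Rightarrow> 'a set set \<Rightarrow> 'a set set" where
  "residual V E = {Y. Y \<subseteq> V \<and> (\<forall>v\<in>Y. 2 \<le> card {u \<in> V - Y. {u, v} \<in> E})}"

lemma xor_lt_power_2:
  fixes i j :: nat
  assumes "i < 2 ^ m" "j < 2 ^ m"
  shows "xor i j < 2 ^ m"
proof -
  have "take_bit m (xor i j) = xor (take_bit m i) (take_bit m j)" by (rule take_bit_xor)
  then have "take_bit m (xor i j) = xor i j" using assms by (simp only: take_bit_nat_eq_self)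
  then show ?thesis by (metis take_bit_nat_less_exp)
qed

text \<open>
  Vertices of degree less than \<open>\<Delta>\<close> are dealt with by taking \<open>2 ^ \<Delta>\<close> copies of the graph and
  padding the closed neighbourhoods with copies of their centres, so that each set has \<open>\<Delta> + 1\<close>
  elements and each element lies in \<open>\<Delta> + 1\<close> sets.
\<close>

lemma card_residual_power_le:
  assumes G: "simple_graph V E" "max_degree V E = \<Delta>"
  shows "card (residual V E) ^ (\<Delta> + 1) \<le> (2 ^ (\<Delta> + 1) - (\<Delta> + 1)) ^ card V"
proof -
  define m :: nat where "m = 2 ^ \<Delta>"
  define N where "N v = {u\<in>V. {u, v} \<in> E}" for v
  \<comment> \<open>Translations of \<open>{..<2 ^ \<Delta>}\<close> as a group under xor. Every
    element is its own inverse, which makes the padding relation symmetric; starting at 1 avoids the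
    copy \<open>j\<close> itself. By \<open>\<Delta> < 2 ^ \<Delta>\<close> there are enough
    copies.\<close>
  define C where "C r j = (\<lambda>i. xor i j) ` {1..r}" for r j :: nat
  define A where "A p = insert (fst p) (N (fst p)) \<times> {snd p} \<union> {fst p} \<times> C (\<Delta> - card (N (fst p))) (snd p)" for p
  define U where "U = V \<times> {..<m}"
  have finV: "finite V" using G by (simp add: simple_graph_def)
  have finN: "finite (N v)" and Nirr: "v \<notin> N v" and NV: "N v \<subseteq> V" for v
    using G by (auto simp: N_def simple_graph_def doubleton_eq_iff)
  have Nsym: "u \<in> N v \<longleftrightarrow> v \<in> N u" if "u \<in> V" "v \<in> V" for u v
    using that by (auto simp: N_def insert_commute)
  have cardN: "card (N v) \<le> \<Delta>" if "v \<in> V" for v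
    using that finV G(2) unfolding max_degree_def N_def degree_of_def by (metis (mono_tags, lifting) Max_ge finite_imageI finite_insert image_eqI insertCI)
  have xx: "xor (xor i j) j = i" for i j :: nat
    by (simp add: xor.assoc)
  have Ccard: "card (C r j) = r" for r j
  proof -
    have "inj_on (\<lambda>i. xor i j) {1..r}" by (metis inj_onI xx)
    then show ?thesis by (simp add: C_def card_image)
  qed
  have Cfin: "finite (C r j)" for r j by (simp add: C_def)
  have Csym: "l \<in> C r j \<longleftrightarrow> j \<in> C r l" for r j l
    unfolding C_def by (metis (no_types, lifting) image_iff xor.commute xx)
  have Cirr: "j \<notin> C r j" for r j
  proof
    assume "j \<in> C r j"
    then obtain i where "i \<in> {1..r}" "j = xor i j" by (auto simp: C_def)
    then have "xor j j = i" by (metis xx)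
    then show False using \<open>i \<in> {1..r}\<close> by simp
  qed
  have CU: "C (\<Delta> - s) j \<subseteq> {..<m}" if "j < m" for j s
  proof -
    have "i < 2 ^ \<Delta>" if "i \<le> \<Delta> - s" for i
      using that less_exp[of \<Delta>] by linarith
    then show ?thesis using that unfolding C_def m_def by (auto intro!: xor_lt_power_2)
  qed
  have cardA: "card (A p) = \<Delta> + 1" "A p \<subseteq> U" "p \<in> A p" "finite (A p)" if "p \<in> U" for p
  proof -
    have v: "fst p \<in> V" "snd p < m" using that by (auto simp: U_def)
    have "card (A p) = card (insert (fst p) (N (fst p)) \<times> {snd p}) + card ({fst p} \<times> C (\<Delta> - card (N (fst p))) (snd p))"
      unfolding A_def using finN Cfin Cirr by (intro card_Un_disjoint) auto
    also have "\<dots> = Suc (card (N (fst p))) + (\<Delta> - card (N (fst p)))"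
      using finN Nirr Ccard by (simp only: card_cartesian_product card_insert_disjoint) simp
    finally show "card (A p) = \<Delta> + 1" using cardN[OF v(1)] by simp
    show "A p \<subseteq> U" using v NV CU by (auto simp: A_def U_def subset_iff)
    show "p \<in> A p" by (cases p) (simp add: A_def)
    show "finite (A p)" by (simp add: A_def finN Cfin)
  qed
  have Asym: "q \<in> A p \<longleftrightarrow> p \<in> A q" if "p \<in> U" "q \<in> U" for p q
    using that Nsym Csym by (cases p; cases q) (auto simp: A_def U_def)
  \<comment> \<open>By symmetry the sets through \<open>q\<close> are indexed by \<open>A q\<close>,
    so equal sizes give equal covering multiplicities.\<close>
  have reg: "card {p\<in>U. q \<in> A p} = \<Delta> + 1" if "q \<in> U" for q
  proof -
    have "{p\<in>U. q \<in> A p} = A q" using Asym[OF _ that] cardA(2)[OF that] by blast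
    then show ?thesis using cardA that by simp
  qed
  \<comment> \<open>Independent choices of a residual set in each copy. The size is at least an
    \<open>m\<close>-th power, so the bound for one graph comes back by cancelling the exponent
    \<open>m\<close> at the end.\<close>
  define F where "F = {Y\<in>Pow U. \<forall>j<m. {v. (v, j) \<in> Y} \<in> residual V E}"
  have finU: "finite U" using finV by (simp add: U_def)
  have "card (residual V E) ^ m \<le> card F"
  proof -
    let ?h = "\<lambda>G. {(v, j). j < m \<and> v \<in> G j}"
    have "inj_on ?h (PiE {..<m} (\<lambda>_. residual V E))"
    proof (rule inj_onI)
      fix G H assume GH: "G \<in> PiE {..<m} (\<lambda>_. residual V E)" "H \<in> PiE {..<m} (\<lambda>_. residual V E)" "?h G = ?h H"
      have "v \<in> G j \<longleftrightarrow> v \<in> H j" if "j < m" for v j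
      proof -
        have "(v, j) \<in> ?h G \<longleftrightarrow> (v, j) \<in> ?h H" by (simp only: GH(3))
        then show ?thesis using that by simp
      qed
      then have "G j = H j" if "j < m" for j using that by blast
      then show "G = H" using GH by (intro PiE_ext) auto
    qed
    moreover have "?h ` PiE {..<m} (\<lambda>_. residual V E) \<subseteq> F"
      by (auto simp: F_def U_def residual_def PiE_iff)
    moreover have "finite F" using finU by (simp add: F_def)
    ultimately have "card (PiE {..<m} (\<lambda>_. residual V E)) \<le> card F" by (rule card_inj_on_le)
    then show ?thesis by (simp add: card_PiE)
  qed
  then have "(card (residual V E) ^ m) ^ (\<Delta> + 1) \<le> card F ^ (\<Delta> + 1)" by (intro power_mono) auto
  also have "\<dots> \<le> (\<Prod>p\<in>U. card ((\<lambda>X. X \<inter> A p) ` F))"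
    using finU reg by (intro shearer[of U]) (auto simp: F_def)
  also have "\<dots> \<le> (\<Prod>p\<in>U. 2 ^ (\<Delta> + 1) - (\<Delta> + 1))"
  proof (intro prod_mono conjI)
    fix p assume p: "p \<in> U"
    \<comment> \<open>The \<open>\<Delta> + 1\<close> impossible traces: each contains the centre
      \<open>p\<close> and misses at most one element of \<open>A p\<close>, whereas a centre in the
      set has two neighbours outside, and their copies lie in \<open>A p\<close>.\<close>
    define W where "W = insert (A p) ((\<lambda>x. A p - {x}) ` (A p - {p}))"
    have "card W = \<Delta> + 1"
    proof -
      have "inj_on (\<lambda>x. A p - {x}) (A p - {p})" by (auto simp: inj_on_def)
      then have "card ((\<lambda>x. A p - {x}) ` (A p - {p})) = \<Delta>" using cardA[OF p] by (simp add: card_image)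
      then show ?thesis unfolding W_def using cardA(4)[OF p] by (subst card_insert_disjoint) auto
    qed
    moreover have "(\<lambda>X. X \<inter> A p) ` F \<subseteq> Pow (A p) - W"
    proof
      fix T assume "T \<in> (\<lambda>X. X \<inter> A p) ` F"
      then obtain Y where Y: "Y \<in> F" "T = Y \<inter> A p" by auto
      obtain v j where vj: "p = (v, j)" "v \<in> V" "j < m" using p by (auto simp: U_def)
      have False if "T \<in> W"
      proof -
        have "p \<in> T" using that cardA(3)[OF p] by (auto simp: W_def)
        then have "v \<in> {v. (v, j) \<in> Y}" using Y vj by auto
        then have "2 \<le> card {u \<in> V - {v. (v, j) \<in> Y}. {u, v} \<in> E}"
          using Y(1) vj(3) unfolding F_def residual_def by blast
        also have "\<dots> = card ((\<lambda>u. (u, j)) ` {u \<in> V - {v. (v, j) \<in> Y}. {u, v} \<in> E})"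
          by (intro card_image[symmetric]) (auto simp: inj_on_def)
        also have "\<dots> \<le> card (A p - T)"
          using cardA(4)[OF p] Y vj by (intro card_mono) (auto simp: A_def N_def)
        also have "\<dots> \<le> 1"
        proof -
          have "\<exists>x. A p - T \<subseteq> {x}" using that unfolding W_def by auto
          then obtain x where "A p - T \<subseteq> {x}" ..
          then show ?thesis by (metis card_mono finite.emptyI finite_insert is_singletonI is_singleton_altdef)
        qed
        finally show False by simp
      qed
      then show "T \<in> Pow (A p) - W" using Y by auto
    qed
    ultimately have "card ((\<lambda>X. X \<inter> A p) ` F) \<le> card (Pow (A p) - W)"
      using cardA(4)[OF p] by (intro card_mono) auto
    also have "\<dots> = card (Pow (A p)) - card W"
      using cardA(4)[OF p] by (intro card_Diff_subset) (auto simp: W_def)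
    finally show "card ((\<lambda>X. X \<inter> A p) ` F) \<le> 2 ^ (\<Delta> + 1) - (\<Delta> + 1)"
      using \<open>card W = \<Delta> + 1\<close> cardA[OF p] by (simp add: card_Pow)
  qed auto
  also have "\<dots> = ((2 ^ (\<Delta> + 1) - (\<Delta> + 1)) ^ card V) ^ m"
    by (simp add: U_def card_cartesian_product power_mult)
  finally have "(card (residual V E) ^ (\<Delta> + 1)) ^ m \<le> ((2 ^ (\<Delta> + 1) - (\<Delta> + 1)) ^ card V) ^ m"
    by (simp only: power_mult[symmetric] mult.commute)
  then show ?thesis by (subst (asm) power_mono_iff) (simp_all add: m_def)
qed

lemma card_residual_le:
  assumes "simple_graph V E" "max_degree V E = \<Delta>"
  shows "real (card (residual V E)) \<le> (2 ^ (\<Delta> + 1) - real \<Delta> - 1) powr (real (card V) / (real \<Delta> + 1))"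
proof -
  define c :: real where "c = 2 ^ (\<Delta> + 1) - real \<Delta> - 1"
  \<comment> \<open>Makes the truncated subtraction exact and the base at least 1.\<close>
  have le: "\<Delta> + 2 \<le> 2 ^ (\<Delta> + 1)" by (induction \<Delta>) auto
  have c: "real (2 ^ (\<Delta> + 1) - (\<Delta> + 1)) = c" using le by (subst of_nat_diff) (auto simp: c_def)
  moreover have "1 \<le> 2 ^ (\<Delta> + 1) - (\<Delta> + 1)" using le by linarith
  ultimately have c1: "c \<ge> 1" by (metis of_nat_1 of_nat_mono)
  have "real (card (residual V E) ^ (\<Delta> + 1)) \<le> real ((2 ^ (\<Delta> + 1) - (\<Delta> + 1)) ^ card V)"
    using card_residual_power_le[OF assms] by (simp only: of_nat_le_iff)
  then have "real (card (residual V E)) ^ (\<Delta> + 1) \<le> c ^ card V"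
    by (simp only: of_nat_power c)
  also have "c ^ card V = c powr (real (card V))" using c1 by (simp add: powr_realpow)
  also have "\<dots> = (c powr (real (card V) / (real \<Delta> + 1))) powr (real \<Delta> + 1)"
    by (simp add: powr_powr)
  also have "\<dots> = (c powr (real (card V) / (real \<Delta> + 1))) ^ (\<Delta> + 1)"
    using c1 by (subst powr_realpow[symmetric]) (auto simp: add.commute)
  finally show ?thesis unfolding c_def by (subst (asm) power_mono_iff) auto
qed

section \<open>Colourings\<close>

lemma coverable_iff_proper_colouring: "coverable V E k \<longleftrightarrow> (\<exists>f. proper_colouring V E k f)"
proof
  assume "coverable V E k"
  then obtain S where S: "\<And>i. i < k \<Longrightarrow> independent_set V E (S i)" "V = (\<Union>i<k. S i)"
    by (auto simp: coverable_def)
  then have "\<forall>v\<in>V. \<exists>i. i < k \<and> v \<in> S i" by auto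
  then obtain f where "\<forall>v\<in>V. f v < k \<and> v \<in> S (f v)" by metis
  then have "proper_colouring V E k f"
    using S(1) unfolding proper_colouring_def independent_set_def by metis
  then show "\<exists>f. proper_colouring V E k f" by blast
next
  assume "\<exists>f. proper_colouring V E k f"
  then obtain f where "proper_colouring V E k f" by blast
  then show "coverable V E k"
    unfolding coverable_def proper_colouring_def independent_set_def
    by (intro exI[of _ "\<lambda>i. {v\<in>V. f v = i}"]) fastforce
qed

lemma coverable_mono:
  assumes "coverable V E k" "k \<le> l"
  shows "coverable V E l"
proof -
  obtain f where "proper_colouring V E k f" using assms(1) coverable_iff_proper_colouring by blast
  then have "proper_colouring V E l f"
    using assms(2) unfolding proper_colouring_def by (auto intro: less_le_trans)
  then show ?thesis using coverable_iff_proper_colouring by blast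
qed

lemma no_loop:
  assumes "simple_graph V E"
  shows "{v} \<notin> E"
proof
  assume "{v} \<in> E"
  then obtain a b where "{v} = {a, b}" "a \<noteq> b" using assms unfolding simple_graph_def by blast
  then show False by auto
qed

lemma coverable_card:
  fixes n :: nat
  assumes "simple_graph {..<n} E"
  shows "coverable {..<n} E n"
proof -
  have "u \<noteq> v" if "{u, v} \<in> E" for u v using no_loop[OF assms, of u] that by auto
  then have "proper_colouring {..<n} E n id" by (simp add: proper_colouring_def)
  then show ?thesis unfolding coverable_iff_proper_colouring by blast
qed

lemma coverable_iff_chromatic_number:
  fixes n :: nat
  assumes "simple_graph {..<n} E"
  shows "coverable {..<n} E k \<longleftrightarrow> chromatic_number {..<n} E \<le> k"
proof
  assume "coverable {..<n} E k"
  then show "chromatic_number {..<n} E \<le> k"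
    unfolding chromatic_number_def coverable_iff_proper_colouring by (rule Least_le)
next
  have "coverable {..<n} E (chromatic_number {..<n} E)"
    using coverable_card[OF assms] unfolding chromatic_number_def coverable_iff_proper_colouring by (rule LeastI)
  then show "chromatic_number {..<n} E \<le> k \<Longrightarrow> coverable {..<n} E k" by (rule coverable_mono)
qed

text \<open>The form covers small \<open>k\<close> uniformly: for \<open>k < 2\<close> the truncated
  \<open>k - 2\<close> is 0, which forces \<open>Y\<close> to be empty, and \<open>min k 2\<close>
  leaves just \<open>k\<close> colours for the complement.\<close>

lemma coverable_iff_residual:
  assumes G: "simple_graph V E"
  shows "coverable V E k \<longleftrightarrow>
    (\<exists>Y\<in>residual V E. coverable Y E (k - 2) \<and> coverable (V - Y) E (min k 2))"
proof
  have finV: "finite V" using G by (simp add: simple_graph_def)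
  assume "coverable V E k"
  then obtain f where f: "proper_colouring V E k f"
    and min: "\<And>g. proper_colouring V E k g \<Longrightarrow> sum f V \<le> sum g V"
    using ex_has_least_nat[of "proper_colouring V E k" _ "\<lambda>f. sum f V"]
    unfolding coverable_iff_proper_colouring by metis
  \<comment> \<open>Otherwise giving \<open>v\<close> the colour \<open>c\<close> would keep the
    colouring proper and lower the sum.\<close>
  have greedy: "\<exists>u\<in>V. {u, v} \<in> E \<and> f u = c" if "v \<in> V" "c < f v" for v c
  proof (rule ccontr)
    assume contra: "\<not> ?thesis"
    have "{v} \<notin> E" using G by (rule no_loop)
    then have "proper_colouring V E k (f(v := c))"
      using f that contra unfolding proper_colouring_def
      by (auto simp: insert_commute)
    then have "sum f V \<le> sum (f(v := c)) V" by (rule min)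
    also have "\<dots> < sum f V"
      using finV that by (intro sum_strict_mono_ex1) (auto intro!: bexI[of _ v])
    finally show False by simp
  qed
  define Y where "Y = {v\<in>V. 2 \<le> f v}"
  have "2 \<le> card {u \<in> V - Y. {u, v} \<in> E}" if "v \<in> Y" for v
  proof -
    have v: "v \<in> V" "0 < f v" "1 < f v" using that by (auto simp: Y_def)
    obtain x y where xy: "x \<in> V" "{x, v} \<in> E" "f x = 0" "y \<in> V" "{y, v} \<in> E" "f y = 1"
      using greedy[OF v(1,2)] greedy[OF v(1,3)] by blast
    then have "{x, y} \<subseteq> {u \<in> V - Y. {u, v} \<in> E}" by (auto simp: Y_def)
    then have "card {x, y} \<le> card {u \<in> V - Y. {u, v} \<in> E}" using finV by (intro card_mono) auto
    moreover have "x \<noteq> y" using xy by auto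
    ultimately show ?thesis by simp
  qed
  then have "Y \<in> residual V E" by (auto simp: residual_def Y_def)
  moreover have "coverable Y E (k - 2)"
    unfolding coverable_iff_proper_colouring
  proof (intro exI)
    show "proper_colouring Y E (k - 2) (\<lambda>v. f v - 2)"
      using f unfolding proper_colouring_def Y_def by (fastforce simp: less_diff_conv2)
  qed
  moreover have "coverable (V - Y) E (min k 2)"
    unfolding coverable_iff_proper_colouring
    using f by (intro exI[of _ f]) (auto simp: proper_colouring_def Y_def not_le)
  ultimately show "\<exists>Y\<in>residual V E. coverable Y E (k - 2) \<and> coverable (V - Y) E (min k 2)"
    by blast
next
  assume "\<exists>Y\<in>residual V E. coverable Y E (k - 2) \<and> coverable (V - Y) E (min k 2)"
  then obtain Y f g where f: "proper_colouring Y E (k - 2) f"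
    and g: "proper_colouring (V - Y) E (min k 2) g"
    unfolding coverable_iff_proper_colouring by blast
  have "proper_colouring V E k (\<lambda>v. if v \<in> Y then f v + 2 else g v)"
    unfolding proper_colouring_def
  proof (intro conjI ballI impI)
    fix v assume "v \<in> V"
    then show "(if v \<in> Y then f v + 2 else g v) < k"
      using f g unfolding proper_colouring_def by (auto simp: less_diff_conv)
  next
    fix u v assume "u \<in> V" "v \<in> V" "{u, v} \<in> E"
    moreover have "g w < 2" if "w \<in> V" "w \<notin> Y" for w
      using g that unfolding proper_colouring_def by auto
    then have "g w \<noteq> f x + 2" if "w \<in> V" "w \<notin> Y" for w x
      using that by (metis not_add_less2)
    ultimately show "(if u \<in> Y then f u + 2 else g u) \<noteq> (if v \<in> Y then f v + 2 else g v)"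
      using f g unfolding proper_colouring_def by (auto; metis)
  qed
  then show "coverable V E k" unfolding coverable_iff_proper_colouring by blast
qed

section \<open>Counting independent sets and covering tuples\<close>

definition independent_count :: "'a set set \<Rightarrow> 'a set \<Rightarrow> nat" where
  "independent_count E Y = card {S. independent_set Y E S}"

lemma finite_independent_sets: "finite Y \<Longrightarrow> finite {S. independent_set Y E S}"
  by (rule finite_subset[of _ "Pow Y"]) (auto simp: independent_set_def)

lemma independent_count_empty: "independent_count E {} = 1"
proof -
  have "{S. independent_set {} E S} = {{}}" by (auto simp: independent_set_def)
  then show ?thesis by (simp add: independent_count_def)
qed

lemma independent_count_le: "finite Y \<Longrightarrow> independent_count E Y \<le> 2 ^ card Y"
  unfolding independent_count_def
  by (subst card_Pow[symmetric], assumption, intro card_mono) (auto simp: independent_set_def)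

text \<open>Case distinction on whether \<open>j\<close> is chosen. Both arguments on the right are
  subsets of \<open>Y\<close>, so the recurrence never leaves a family closed under subsets.\<close>

lemma independent_count_insert:
  assumes "finite Y" "j \<notin> Y" "{j} \<notin> E"
  shows "independent_count E (insert j Y) = independent_count E Y + independent_count E (Y - {u. {j, u} \<in> E})"
proof -
  let ?N = "{u. {j, u} \<in> E}" and ?I = "\<lambda>Y. {S. independent_set Y E S}"
  have "?I (insert j Y) \<subseteq> ?I Y \<union> insert j ` ?I (Y - ?N)"
  proof
    fix S assume S: "S \<in> ?I (insert j Y)"
    show "S \<in> ?I Y \<union> insert j ` ?I (Y - ?N)"
    proof (cases "j \<in> S")
      case True
      then have "S - {j} \<in> ?I (Y - ?N)" "S = insert j (S - {j})"
        using S by (auto simp: independent_set_def)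
      then show ?thesis by blast
    next
      case False
      then show ?thesis using S by (auto simp: independent_set_def)
    qed
  qed
  moreover have "?I Y \<union> insert j ` ?I (Y - ?N) \<subseteq> ?I (insert j Y)"
    using assms by (auto simp: independent_set_def insert_commute)
  ultimately have "?I (insert j Y) = ?I Y \<union> insert j ` ?I (Y - ?N)" by (rule antisym)
  moreover have "inj_on (insert j) (?I (Y - ?N))"
    using assms by (auto simp: inj_on_def independent_set_def insert_ident subset_iff)
  moreover have "?I Y \<inter> insert j ` ?I (Y - ?N) = {}" using assms by (auto simp: independent_set_def)
  ultimately show ?thesis
    unfolding independent_count_def using assms(1)
    by (simp only: card_image card_Un_disjoint finite_independent_sets finite_imageI finite_Diff)
qed

text \<open>What the Moebius transform holds once the vertices of \<open>J\<close> have been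
  treated. \<open>J\<close> grows from the empty set, where the number of tuples is a power of
  \<open>independent_count\<close>, to the whole vertex set.\<close>

definition covering_tuples :: "'a set set \<Rightarrow> nat \<Rightarrow> 'a set \<Rightarrow> 'a set \<Rightarrow> 'a set list set" where
  "covering_tuples E m J Y =
     {ss. set ss \<subseteq> {S. independent_set Y E S} \<and> length ss = m \<and> Y \<inter> J \<subseteq> \<Union> (set ss)}"

lemma finite_covering_tuples: "finite Y \<Longrightarrow> finite (covering_tuples E m J Y)"
  using finite_lists_length_eq[OF finite_independent_sets, of Y E m]
  by (rule finite_subset[rotated]) (auto simp: covering_tuples_def)

lemma card_covering_tuples_empty:
  "finite Y \<Longrightarrow> card (covering_tuples E m {} Y) = independent_count E Y ^ m"
  using card_lists_length_eq[OF finite_independent_sets, of Y E m]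
  by (simp add: covering_tuples_def independent_count_def)

lemma covering_tuples_insert_notin:
  "j \<notin> Y \<Longrightarrow> covering_tuples E m (insert j J) Y = covering_tuples E m J Y"
  by (simp add: covering_tuples_def)

text \<open>The tuples that miss \<open>j\<close> are exactly the tuples for \<open>Y - {j}\<close>.
  They form a subset, so the truncated subtraction is exact.\<close>

lemma card_covering_tuples_insert:
  assumes "finite Y" "j \<in> Y" "j \<notin> J"
  shows "card (covering_tuples E m (insert j J) Y)
    = card (covering_tuples E m J Y) - card (covering_tuples E m J (Y - {j}))"
proof -
  have "covering_tuples E m J (Y - {j}) = {ss \<in> covering_tuples E m J Y. j \<notin> \<Union> (set ss)}"
    using assms by (auto simp: covering_tuples_def independent_set_def subset_iff; blast)
  moreover have "covering_tuples E m (insert j J) Y = {ss \<in> covering_tuples E m J Y. j \<in> \<Union> (set ss)}"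
    using assms by (auto simp: covering_tuples_def)
  ultimately have "covering_tuples E m (insert j J) Y = covering_tuples E m J Y - covering_tuples E m J (Y - {j})"
      and "covering_tuples E m J (Y - {j}) \<subseteq> covering_tuples E m J Y"
    by auto
  then show ?thesis
    using assms(1) by (simp add: card_Diff_subset finite_covering_tuples)
qed

lemma card_covering_tuples_neq_0_iff:
  assumes "finite Y" "Y \<subseteq> J"
  shows "card (covering_tuples E m J Y) \<noteq> 0 \<longleftrightarrow> coverable Y E m"
proof -
  have "covering_tuples E m J Y \<noteq> {} \<longleftrightarrow> coverable Y E m"
  proof
    assume "covering_tuples E m J Y \<noteq> {}"
    then obtain ss where "ss \<in> covering_tuples E m J Y" by blast
    then have ss: "\<And>S. S \<in> set ss \<Longrightarrow> independent_set Y E S" "length ss = m" "Y \<subseteq> \<Union> (set ss)"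
      using assms(2) by (auto simp: covering_tuples_def)
    then have "\<Union> (set ss) = Y" by (auto simp: independent_set_def)
    moreover have "\<Union> (set ss) = (\<Union>i<m. ss ! i)"
      using ss(2) by (simp add: set_conv_nth) blast
    ultimately show "coverable Y E m"
      unfolding coverable_def using ss(1,2) by (intro exI[of _ "\<lambda>i. ss ! i"]) auto
  next
    assume "coverable Y E m"
    then obtain S where S: "\<And>i. i < m \<Longrightarrow> independent_set Y E (S i)" "Y = (\<Union>i<m. S i)"
      by (auto simp: coverable_def)
    have "\<Union> (set (map S [0..<m])) = Y" by (simp only: S(2) set_map set_upt atLeast0LessThan)
    then have "map S [0..<m] \<in> covering_tuples E m J Y"
      unfolding covering_tuples_def using S(1) by auto
    then show "covering_tuples E m J Y \<noteq> {}" by blast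
  qed
  then show ?thesis using finite_covering_tuples[OF assms(1), of E m J] by (simp add: card_eq_0_iff)
qed

section \<open>Two-colourability by signed labels\<close>

definition separates :: "(nat \<times> nat) set \<Rightarrow> (nat \<Rightarrow> bool) \<Rightarrow> bool" where
  "separates P g \<longleftrightarrow> (\<forall>u v. (u, v) \<in> P \<longrightarrow> g u \<noteq> g v)"

text \<open>
  Signed labels for testing bipartiteness: \<open>x\<close> and \<open>2 * n - x\<close> are opposite labels, and no
  label is \<open>n\<close>. Equal labels force equal colours and opposite labels force different colours.
\<close>

definition labelling :: "nat \<Rightarrow> nat \<Rightarrow> (nat \<times> nat) set \<Rightarrow> (nat \<Rightarrow> nat) \<Rightarrow> bool \<Rightarrow> bool" where
  "labelling n k P L b \<longleftrightarrow> (\<forall>w<n. L w \<le> 2 * n \<and> L w \<noteq> n)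
    \<and> (if b then (\<forall>u v. (u, v) \<in> P \<longrightarrow> L u + L v = 2 * n) \<and> (P = {} \<or> 2 \<le> k)
       else P \<noteq> {} \<and> (2 \<le> k \<longrightarrow> \<not> (\<exists>g. separates P g)))
    \<and> (\<forall>g. separates P g \<longrightarrow>
        (\<forall>u<n. \<forall>w<n. (L u = L w \<longrightarrow> g u = g w) \<and> (L u + L w = 2 * n \<longrightarrow> g u \<noteq> g w)))"

text \<open>The union step for an edge whose ends have the labels \<open>a\<close> and
  \<open>b\<close>: the class of \<open>b\<close> is identified with the opposite of
  \<open>a\<close>, and the opposite of \<open>b\<close> with \<open>a\<close>.\<close>

definition merge_label :: "nat \<Rightarrow> nat \<Rightarrow> nat \<Rightarrow> nat \<Rightarrow> nat" where
  "merge_label n a b c = (if c = b then 2 * n - a else if c + b = 2 * n then a else c)"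

text \<open>Vertices as their own labels: distinct, and all below \<open>n\<close>, so that no two
  of them are opposite.\<close>

lemma labelling_empty: "labelling n k {} (\<lambda>v. v) True"
  unfolding labelling_def by auto

lemma labelling_insert:
  assumes L: "labelling n k P L b" and uv: "u < n" "v < n" and P: "P \<subseteq> {..<n} \<times> {..<n}"
  shows "labelling n k (insert (u, v) P) (\<lambda>w. merge_label n (L u) (L v) (L w)) (b \<and> 2 \<le> k \<and> L u \<noteq> L v)"
proof -
  let ?L = "\<lambda>w. merge_label n (L u) (L v) (L w)"
  have range: "L w \<le> 2 * n" "L w \<noteq> n" if "w < n" for w
    using L that by (simp_all add: labelling_def)
  have sound: "L x = L y \<Longrightarrow> g x = g y" "L x + L y = 2 * n \<Longrightarrow> g x \<noteq> g y"
    if "separates P g" "x < n" "y < n" for g x y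
    using L that unfolding labelling_def by blast+
  have split: "separates (insert (u, v) P) g \<longleftrightarrow> g u \<noteq> g v \<and> separates P g" for g
    unfolding separates_def by blast
  have range': "?L w \<le> 2 * n" "?L w \<noteq> n" if "w < n" for w
    using range[OF that] range[OF uv(1)] by (auto simp: merge_label_def)
  have sound': "(?L x = ?L y \<longrightarrow> g x = g y) \<and> (?L x + ?L y = 2 * n \<longrightarrow> g x \<noteq> g y)"
    if g: "separates (insert (u, v) P) g" and xy: "x < n" "y < n" for g x y
  proof -
    have gP: "separates P g" and guv: "g u \<noteq> g v" using g split by auto
    \<comment> \<open>Up to a sign every new label is the old label of some vertex, and the colours
      agree with that sign. So soundness of the new labels reduces to soundness of the old
      ones.\<close>
    have key: "\<exists>w<n. ?L x = L w \<and> g x = g w \<or> ?L x + L w = 2 * n \<and> g x \<noteq> g w" if "x < n" for x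
    proof (cases "L x = L v")
      case True
      then have "?L x + L u = 2 * n" using range(1)[OF uv(1)] by (simp add: merge_label_def)
      moreover have "g x = g v" using sound(1)[OF gP that uv(2) True] .
      ultimately show ?thesis using guv uv(1) by (intro exI[of _ u]) auto
    next
      case neq: False
      show ?thesis
      proof (cases "L x + L v = 2 * n")
        case True
        then have "?L x = L u" using neq by (simp add: merge_label_def)
        moreover have "g x \<noteq> g v" using sound(2)[OF gP that uv(2) True] .
        ultimately show ?thesis using guv uv(1) by (intro exI[of _ u]) auto
      next
        case False
        then have "?L x = L x" using neq by (simp add: merge_label_def)
        then show ?thesis using that by blast
      qed
    qed
    obtain a where a: "a < n" "?L x = L a \<and> g x = g a \<or> ?L x + L a = 2 * n \<and> g x \<noteq> g a"
      using key[OF xy(1)] by blast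
    obtain b where b: "b < n" "?L y = L b \<and> g y = g b \<or> ?L y + L b = 2 * n \<and> g y \<noteq> g b"
      using key[OF xy(2)] by blast
    note ab = sound[OF gP a(1) b(1)]
    show ?thesis
    proof (intro conjI impI)
      assume "?L x = ?L y"
      then have "L a = L b \<and> (g x = g a \<longleftrightarrow> g y = g b) \<or> L a + L b = 2 * n \<and> (g x = g a \<longleftrightarrow> g y \<noteq> g b)"
        using a(2) b(2) by linarith
      then show "g x = g y" using ab by blast
    next
      assume "?L x + ?L y = 2 * n"
      then have "L a = L b \<and> (g x = g a \<longleftrightarrow> g y \<noteq> g b) \<or> L a + L b = 2 * n \<and> (g x = g a \<longleftrightarrow> g y = g b)"
        using a(2) b(2) by linarith
      then show "g x \<noteq> g y" using ab by blast
    qed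
  qed
  \<comment> \<open>As no label is \<open>n\<close>, merging commutes with taking opposites: earlier
    pairs stay opposite, and the new pair becomes opposite.\<close>
  have opp: "?L x + ?L y = 2 * n" if "b" "L u \<noteq> L v" "(x, y) \<in> insert (u, v) P" for x y
  proof (cases "(x, y) \<in> P")
    case True
    then have "L x + L y = 2 * n" using L \<open>b\<close> by (auto simp: labelling_def)
    moreover have "x < n" "y < n" using True P by auto
    ultimately show ?thesis
      using range[of x] range[of y] range[OF uv(1)] range[OF uv(2)]
      by (auto simp: merge_label_def)
  next
    case False
    then have "x = u" "y = v" using that by auto
    then show ?thesis using that(2) range[OF uv(1)] range[OF uv(2)] by (auto simp: merge_label_def)
  qed
  \<comment> \<open>Equal labels force equal colours, so an edge between them rules out every
    two-colouring.\<close>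
  have bad: "\<not> separates (insert (u, v) P) g" if "\<not> (b \<and> L u \<noteq> L v)" "2 \<le> k" for g
  proof
    assume g: "separates (insert (u, v) P) g"
    then have "g u \<noteq> g v" "separates P g" using split by auto
    moreover from this have "L u \<noteq> L v" using sound(1) uv by blast
    ultimately show False using that L by (auto simp: labelling_def)
  qed
  show ?thesis
    unfolding labelling_def
  proof (intro conjI)
    show "if b \<and> 2 \<le> k \<and> L u \<noteq> L v
      then (\<forall>x y. (x, y) \<in> insert (u, v) P \<longrightarrow> ?L x + ?L y = 2 * n) \<and> (insert (u, v) P = {} \<or> 2 \<le> k)
      else insert (u, v) P \<noteq> {} \<and> (2 \<le> k \<longrightarrow> \<not> (\<exists>g. separates (insert (u, v) P) g))"
      using opp bad by (cases "b \<and> 2 \<le> k \<and> L u \<noteq> L v") (simp_all del: insert_iff, blast)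
  qed (use range' sound' in blast)+
qed

lemma labelling_two_colourable:
  assumes L: "labelling n k {(u, v). u \<in> X \<and> v \<in> X \<and> {u, v} \<in> E} L b" and X: "X \<subseteq> {..<n}" and "k > 0"
  shows "b \<longleftrightarrow> coverable X E (min k 2)"
proof -
  let ?P = "{(u, v). u \<in> X \<and> v \<in> X \<and> {u, v} \<in> E}"
  have range: "\<And>w. w \<in> X \<Longrightarrow> L w \<le> 2 * n \<and> L w \<noteq> n" using L X by (auto simp: labelling_def)
  show ?thesis
  proof
    assume b
    then have opp: "\<And>u v. (u, v) \<in> ?P \<Longrightarrow> L u + L v = 2 * n" and k: "?P = {} \<or> 2 \<le> k"
      using L by (auto simp: labelling_def)
    show "coverable X E (min k 2)"
    proof (cases "?P = {}")
      case True
      then show ?thesis using \<open>k > 0\<close> unfolding coverable_iff_proper_colouring proper_colouring_def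
        by (intro exI[of _ "\<lambda>_. 0"]) auto
    next
      case False
      \<comment> \<open>Of two opposite labels different from \<open>n\<close>, exactly one is below
        \<open>n\<close>.\<close>
      have "proper_colouring X E 2 (\<lambda>v. if L v < n then 0 else 1)"
        unfolding proper_colouring_def
      proof (intro conjI ballI impI)
        fix u v assume "u \<in> X" "v \<in> X" "{u, v} \<in> E"
        then have "L u + L v = 2 * n" "L u \<noteq> n" using opp range by auto
        then show "(if L u < n then 0 else 1) \<noteq> (if L v < n then 0 else (1::nat))" by auto
      qed auto
      then show ?thesis using k False unfolding coverable_iff_proper_colouring by (auto simp: min_def)
    qed
  next
    assume "coverable X E (min k 2)"
    then obtain f where f: "proper_colouring X E (min k 2) f" unfolding coverable_iff_proper_colouring ..
    show b
    proof (rule ccontr)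
      assume "\<not> b"
      then have ne: "?P \<noteq> {}" and no: "2 \<le> k \<Longrightarrow> \<not> (\<exists>g. separates ?P g)"
        using L by (auto simp: labelling_def)
      have c: "f u < 2" "f u < k" "f v < 2" "f v < k" "f u \<noteq> f v" if "(u, v) \<in> ?P" for u v
        using f that unfolding proper_colouring_def by auto
      obtain u v where "(u, v) \<in> ?P" using ne by auto
      \<comment> \<open>Settles \<open>k = 1\<close>: an adjacent pair needs two different colours
        below \<open>k\<close>.\<close>
      from c[OF this] have "2 \<le> k" by linarith
      moreover have "separates ?P (\<lambda>v. f v = 0)"
        unfolding separates_def
      proof (intro allI impI)
        fix u v assume "(u, v) \<in> ?P"
        from c[OF this] show "(f u = 0) \<noteq> (f v = 0)" by auto
      qed
      ultimately show False using no by blast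
    qed
  qed
qed

section \<open>Programs and their running time\<close>

fun expr_size :: "expr \<Rightarrow> nat" where
  "expr_size (Const m) = 1"
| "expr_size (Reg r) = 1"
| "expr_size (Load a) = expr_size a + 1"
| "expr_size (Add a b) = expr_size a + expr_size b + 1"
| "expr_size (Sub a b) = expr_size a + expr_size b + 1"
| "expr_size (Mul a b) = expr_size a + expr_size b + 1"
| "expr_size (Div a b) = expr_size a + expr_size b + 1"

text \<open>Constants have to obey the bound \<open>2 ^ B\<close> like registers and cells. Since
  \<open>bounded_state\<close> demands \<open>2 \<le> B\<close>, the limit 4 suits every such
  \<open>B\<close>.\<close>

fun small_consts :: "expr \<Rightarrow> bool" where
  "small_consts (Const m) \<longleftrightarrow> m < 4"
| "small_consts (Reg r) \<longleftrightarrow> True"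
| "small_consts (Load a) \<longleftrightarrow> small_consts a"
| "small_consts (Add a b) \<longleftrightarrow> small_consts a \<and> small_consts b"
| "small_consts (Sub a b) \<longleftrightarrow> small_consts a \<and> small_consts b"
| "small_consts (Mul a b) \<longleftrightarrow> small_consts a \<and> small_consts b"
| "small_consts (Div a b) \<longleftrightarrow> small_consts a \<and> small_consts b"

definition bounded_state :: "nat \<Rightarrow> state \<Rightarrow> bool" where
  "bounded_state B s \<longleftrightarrow> 2 \<le> B \<and> (\<forall>r. fst s r < 2 ^ B) \<and> (\<forall>a. snd s a < 2 ^ B)"

lemma bits_le:
  assumes "m < 2 ^ b" "1 \<le> b"
  shows "bits m \<le> b"
  using assms floorlog_leI[of m 2 b] by (simp add: bits_def)

text \<open>An operation yields at most the digits of its operands together plus one, and a load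
  yields at most \<open>B\<close>; so \<open>B\<close> digits per node suffice.\<close>

lemma val_less:
  assumes "bounded_state B s"
  shows "small_consts e \<Longrightarrow> val e s < 2 ^ (expr_size e * B)"
proof (induction e)
  case (Const m)
  have "(4::nat) \<le> 2 ^ B" using assms power_increasing[of 2 B "2::nat"] by (simp add: bounded_state_def)
  then show ?case using Const by simp
next
  case (Reg r)
  then show ?case using assms by (simp add: bounded_state_def)
next
  case (Load a)
  have "snd s (val a s) < 2 ^ B" using assms by (simp add: bounded_state_def)
  also have "\<dots> \<le> 2 ^ (expr_size (Load a) * B)" by (intro power_increasing) auto
  finally show ?case by simp
next
  case (Add a b)
  have "val a s < 2 ^ ((expr_size a + expr_size b) * B)"
    using Add by (auto intro: less_le_trans power_increasing)
  moreover have "val b s < 2 ^ ((expr_size a + expr_size b) * B)"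
    using Add by (auto intro: less_le_trans power_increasing)
  ultimately have "val (Add a b) s < 2 ^ Suc ((expr_size a + expr_size b) * B)" by simp
  also have "\<dots> \<le> 2 ^ (expr_size (Add a b) * B)"
    using assms by (intro power_increasing) (auto simp: bounded_state_def)
  finally show ?case .
next
  case (Sub a b)
  then have "val (Sub a b) s < 2 ^ (expr_size a * B)" by auto
  also have "\<dots> \<le> 2 ^ (expr_size (Sub a b) * B)"
    by (intro power_increasing) (auto simp: add_mult_distrib)
  finally show ?case .
next
  case (Mul a b)
  then have "val (Mul a b) s < 2 ^ (expr_size a * B) * 2 ^ (expr_size b * B)"
    by (auto intro!: mult_strict_mono)
  also have "\<dots> \<le> 2 ^ (expr_size (Mul a b) * B)"
    unfolding power_add[symmetric] by (intro power_increasing) (auto simp: algebra_simps)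
  finally show ?case .
next
  case (Div a b)
  then have "val (Div a b) s < 2 ^ (expr_size a * B)"
    by (auto intro: le_less_trans[OF div_le_dividend])
  also have "\<dots> \<le> 2 ^ (expr_size (Div a b) * B)"
    by (intro power_increasing) (auto simp: add_mult_distrib)
  finally show ?case .
qed

text \<open>Quadratic because each of the \<open>expr_size e\<close> nodes may have a value of
  \<open>expr_size e * B\<close> digits.\<close>

lemma expr_cost_le:
  assumes s: "bounded_state B s" and "small_consts e"
  shows "expr_cost e s \<le> expr_size e ^ 2 * B"
  using assms(2)
proof (induction e)
  case (Const m)
  then show ?case using val_less[OF s, of "Const m"] s by (auto intro: bits_le simp: bounded_state_def)
next
  case (Reg r)
  then show ?case using val_less[OF s, of "Reg r"] s by (auto intro: bits_le simp: bounded_state_def)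
next
  case (Load a)
  have "bits (val (Load a) s) \<le> B" using s by (auto intro: bits_le simp: bounded_state_def)
  then have "expr_cost (Load a) s \<le> expr_size a ^ 2 * B + B" using Load by simp
  also have "\<dots> \<le> expr_size (Load a) ^ 2 * B" by (simp add: power2_eq_square algebra_simps)
  finally show ?case .
next
  case (Add a b)
  have "bits (val (Add a b) s) \<le> expr_size (Add a b) * B"
    using s Add.prems by (intro bits_le val_less) (auto simp: bounded_state_def)
  then have "expr_cost (Add a b) s \<le> expr_size a ^ 2 * B + expr_size b ^ 2 * B + expr_size (Add a b) * B"
    using Add by simp
  also have "\<dots> \<le> expr_size (Add a b) ^ 2 * B" by (simp add: power2_eq_square algebra_simps)
  finally show ?case .
next
  case (Sub a b)
  have "bits (val (Sub a b) s) \<le> expr_size (Sub a b) * B"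
    using s Sub.prems by (intro bits_le val_less) (auto simp: bounded_state_def)
  then have "expr_cost (Sub a b) s \<le> expr_size a ^ 2 * B + expr_size b ^ 2 * B + expr_size (Sub a b) * B"
    using Sub by simp
  also have "\<dots> \<le> expr_size (Sub a b) ^ 2 * B" by (simp add: power2_eq_square algebra_simps)
  finally show ?case .
next
  case (Mul a b)
  have "bits (val (Mul a b) s) \<le> expr_size (Mul a b) * B"
    using s Mul.prems by (intro bits_le val_less) (auto simp: bounded_state_def)
  then have "expr_cost (Mul a b) s \<le> expr_size a ^ 2 * B + expr_size b ^ 2 * B + expr_size (Mul a b) * B"
    using Mul by simp
  also have "\<dots> \<le> expr_size (Mul a b) ^ 2 * B" by (simp add: power2_eq_square algebra_simps)
  finally show ?case .
next
  case (Div a b)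
  have "bits (val (Div a b) s) \<le> expr_size (Div a b) * B"
    using s Div.prems by (intro bits_le val_less) (auto simp: bounded_state_def)
  then have "expr_cost (Div a b) s \<le> expr_size a ^ 2 * B + expr_size b ^ 2 * B + expr_size (Div a b) * B"
    using Div by simp
  also have "\<dots> \<le> expr_size (Div a b) ^ 2 * B" by (simp add: power2_eq_square algebra_simps)
  finally show ?case .
qed

text \<open>A generous size limit met by all expressions of the programs, so that one evaluation
  costs at most \<open>100 ^ 2 * B\<close>. A store evaluates two expressions, which is the origin
  of the 20000 in \<open>step_cost\<close>.\<close>

definition simple_expr :: "expr \<Rightarrow> bool" where
  "simple_expr e \<longleftrightarrow> small_consts e \<and> expr_size e \<le> 100"

lemma expr_cost_simple:
  assumes "bounded_state B s" "simple_expr e"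
  shows "expr_cost e s \<le> 10000 * B"
proof -
  have "expr_size e ^ 2 \<le> 100 ^ 2" using assms(2) unfolding simple_expr_def by (intro power_mono) auto
  then have "expr_size e ^ 2 * B \<le> 10000 * B" by (intro mult_right_mono) auto
  then show ?thesis using expr_cost_le[OF assms(1)] assms(2) unfolding simple_expr_def by (meson le_trans)
qed

section \<open>Total correctness with step counts\<close>

definition step_cost :: "nat \<Rightarrow> nat" where
  "step_cost B = 1 + 20000 * B"

text \<open>
  Total correctness where the time \<open>T\<close> counts elementary steps. Every step is cheap because
  the registers and the memory cells stay below \<open>2 ^ B\<close>.
\<close>

definition run :: "nat \<Rightarrow> prog \<Rightarrow> state \<Rightarrow> nat \<Rightarrow> (state \<Rightarrow> bool) \<Rightarrow> bool" where
  "run B c s T Q \<longleftrightarrow> (bounded_state B s \<longrightarrow>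
     (\<exists>t s'. exec c s t s' \<and> t \<le> T * step_cost B \<and> bounded_state B s' \<and> Q s'))"

lemma run_mono: "run B c s T Q \<Longrightarrow> T \<le> T' \<Longrightarrow> (\<And>s'. Q s' \<Longrightarrow> Q' s') \<Longrightarrow> run B c s T' Q'"
  unfolding run_def by (meson le_trans mult_le_mono1)

text \<open>For values that are known to be small only because they are, or do not exceed, something
  stored in the starting state.\<close>

lemma run_bounded: "(bounded_state B s \<Longrightarrow> run B c s T Q) \<Longrightarrow> run B c s T Q"
  by (simp add: run_def)

lemma run_Skip:
  assumes "Q s" "1 \<le> T"
  shows "run B Skip s T Q"
proof -
  have "run B Skip s 1 Q" using assms(1) exec.Skip unfolding run_def step_cost_def by fastforce
  then show ?thesis using assms(2) by (rule run_mono)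
qed

lemma run_Assign:
  assumes "simple_expr e" "val e s < 2 ^ B" "Q ((fst s)(r := val e s), snd s)"
  shows "run B (Assign r e) s 1 Q"
  unfolding run_def
proof
  assume s: "bounded_state B s"
  have "1 + expr_cost e s \<le> 1 * step_cost B"
    using expr_cost_simple[OF s assms(1)] by (simp add: step_cost_def)
  moreover have "bounded_state B ((fst s)(r := val e s), snd s)"
    using s assms(2) by (simp add: bounded_state_def)
  ultimately show "\<exists>t s'. exec (Assign r e) s t s' \<and> t \<le> 1 * step_cost B \<and> bounded_state B s' \<and> Q s'"
    using exec.Assign assms(3) by blast
qed

lemma run_Store:
  assumes "simple_expr a" "simple_expr e" "val e s < 2 ^ B" "Q (fst s, (snd s)(val a s := val e s))"
  shows "run B (Store a e) s 1 Q"
  unfolding run_def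
proof
  assume s: "bounded_state B s"
  have "1 + expr_cost a s + expr_cost e s \<le> 1 * step_cost B"
    using expr_cost_simple[OF s assms(1)] expr_cost_simple[OF s assms(2)] by (simp add: step_cost_def)
  moreover have "bounded_state B (fst s, (snd s)(val a s := val e s))"
    using s assms(3) by (simp add: bounded_state_def)
  ultimately show "\<exists>t s'. exec (Store a e) s t s' \<and> t \<le> 1 * step_cost B \<and> bounded_state B s' \<and> Q s'"
    using exec.Store assms(4) by blast
qed

lemma run_Seq:
  assumes "run B c s T (\<lambda>s'. run B d s' T' Q)"
  shows "run B (Seq c d) s (T + T') Q"
  unfolding run_def
proof
  assume "bounded_state B s"
  then obtain t s' where 1: "exec c s t s'" "t \<le> T * step_cost B" "bounded_state B s'" "run B d s' T' Q"
    using assms unfolding run_def by blast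
  then obtain t' s'' where 2: "exec d s' t' s''" "t' \<le> T' * step_cost B" "bounded_state B s''" "Q s''"
    unfolding run_def by blast
  have "t + t' \<le> (T + T') * step_cost B" using 1 2 by (simp add: add_mono distrib_right)
  then show "\<exists>t s'. exec (Seq c d) s t s' \<and> t \<le> (T + T') * step_cost B \<and> bounded_state B s' \<and> Q s'"
    using exec.Seq[OF 1(1) 2(1)] 2(3,4) by blast
qed

lemma guard_cost: "bounded_state B s \<Longrightarrow> simple_expr e \<Longrightarrow> 1 + expr_cost e s \<le> step_cost B"
  using expr_cost_simple[of B s e] by (simp add: step_cost_def)

lemma run_If:
  assumes "simple_expr e" "val e s \<noteq> 0 \<Longrightarrow> run B c s T Q" "val e s = 0 \<Longrightarrow> run B d s T Q"
  shows "run B (If e c d) s (1 + T) Q"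
  unfolding run_def
proof
  assume s: "bounded_state B s"
  note g = guard_cost[OF s assms(1)]
  show "\<exists>t s'. exec (If e c d) s t s' \<and> t \<le> (1 + T) * step_cost B \<and> bounded_state B s' \<and> Q s'"
  proof (cases "val e s = 0")
    case True
    then obtain t s' where *: "exec d s t s'" "t \<le> T * step_cost B" "bounded_state B s'" "Q s'"
      using assms(3) s unfolding run_def by blast
    then have "1 + expr_cost e s + t \<le> (1 + T) * step_cost B" using g by (simp add: add_mono)
    then show ?thesis using exec.IfFalse[OF True *(1)] * by blast
  next
    case False
    then obtain t s' where *: "exec c s t s'" "t \<le> T * step_cost B" "bounded_state B s'" "Q s'"
      using assms(2) s unfolding run_def by blast
    then have "1 + expr_cost e s + t \<le> (1 + T) * step_cost B" using g by (simp add: add_mono)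
    then show ?thesis using exec.IfTrue[OF False *(1)] * by blast
  qed
qed

text \<open>By truncation the guard is nonzero exactly as long as \<open>i\<close> is below
  \<open>l\<close>.\<close>

definition For :: "nat \<Rightarrow> nat \<Rightarrow> prog \<Rightarrow> prog" where
  "For i l c = Seq (Assign i (Const 0))
     (While (Sub (Reg l) (Reg i)) (Seq c (Assign i (Add (Reg i) (Const 1)))))"

text \<open>A round pays for the body, the increment and the guard, hence \<open>T + 2\<close>; the
  final 1 is the failing guard. The increment follows the body, so the body has to establish the
  invariant for the state in which \<open>i\<close> is already increased.\<close>

lemma run_While_up:
  assumes body: "\<And>j s. j < N \<Longrightarrow> I j s \<Longrightarrow> fst s i = j \<Longrightarrow>
      run B c s T (\<lambda>s'. fst s' i = j \<and> I (Suc j) ((fst s')(i := Suc j), snd s'))"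
    and limit: "\<And>j s. I j s \<Longrightarrow> fst s l = N" and "N < 2 ^ B"
    and "j \<le> N" "I j s" "fst s i = j"
  shows "run B (While (Sub (Reg l) (Reg i)) (Seq c (Assign i (Add (Reg i) (Const 1))))) s
    ((N - j) * (T + 2) + 1) (I N)"
  using assms(4-6)
proof (induction "N - j" arbitrary: j s)
  case 0
  have simple: "simple_expr (Sub (Reg l) (Reg i))" by (simp add: simple_expr_def)
  have "val (Sub (Reg l) (Reg i)) s = 0" using 0 limit by simp
  moreover have "j = N" using 0 by simp
  ultimately show ?case
    using guard_cost[OF _ simple, of B s] exec.WhileFalse[of "Sub (Reg l) (Reg i)" s] 0
    unfolding run_def by fastforce
next
  case (Suc d)
  let ?e = "Sub (Reg l) (Reg i)" and ?c = "Seq c (Assign i (Add (Reg i) (Const 1)))"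
  have simple: "simple_expr ?e" by (simp add: simple_expr_def)
  have j: "j < N" using Suc by linarith
  have first: "run B ?c s (T + 1) (\<lambda>s'. I (Suc j) s' \<and> fst s' i = Suc j)"
  proof (rule run_Seq, rule run_mono[OF body[OF j Suc.prems(2,3)] order.refl], rule run_Assign)
    fix s' assume s': "fst s' i = j \<and> I (Suc j) ((fst s')(i := Suc j), snd s')"
    then show "val (Add (Reg i) (Const 1)) s' < 2 ^ B" using j \<open>N < 2 ^ B\<close> by simp
    show "I (Suc j) ((fst s')(i := val (Add (Reg i) (Const 1)) s'), snd s')
      \<and> fst ((fst s')(i := val (Add (Reg i) (Const 1)) s'), snd s') i = Suc j"
      using s' by simp
  qed (simp add: simple_expr_def)
  have rest: "run B (While ?e ?c) s' ((N - Suc j) * (T + 2) + 1) (I N)"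
    if "I (Suc j) s'" "fst s' i = Suc j" for s'
    using that Suc.hyps j by (intro Suc.hyps) auto
  have step: "run B (Seq ?c (While ?e ?c)) s (T + 1 + ((N - Suc j) * (T + 2) + 1)) (I N)"
    by (rule run_Seq, rule run_mono[OF first order.refl]) (use rest in blast)
  show ?case
    unfolding run_def
  proof
    assume s: "bounded_state B s"
    obtain t s' where e: "exec (Seq ?c (While ?e ?c)) s t s'"
      and t: "t \<le> (T + 1 + ((N - Suc j) * (T + 2) + 1)) * step_cost B" and s': "bounded_state B s'" "I N s'"
      using step s unfolding run_def by blast
    obtain t1 t2 s1 where "exec ?c s t1 s1" "exec (While ?e ?c) s1 t2 s'" "t = t1 + t2"
      using e by (auto elim: exec.cases)
    moreover have "val ?e s \<noteq> 0" using limit[OF Suc.prems(2)] Suc.prems(3) j by simp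
    ultimately have ex: "exec (While ?e ?c) s (1 + expr_cost ?e s + t) s'"
      using exec.WhileTrue[of ?e s ?c t1 s1 t2 s'] by (simp add: add.assoc)
    have "N - j = Suc (N - Suc j)" using j by simp
    then have "(N - j) * (T + 2) + 1 = 1 + (T + 1 + ((N - Suc j) * (T + 2) + 1))" by simp
    then have "1 + expr_cost ?e s + t \<le> ((N - j) * (T + 2) + 1) * step_cost B"
      using guard_cost[OF s simple] t by (simp only: distrib_right)
    then show "\<exists>t s'. exec (While ?e ?c) s t s' \<and> t \<le> ((N - j) * (T + 2) + 1) * step_cost B
        \<and> bounded_state B s' \<and> I N s'"
      using ex s' by blast
  qed
qed

lemma run_For:
  assumes "\<And>j s. j < N \<Longrightarrow> I j s \<Longrightarrow> fst s i = j \<Longrightarrow>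
      run B c s T (\<lambda>s'. fst s' i = j \<and> I (Suc j) ((fst s')(i := Suc j), snd s'))"
    and "\<And>j s. I j s \<Longrightarrow> fst s l = N" and "N < 2 ^ B"
    and "I 0 ((fst s)(i := 0), snd s)" and "\<And>s'. I N s' \<Longrightarrow> Q s'"
  shows "run B (For i l c) s (N * (T + 2) + 2) Q"
proof -
  have loop: "run B (While (Sub (Reg l) (Reg i)) (Seq c (Assign i (Add (Reg i) (Const 1)))))
      ((fst s)(i := 0), snd s) ((N - 0) * (T + 2) + 1) (I N)"
    by (rule run_While_up) (use assms in auto)
  have "run B (For i l c) s (1 + (N * (T + 2) + 1)) (I N)"
    unfolding For_def by (rule run_Seq, rule run_Assign) (use loop in \<open>auto simp: simple_expr_def\<close>)
  then show ?thesis by (rule run_mono) (use assms(5) in auto)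
qed

section \<open>Polynomial bounds\<close>

definition polynomial_fun :: "(nat \<Rightarrow> nat) \<Rightarrow> bool" where
  "polynomial_fun f \<longleftrightarrow> (\<exists>p :: real poly. \<forall>n. real (f n) = poly p (real n))"

lemma polynomial_fun_const: "polynomial_fun (\<lambda>_. c)"
  unfolding polynomial_fun_def by (intro exI[of _ "[:real c:]"]) simp

lemma polynomial_fun_id: "polynomial_fun (\<lambda>n. n)"
  unfolding polynomial_fun_def by (intro exI[of _ "[:0, 1:]"]) simp

lemma polynomial_fun_add: "polynomial_fun f \<Longrightarrow> polynomial_fun g \<Longrightarrow> polynomial_fun (\<lambda>n. f n + g n)"
  unfolding polynomial_fun_def by (metis of_nat_add poly_add)

lemma polynomial_fun_mult: "polynomial_fun f \<Longrightarrow> polynomial_fun g \<Longrightarrow> polynomial_fun (\<lambda>n. f n * g n)"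
  unfolding polynomial_fun_def by (metis of_nat_mult poly_mult)

lemmas polynomial_fun_intros =
  polynomial_fun_const polynomial_fun_id polynomial_fun_add polynomial_fun_mult

section \<open>The algorithm\<close>

lemma finite_residual: "finite V \<Longrightarrow> finite (residual V E)"
  by (rule finite_subset[of _ "Pow V"]) (auto simp: residual_def)

lemma residual_subset:
  assumes "Y \<in> residual V E" "Z \<subseteq> Y" "finite V"
  shows "Z \<in> residual V E"
proof -
  have "2 \<le> card {u \<in> V - Z. {u, v} \<in> E}" if "v \<in> Z" for v
  proof -
    have "2 \<le> card {u \<in> V - Y. {u, v} \<in> E}" using assms that by (auto simp: residual_def)
    also have "\<dots> \<le> card {u \<in> V - Z. {u, v} \<in> E}" using assms by (intro card_mono) auto
    finally show ?thesis .
  qed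
  then show ?thesis using assms by (auto simp: residual_def)
qed

text \<open>When \<open>insert j Y\<close> is appended, \<open>Y\<close> and all its subsets are
  already listed, as the recurrence for \<open>independent_count\<close> requires. Every
  intermediate list consists of residual sets, so a stage examines at most one candidate per
  residual set.\<close>

primrec residual_list :: "nat \<Rightarrow> nat set set \<Rightarrow> nat \<Rightarrow> nat set list" where
  "residual_list n E 0 = [{}]"
| "residual_list n E (Suc j) = residual_list n E j @
     filter (\<lambda>Y. Y \<in> residual {..<n} E) (map (insert j) (residual_list n E j))"

lemma set_residual_list:
  "set (residual_list n E j) = {Y \<in> residual {..<n} E. Y \<subseteq> {..<j}}"
proof (induction j)
  case 0
  then show ?case by (auto simp: residual_def)
next
  case (Suc j)
  show ?case
  proof (intro set_eqI iffI)
    fix Y assume "Y \<in> set (residual_list n E (Suc j))"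
    then show "Y \<in> {Y \<in> residual {..<n} E. Y \<subseteq> {..<Suc j}}" by (auto simp: Suc.IH less_Suc_eq)
  next
    fix Y assume Y: "Y \<in> {Y \<in> residual {..<n} E. Y \<subseteq> {..<Suc j}}"
    show "Y \<in> set (residual_list n E (Suc j))"
    proof (cases "j \<in> Y")
      case True
      then have "Y = insert j (Y - {j})" by auto
      \<comment> \<open>Closure under subsets makes the enumeration complete: without its largest
        element the set is still residual and was listed in an earlier stage.\<close>
      moreover have "Y - {j} \<in> residual {..<n} E" using Y by (auto intro: residual_subset)
      moreover have "Y - {j} \<subseteq> {..<j}" using Y by (auto simp: less_Suc_eq)
      ultimately have "Y \<in> insert j ` set (residual_list n E j)" unfolding Suc.IH by blast
      then show ?thesis using Y by auto
    next
      case False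
      then have "Y \<subseteq> {..<j}" using Y by (auto simp: less_Suc_eq)
      then show ?thesis using Y by (simp add: Suc.IH)
    qed
  qed
qed

lemma distinct_residual_list: "distinct (residual_list n E j)"
proof (induction j)
  case (Suc j)
  have "j \<notin> Y" if "Y \<in> set (residual_list n E j)" for Y
    using that by (auto simp: set_residual_list)
  then have "inj_on (insert j) (set (residual_list n E j))" "set (residual_list n E j) \<inter> insert j ` set (residual_list n E j) = {}"
    by (auto simp: inj_on_def insert_ident)
  then show ?case using Suc by (auto simp: distinct_map)
qed simp

lemma length_residual_list:
  assumes "j \<le> n"
  shows "length (residual_list n E j) \<le> card (residual {..<n} E)"
proof -
  have "length (residual_list n E j) = card (set (residual_list n E j))"
    using distinct_residual_list distinct_card by metis
  also have "\<dots> \<le> card (residual {..<n} E)"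
    using card_mono[OF finite_residual[of "{..<n}" E], of "set (residual_list n E j)"]
    by (auto simp: set_residual_list)
  finally show ?thesis .
qed

section \<open>Codes of sets and the expressions that read them\<close>

lemma set_encode_less:
  assumes "Y \<subseteq> {..<n}"
  shows "set_encode Y < 2 ^ n"
proof -
  have "set_encode Y \<le> (\<Sum>i\<in>{0..<n}. 2 ^ i)"
    unfolding set_encode_def using assms by (intro sum_mono2) auto
  also have "\<dots> = 2 ^ n - 1" by (rule sum_power2)
  finally show ?thesis using less_le_trans by (metis Suc_pred' le_imp_less_Suc zero_less_numeral zero_less_power)
qed

text \<open>The machine has no remainder operation, so the parity of \<open>q\<close> is taken as
  \<open>q - 2 * (q div 2)\<close>; this is the shape of \<open>bit_expr\<close>.\<close>

lemma set_encode_bit: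
  assumes "finite Y"
  shows "set_encode Y div 2 ^ u - 2 * (set_encode Y div 2 ^ u div 2) = of_bool (u \<in> Y)"
proof -
  have "u \<in> Y \<longleftrightarrow> odd (set_encode Y div 2 ^ u)"
    using set_encode_inverse[OF assms] unfolding set_decode_def by blast
  then show ?thesis by (simp add: minus_mult_div_eq_mod mod_2_eq_odd)
qed

lemma set_encode_eq_iff: "Y \<subseteq> {..<n} \<Longrightarrow> Z \<subseteq> {..<n} \<Longrightarrow> set_encode Y = set_encode Z \<longleftrightarrow> Y = Z"
  by (meson finite_lessThan finite_subset set_encode_eq)

definition adj_expr :: "nat \<Rightarrow> nat \<Rightarrow> expr" where
  "adj_expr x y = Load (Add (Const 1) (Add (Mul (Reg 1) (Reg x)) (Reg y)))"

text \<open>The cells behind the adjacency matrix. They arrive with the digits of \<open>k\<close>;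
  \<open>read_input\<close> overwrites the first \<open>n\<close> of them by powers of two, which
  replace the missing shift operation.\<close>

definition pow_addr :: "nat \<Rightarrow> expr" where
  "pow_addr x = Add (Add (Mul (Reg 1) (Reg 1)) (Const 1)) (Reg x)"

definition bit_expr :: "nat \<Rightarrow> nat \<Rightarrow> expr" where
  "bit_expr y x = Sub (Div (Reg y) (Load (pow_addr x)))
     (Mul (Const 2) (Div (Div (Reg y) (Load (pow_addr x))) (Const 2)))"

definition list_cell :: "nat \<Rightarrow> expr" where
  "list_cell x = Add (Reg 3) (Reg x)"

definition value_cell :: "expr \<Rightarrow> expr" where
  "value_cell e = Add (Mul (Const 2) (Reg 3)) e"

definition label_cell :: "nat \<Rightarrow> expr" where
  "label_cell x = Add (Mul (Const 3) (Reg 3)) (Reg x)"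

definition not_expr :: "expr \<Rightarrow> expr" where
  "not_expr e = Sub (Const 1) e"

text \<open>Truncation makes one summand 0, so this is the distance of the two values. It serves as
  the test for inequality.\<close>

definition diff_expr :: "expr \<Rightarrow> expr \<Rightarrow> expr" where
  "diff_expr a b = Add (Sub a b) (Sub b a)"

lemma expr_size_simps [simp]:
  "expr_size (adj_expr x y) = 8" "expr_size (pow_addr x) = 7" "expr_size (bit_expr y x) = 25"
  "expr_size (list_cell x) = 3" "expr_size (value_cell e) = expr_size e + 4" "expr_size (label_cell x) = 5"
  "expr_size (not_expr e) = expr_size e + 2" "expr_size (diff_expr a b) = 2 * expr_size a + 2 * expr_size b + 3"
  by (simp_all add: adj_expr_def pow_addr_def bit_expr_def list_cell_def value_cell_def label_cell_def
      not_expr_def diff_expr_def)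

lemma small_consts_simps [simp]:
  "small_consts (adj_expr x y)" "small_consts (pow_addr x)" "small_consts (bit_expr y x)"
  "small_consts (list_cell x)" "small_consts (value_cell e) \<longleftrightarrow> small_consts e" "small_consts (label_cell x)"
  "small_consts (not_expr e) \<longleftrightarrow> small_consts e" "small_consts (diff_expr a b) \<longleftrightarrow> small_consts a \<and> small_consts b"
  by (auto simp: adj_expr_def pow_addr_def bit_expr_def list_cell_def value_cell_def label_cell_def
      not_expr_def diff_expr_def)

lemma val_simps [simp]:
  "val (not_expr e) s = of_bool (val e s = 0)" 
  "val (diff_expr a b) s = 0 \<longleftrightarrow> val a s = val b s"
  "val (list_cell x) s = fst s 3 + fst s x"
  "val (value_cell e) s = 2 * fst s 3 + val e s"
  "val (label_cell x) s = 3 * fst s 3 + fst s x"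
  by (auto simp: not_expr_def diff_expr_def list_cell_def value_cell_def label_cell_def)

text \<open>
  Register 1 holds \<open>n\<close>, register 2 holds \<open>k\<close>, and register 3 the distance between the memory
  blocks: the list of the residual sets, then their values, then the labels.
  Register 4 is the length of the list, and sets are stored as binary numbers.
\<close>

definition residual_test :: prog where
  "residual_test = Seq (Assign 11 (Const 1)) (For 12 1 (Seq (Assign 14 (Const 0)) (Seq
     (For 13 1 (Assign 14 (Add (Reg 14) (Mul (adj_expr 12 13) (not_expr (bit_expr 6 13))))))
     (Assign 11 (Mul (Reg 11) (not_expr (Mul (bit_expr 6 12) (Sub (Const 2) (Reg 14)))))))))"

text \<open>This and the other time functions repeat the nesting of their program, with sums for
  sequences and \<open>N * (T + 2) + 2\<close> for loops, so that the rules for \<open>run\<close>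
  apply by unification.\<close>

definition residual_test_time :: "nat \<Rightarrow> nat" where
  "residual_test_time n = 1 + (n * ((1 + ((n * (1 + 2) + 2) + 1)) + 2) + 2)"

definition remove_neighbours :: prog where
  "remove_neighbours = Seq (Assign 10 (Const 0)) (For 13 1
     (Assign 10 (Add (Reg 10) (Mul (Mul (bit_expr 9 13) (not_expr (adj_expr 7 13))) (Load (pow_addr 13))))))"

definition remove_neighbours_time :: "nat \<Rightarrow> nat" where
  "remove_neighbours_time n = 1 + (n * (1 + 2) + 2)"

section \<open>Memory layout and bounds on the numbers\<close>

locale counting =
  fixes n k :: nat and E :: "nat set set"
  assumes graph: "simple_graph {..<n} E"
begin

text \<open>Exceeds all addresses of the tables, which end at \<open>n * n + n\<close>, as well as
  \<open>2 ^ n\<close>, which bounds the codes of sets and the length of the list. So the memory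
  blocks do not overlap.\<close>

definition stride :: nat where "stride = 2 ^ n + n * n + n + 2"

text \<open>The \<open>n * n\<close> is for powers with exponent below \<open>n\<close> of counts of
  at most \<open>2 ^ n\<close>; the rest leaves room for \<open>stride\<close> and for small
  numbers.\<close>

definition width :: nat where "width = n * n + n + 10"

definition tables :: "(nat \<Rightarrow> nat) \<Rightarrow> bool" where
  "tables M \<longleftrightarrow> (\<forall>u<n. \<forall>v<n. M (1 + (n * u + v)) = of_bool ({u, v} \<in> E))
     \<and> (\<forall>u<n. M (n * n + 1 + u) = 2 ^ u)"

definition ctx :: "state \<Rightarrow> bool" where
  "ctx s \<longleftrightarrow> fst s 1 = n \<and> fst s 2 = k \<and> fst s 3 = stride \<and> tables (snd s)"

definition frame :: "nat \<Rightarrow> state \<Rightarrow> state \<Rightarrow> bool" where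
  "frame m s s' \<longleftrightarrow> snd s' = snd s \<and> (\<forall>r<m. fst s' r = fst s r)"

lemma frame_refl [simp]: "frame m s s"
  by (simp add: frame_def)

lemma frame_upd [simp]: "m \<le> r \<Longrightarrow> frame m s (f(r := x), M) \<longleftrightarrow> frame m s (f, M)"
  by (auto simp: frame_def)

lemma frame_reg: "frame m s s' \<Longrightarrow> r < m \<Longrightarrow> fst s' r = fst s r"
  by (simp add: frame_def)

lemma ctx_frame: "ctx s \<Longrightarrow> frame m s s' \<Longrightarrow> 3 < m \<Longrightarrow> ctx s'"
  by (auto simp: ctx_def frame_def)

lemma ctx_upd [simp]: "3 < r \<Longrightarrow> ctx (f(r := x), M) \<longleftrightarrow> ctx (f, M)"
  by (auto simp: ctx_def)

lemma less_width: "(x :: nat) \<le> 2 ^ (n * n + n + 2) \<Longrightarrow> x < 2 ^ width"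
  unfolding width_def by (rule le_less_trans, assumption, rule power_strict_increasing) auto

lemma less_width_set: "(x :: nat) < 2 ^ n \<Longrightarrow> x < 2 ^ width"
  by (rule less_width, rule less_imp_le, rule less_le_trans, assumption, rule power_increasing) auto

lemma less_width_pow: "(x :: nat) \<le> 2 ^ n \<Longrightarrow> x < 2 ^ width"
  by (rule less_width, rule order_trans, assumption, rule power_increasing) auto

lemma less_width_n: "x \<le> 2 * n + 2 \<Longrightarrow> x < 2 ^ width"
proof (rule less_width)
  assume "x \<le> 2 * n + 2"
  moreover have "n + 1 \<le> 2 ^ n" using less_exp[of n] by linarith
  ultimately have "x \<le> 2 ^ Suc n" by simp
  also have "\<dots> \<le> 2 ^ (n * n + n + 2)" by (rule power_increasing) auto
  finally show "x \<le> 2 ^ (n * n + n + 2)" .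
qed

lemma stride_less: "stride < 2 ^ width"
proof (rule less_width)
  have "n * n + n + 2 \<le> 2 ^ (n * n + n + 1)" using less_exp[of "n * n + n + 1"] by linarith
  moreover have "2 ^ n \<le> (2 :: nat) ^ (n * n + n + 1)" by (rule power_increasing) auto
  ultimately show "stride \<le> 2 ^ (n * n + n + 2)" by (simp add: stride_def)
qed

lemma val_adj:
  assumes "ctx s" "fst s x = u" "fst s y = v" "u < n" "v < n"
  shows "val (adj_expr x y) s = of_bool ({u, v} \<in> E)"
  using assms by (simp add: adj_expr_def ctx_def tables_def)

lemma val_pow:
  assumes "ctx s" "fst s x = u" "u < n"
  shows "val (Load (pow_addr x)) s = 2 ^ u"
  using assms by (simp add: pow_addr_def ctx_def tables_def)

lemma val_bit:
  assumes "ctx s" "fst s x = u" "u < n" "fst s y = set_encode Y" "Y \<subseteq> {..<n}"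
  shows "val (bit_expr y x) s = of_bool (u \<in> Y)"
proof -
  have "finite Y" using assms(5) finite_subset by blast
  then show ?thesis
    using set_encode_bit val_pow[OF assms(1-3)] assms(4) by (simp add: bit_expr_def)
qed

lemma run_residual_test:
  assumes s: "ctx s" "fst s 6 = set_encode Y" and Y: "Y \<subseteq> {..<n}"
  shows "run width residual_test s (residual_test_time n)
    (\<lambda>s'. frame 11 s s' \<and> fst s' 11 = of_bool (Y \<in> residual {..<n} E))"
proof -
  \<comment> \<open>The number of outside neighbours of \<open>v\<close> found after
    \<open>i\<close> rounds of the inner loop. After the last round, truncated
    \<open>2 - c v n\<close> is nonzero exactly if \<open>v\<close> has too few of them.\<close>
  define c where "c v i = card {u \<in> {..<n} - Y. u < i \<and> {u, v} \<in> E}" for v i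
  define ok where "ok j \<longleftrightarrow> (\<forall>v\<in>Y. v < j \<longrightarrow> 2 \<le> c v n)" for j
  have c_Suc: "c v (Suc i) = c v i + of_bool ({v, i} \<in> E) * of_bool (i \<notin> Y)" if "i < n" for v i
  proof (cases "{v, i} \<in> E \<and> i \<notin> Y")
    case True
    then have "{u \<in> {..<n} - Y. u < Suc i \<and> {u, v} \<in> E} = insert i {u \<in> {..<n} - Y. u < i \<and> {u, v} \<in> E}"
      using that by (auto simp: less_Suc_eq insert_commute)
    then show ?thesis using True by (simp add: c_def)
  next
    case False
    then have "{u \<in> {..<n} - Y. u < Suc i \<and> {u, v} \<in> E} = {u \<in> {..<n} - Y. u < i \<and> {u, v} \<in> E}"
      by (auto simp: less_Suc_eq insert_commute)
    then show ?thesis using False by (auto simp: c_def)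
  qed
  have c_le: "c v i \<le> n" for v i
    using card_mono[of "{..<n}" "{u \<in> {..<n} - Y. u < i \<and> {u, v} \<in> E}"] by (auto simp: c_def)
  have ok_n: "ok n \<longleftrightarrow> Y \<in> residual {..<n} E"
  proof -
    have "c v n = card {u \<in> {..<n} - Y. {u, v} \<in> E}" for v
      unfolding c_def by (rule arg_cong[where f = card]) auto
    then show ?thesis using Y by (auto simp: ok_def residual_def)
  qed
  show ?thesis
    unfolding residual_test_def residual_test_time_def
  proof (rule run_Seq, rule run_Assign)
    show "run width (For 12 1 (Seq (Assign 14 (Const 0)) (Seq
         (For 13 1 (Assign 14 (Add (Reg 14) (Mul (adj_expr 12 13) (not_expr (bit_expr 6 13))))))
         (Assign 11 (Mul (Reg 11) (not_expr (Mul (bit_expr 6 12) (Sub (Const 2) (Reg 14)))))))))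
      ((fst s)(11 := val (Const 1) s), snd s)
      (n * ((1 + ((n * (1 + 2) + 2) + 1)) + 2) + 2)
      (\<lambda>s'. frame 11 s s' \<and> fst s' 11 = of_bool (Y \<in> residual {..<n} E))"
    proof (rule run_For[where I = "\<lambda>j s'. frame 11 s s' \<and> fst s' 11 = of_bool (ok j)"])
      fix j s1 assume j: "j < n" and "frame 11 s s1 \<and> fst s1 11 = of_bool (ok j)" "fst s1 12 = j"
      then have s1: "frame 11 s s1" "fst s1 11 = of_bool (ok j)" "fst s1 12 = j" by auto
      show "run width (Seq (Assign 14 (Const 0)) (Seq
          (For 13 1 (Assign 14 (Add (Reg 14) (Mul (adj_expr 12 13) (not_expr (bit_expr 6 13))))))
          (Assign 11 (Mul (Reg 11) (not_expr (Mul (bit_expr 6 12) (Sub (Const 2) (Reg 14))))))))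
        s1 (1 + ((n * (1 + 2) + 2) + 1))
        (\<lambda>s'. fst s' 12 = j \<and> frame 11 s ((fst s')(12 := Suc j), snd s') \<and>
            fst ((fst s')(12 := Suc j), snd s') 11 = of_bool (ok (Suc j)))"
      proof (rule run_Seq, rule run_Assign, simp_all only: simple_expr_def expr_size.simps small_consts.simps, simp, simp,
          rule run_Seq, rule run_For[where N = n and I = "\<lambda>i s'. frame 11 s s' \<and> fst s' 11 = of_bool (ok j)
            \<and> fst s' 12 = j \<and> fst s' 14 = c j i"])
        fix i s2 assume i: "i < n" and "frame 11 s s2 \<and> fst s2 11 = of_bool (ok j)
            \<and> fst s2 12 = j \<and> fst s2 14 = c j i" "fst s2 13 = i"
        then have s2: "frame 11 s s2" "fst s2 11 = of_bool (ok j)" "fst s2 12 = j" "fst s2 14 = c j i" "fst s2 13 = i"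
          by auto
        have "ctx s2" using ctx_frame[OF s(1) s2(1)] by simp
        then have v: "val (bit_expr 6 13) s2 = of_bool (i \<in> Y)" "val (adj_expr 12 13) s2 = of_bool ({j, i} \<in> E)"
          using s2 i j Y s(2) frame_reg[OF s2(1), of 6] val_bit[of s2 13 i 6 Y] val_adj[of s2 12 j 13 i] by auto
        show "run width (Assign 14 (Add (Reg 14) (Mul (adj_expr 12 13) (not_expr (bit_expr 6 13))))) s2 1
          (\<lambda>s'. fst s' 13 = i \<and> frame 11 s ((fst s')(13 := Suc i), snd s')
            \<and> fst ((fst s')(13 := Suc i), snd s') 11 = of_bool (ok j)
            \<and> fst ((fst s')(13 := Suc i), snd s') 12 = j \<and> fst ((fst s')(13 := Suc i), snd s') 14 = c j (Suc i))"
          using s2 v c_Suc[OF i, of j] c_le[of j "Suc i"]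
          by (intro run_Assign) (auto simp: simple_expr_def intro!: less_width_n)
      next
        fix i s2 assume "frame 11 s s2 \<and> fst s2 11 = of_bool (ok j) \<and> fst s2 12 = j \<and> fst s2 14 = c j i"
        then show "fst s2 1 = n" using s by (auto simp: frame_def ctx_def)
      next
        show "n < 2 ^ width" by (rule less_width_n) simp
      next
        show "frame 11 s ((fst ((fst s1)(14 := val (Const 0) s1), snd s1))(13 := 0), snd ((fst s1)(14 := val (Const 0) s1), snd s1)) \<and>
          fst ((fst ((fst s1)(14 := val (Const 0) s1), snd s1))(13 := 0), snd ((fst s1)(14 := val (Const 0) s1), snd s1)) 11 = of_bool (ok j) \<and>
          fst ((fst ((fst s1)(14 := val (Const 0) s1), snd s1))(13 := 0), snd ((fst s1)(14 := val (Const 0) s1), snd s1)) 12 = j \<and>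
          fst ((fst ((fst s1)(14 := val (Const 0) s1), snd s1))(13 := 0), snd ((fst s1)(14 := val (Const 0) s1), snd s1)) 14 = c j 0"
          using s1 by (simp add: c_def)
      next
        fix s2 assume "frame 11 s s2 \<and> fst s2 11 = of_bool (ok j) \<and> fst s2 12 = j \<and> fst s2 14 = c j n"
        then have s2: "frame 11 s s2" "fst s2 11 = of_bool (ok j)" "fst s2 12 = j" "fst s2 14 = c j n" by auto
        have "ctx s2" using ctx_frame[OF s(1) s2(1)] by simp
        then have v: "val (bit_expr 6 12) s2 = of_bool (j \<in> Y)"
          using s2 j Y s(2) frame_reg[OF s2(1), of 6] val_bit[of s2 12 j 6 Y] by auto
        have "ok (Suc j) \<longleftrightarrow> ok j \<and> (j \<in> Y \<longrightarrow> 2 \<le> c j n)"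
          by (auto simp: ok_def less_Suc_eq)
        then show "run width (Assign 11 (Mul (Reg 11) (not_expr (Mul (bit_expr 6 12) (Sub (Const 2) (Reg 14)))))) s2 1
          (\<lambda>s'. fst s' 12 = j \<and> frame 11 s ((fst s')(12 := Suc j), snd s') \<and>
            fst ((fst s')(12 := Suc j), snd s') 11 = of_bool (ok (Suc j)))"
          using s2 v by (intro run_Assign) (auto simp: simple_expr_def intro!: less_width_n)
      qed
    next
      fix j s1 assume "frame 11 s s1 \<and> fst s1 11 = of_bool (ok j)"
      then show "fst s1 1 = n" using s by (auto simp: frame_def ctx_def)
    next
      show "n < 2 ^ width" by (rule less_width_n) simp
    qed (use ok_n in \<open>auto simp: ok_def\<close>)
  qed (auto simp: simple_expr_def intro!: less_width_n)
qed

lemma run_remove_neighbours: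
  assumes s: "ctx s" "fst s 9 = set_encode Y" "fst s 7 = j" and Y: "Y \<subseteq> {..<n}" and j: "j < n"
  shows "run width remove_neighbours s (remove_neighbours_time n)
    (\<lambda>s'. frame 10 s s' \<and> fst s' 10 = set_encode (Y - {u. {j, u} \<in> E}))"
proof -
  define Z where "Z i = {u \<in> Y. u < i \<and> {j, u} \<notin> E}" for i
  have fin: "finite (Z i)" for i by (rule finite_subset[of _ "{..<i}"]) (auto simp: Z_def)
  have Z: "Z i \<subseteq> {..<n}" for i using Y by (auto simp: Z_def)
  have Z_Suc: "Z (Suc i) = (if i \<in> Y \<and> {j, i} \<notin> E then insert i (Z i) else Z i)" for i
    by (auto simp: Z_def less_Suc_eq)
  have Z_n: "Z n = Y - {u. {j, u} \<in> E}" using Y by (auto simp: Z_def)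
  show ?thesis
    unfolding remove_neighbours_def remove_neighbours_time_def
  proof (rule run_Seq, rule run_Assign, simp add: simple_expr_def, simp,
      rule run_For[where N = n and I = "\<lambda>i s'. frame 10 s s' \<and> fst s' 10 = set_encode (Z i)"])
    fix i s1 assume i: "i < n" and "frame 10 s s1 \<and> fst s1 10 = set_encode (Z i)" "fst s1 13 = i"
    then have s1: "frame 10 s s1" "fst s1 10 = set_encode (Z i)" "fst s1 13 = i" by auto
    have "ctx s1" using ctx_frame[OF s(1) s1(1)] by simp
    then have v: "val (bit_expr 9 13) s1 = of_bool (i \<in> Y)" "val (adj_expr 7 13) s1 = of_bool ({j, i} \<in> E)"
        "val (Load (pow_addr 13)) s1 = 2 ^ i"
      using s1 i j Y s frame_reg[OF s1(1), of 9] frame_reg[OF s1(1), of 7]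
        val_bit[of s1 13 i 9 Y] val_adj[of s1 7 j 13 i] val_pow[of s1 13 i] by auto
    let ?e = "Add (Reg 10) (Mul (Mul (bit_expr 9 13) (not_expr (adj_expr 7 13))) (Load (pow_addr 13)))"
    \<comment> \<open>Hence adding \<open>2 ^ i\<close> to the code amounts to inserting
      \<open>i\<close>.\<close>
    have "i \<notin> Z i" by (simp add: Z_def)
    then have "val ?e s1 = set_encode (Z (Suc i))"
      using v s1(2) fin by (auto simp: Z_Suc simp del: val.simps(3))
    then show "run width (Assign 10 ?e) s1 1
      (\<lambda>s'. fst s' 13 = i \<and> frame 10 s ((fst s')(13 := Suc i), snd s')
        \<and> fst ((fst s')(13 := Suc i), snd s') 10 = set_encode (Z (Suc i)))"
      using s1 set_encode_less[OF Z]
      by (intro run_Assign) (auto simp del: val.simps simp: simple_expr_def intro!: less_width_set)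
  next
    fix i s1 assume "frame 10 s s1 \<and> fst s1 10 = set_encode (Z i)"
    then show "fst s1 1 = n" using s by (auto simp: frame_def ctx_def)
  next
    show "n < 2 ^ width" by (rule less_width_n) simp
  qed (use Z_n in \<open>auto simp: Z_def\<close>)
qed

end

section \<open>Enumeration, powers and the Moebius transform\<close>

definition extend_list :: prog where
  "extend_list = Seq (Assign 9 (Load (list_cell 5)))
    (Seq (Assign 6 (Add (Reg 9) (Load (pow_addr 7))))
    (Seq remove_neighbours
    (Seq residual_test
    (If (Reg 11)
      (Seq (Store (list_cell 4) (Reg 6))
      (Seq (Store (value_cell (Reg 6)) (Add (Load (value_cell (Reg 9))) (Load (value_cell (Reg 10)))))
      (Assign 4 (Add (Reg 4) (Const 1)))))
      Skip))))"

definition extend_list_time :: "nat \<Rightarrow> nat" where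
  "extend_list_time n = 1 + (1 + (remove_neighbours_time n + (residual_test_time n + (1 + (1 + (1 + 1))))))"

text \<open>Register 8 freezes the length of the list at the start of a stage, because
  \<open>extend_list\<close> increases register 4 while the loop is running.\<close>

definition enumerate_residual :: prog where
  "enumerate_residual = Seq (Assign 4 (Const 1)) (Seq (Store (Reg 3) (Const 0))
    (Seq (Store (value_cell (Const 0)) (Const 1))
    (For 7 1 (Seq (Assign 8 (Reg 4)) (For 5 8 extend_list)))))"

definition enumerate_residual_time :: "nat \<Rightarrow> nat \<Rightarrow> nat" where
  "enumerate_residual_time n D = 1 + (1 + (1 + (n * ((1 + (D * (extend_list_time n + 2) + 2)) + 2) + 2)))"

definition take_powers :: prog where
  "take_powers = Seq (Assign 9 (Sub (Reg 2) (Const 2))) (For 5 4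
    (Seq (Assign 6 (Load (list_cell 5)))
    (Seq (Assign 14 (Const 1))
    (Seq (For 13 9 (Assign 14 (Mul (Reg 14) (Load (value_cell (Reg 6))))))
    (Store (value_cell (Reg 6)) (Reg 14))))))"

definition take_powers_time :: "nat \<Rightarrow> nat \<Rightarrow> nat" where
  "take_powers_time n D = 1 + (D * ((1 + (1 + ((n * (1 + 2) + 2) + 1))) + 2) + 2)"

text \<open>The bit of the vertex replaces a branch: for a set without it, the second address falls
  back to the set itself and the subtrahend is multiplied by 0.\<close>

definition moebius :: prog where
  "moebius = For 7 1 (For 5 4
    (Seq (Assign 6 (Load (list_cell 5)))
    (Store (value_cell (Reg 6)) (Sub (Load (value_cell (Reg 6)))
      (Mul (bit_expr 6 7) (Load (value_cell (Sub (Reg 6) (Mul (bit_expr 6 7) (Load (pow_addr 7)))))))))))"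

definition moebius_time :: "nat \<Rightarrow> nat \<Rightarrow> nat" where
  "moebius_time n D = n * ((D * ((1 + 1) + 2) + 2) + 2) + 2"

context counting
begin

abbreviation residuals :: "nat \<Rightarrow> nat set list" where
  "residuals \<equiv> residual_list n E"

definition stored_list :: "(nat \<Rightarrow> nat) \<Rightarrow> nat set list \<Rightarrow> bool" where
  "stored_list M xs \<longleftrightarrow> (\<forall>i<length xs. M (stride + i) = set_encode (xs ! i))"

definition stored_values :: "(nat \<Rightarrow> nat) \<Rightarrow> nat set list \<Rightarrow> (nat set \<Rightarrow> nat) \<Rightarrow> bool" where
  "stored_values M xs f \<longleftrightarrow> (\<forall>Y\<in>set xs. M (2 * stride + set_encode Y) = f Y)"

definition family :: "nat set list \<Rightarrow> bool" where
  "family xs \<longleftrightarrow> distinct xs \<and> set xs \<subseteq> Pow {..<n}"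

lemma family_length:
  assumes "family xs"
  shows "length xs \<le> 2 ^ n"
proof -
  have "length xs = card (set xs)" using assms by (simp add: family_def distinct_card)
  also have "\<dots> \<le> card (Pow {..<n})" using assms by (intro card_mono) (auto simp: family_def)
  finally show ?thesis by (simp add: card_Pow)
qed

lemma family_residuals: "family (residuals j)"
  unfolding family_def using distinct_residual_list set_residual_list[of n E j] by (auto simp: residual_def)

lemma power_less_stride: "2 ^ n < stride"
  by (simp add: stride_def)

lemma set_encode_less_stride: "Y \<subseteq> {..<n} \<Longrightarrow> set_encode Y < stride"
  using set_encode_less power_less_stride less_trans by blast

lemma tables_low:
  assumes "tables M" "\<And>a. a < stride \<Longrightarrow> M' a = M a"
  shows "tables M'"
proof -
  have "1 + (n * u + v) < stride" if "u < n" "v < n" for u v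
  proof -
    have "n * u + v < n * Suc u" using that by simp
    also have "\<dots> \<le> n * n" using that by (intro mult_left_mono) auto
    finally show ?thesis by (simp add: stride_def)
  qed
  moreover have "n * n + 1 + u < stride" if "u < n" for u using that by (simp add: stride_def)
  ultimately show ?thesis using assms by (simp add: tables_def)
qed

lemma tables_upd [simp]: "stride \<le> a \<Longrightarrow> tables (M(a := x)) \<longleftrightarrow> tables M"
  using tables_low[of M "M(a := x)"] tables_low[of "M(a := x)" M] by auto

lemma ctx_store [simp]: "stride \<le> a \<Longrightarrow> ctx (f, M(a := x)) \<longleftrightarrow> ctx (f, M)"
  by (simp add: ctx_def)

lemma stored_list_upd [simp]:
  assumes "2 * stride \<le> a" "family xs"
  shows "stored_list (M(a := x)) xs \<longleftrightarrow> stored_list M xs"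
proof -
  have "stride + i \<noteq> a" if "i < length xs" for i
    using that assms family_length[OF assms(2)] power_less_stride by linarith
  then show ?thesis by (simp add: stored_list_def)
qed

lemma stored_list_append:
  "stored_list (M(stride + length xs := set_encode Y)) (xs @ [Y]) \<longleftrightarrow> stored_list M xs"
  unfolding stored_list_def by (auto simp: nth_append less_Suc_eq)

lemma stored_values_list_upd [simp]:
  assumes "a < 2 * stride"
  shows "stored_values (M(a := x)) xs f \<longleftrightarrow> stored_values M xs f"
  using assms by (auto simp: stored_values_def)

lemma stored_values_append:
  assumes "family (xs @ [Y])"
  shows "stored_values (M(2 * stride + set_encode Y := f Y)) (xs @ [Y]) f \<longleftrightarrow> stored_values M xs f"
proof -
  have "set_encode Z \<noteq> set_encode Y" if "Z \<in> set xs" for Z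
    using assms that set_encode_eq_iff[of Z n Y] by (auto simp: family_def)
  then show ?thesis by (auto simp: stored_values_def)
qed

text \<open>The contents of the list block in the middle of stage \<open>j\<close>, when
  \<open>i\<close> sets of the previous stage have been tried; the invariant of the inner
  loop.\<close>

definition partial_list :: "nat \<Rightarrow> nat \<Rightarrow> nat set list" where
  "partial_list j i = residuals j @ filter (\<lambda>Y. Y \<in> residual {..<n} E) (map (insert j) (take i (residuals j)))"

lemma partial_list_Suc:
  assumes "i < length (residuals j)"
  shows "partial_list j (Suc i) = (if insert j (residuals j ! i) \<in> residual {..<n} E
    then partial_list j i @ [insert j (residuals j ! i)] else partial_list j i)"
  using assms by (simp add: partial_list_def take_Suc_conv_app_nth)

lemma partial_list_0: "partial_list j 0 = residuals j"
  by (simp add: partial_list_def)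

lemma partial_list_length: "partial_list j (length (residuals j)) = residuals (Suc j)"
  by (simp add: partial_list_def)

text \<open>A prefix of the next full list, whose sets are distinct.\<close>

lemma family_partial_list: "family (partial_list j i)"
proof -
  have "map (insert j) (residuals j) = map (insert j) (take i (residuals j)) @ map (insert j) (drop i (residuals j))"
    by (simp flip: map_append)
  then have "residuals (Suc j) = partial_list j i @ filter (\<lambda>Y. Y \<in> residual {..<n} E) (map (insert j) (drop i (residuals j)))"
    by (simp add: partial_list_def)
  then show ?thesis using family_residuals[of "Suc j"] unfolding family_def by simp
qed

definition enum_inv :: "nat set list \<Rightarrow> state \<Rightarrow> bool" where
  "enum_inv xs s \<longleftrightarrow> ctx s \<and> fst s 4 = length xs \<and> stored_list (snd s) xs
     \<and> stored_values (snd s) xs (independent_count E)"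

lemma enum_inv_upd [simp]: "4 < r \<Longrightarrow> enum_inv xs (f(r := x), M) \<longleftrightarrow> enum_inv xs (f, M)"
  by (simp add: enum_inv_def)

lemma enum_inv_frame: "enum_inv xs s \<Longrightarrow> frame m s s' \<Longrightarrow> 4 < m \<Longrightarrow> enum_inv xs s'"
  unfolding enum_inv_def using ctx_frame[of s m s'] by (simp add: frame_def)

lemma independent_count_less: "Y \<subseteq> {..<n} \<Longrightarrow> independent_count E Y \<le> 2 ^ n"
proof -
  assume Y: "Y \<subseteq> {..<n}"
  then have "finite Y" using finite_subset by blast
  then have "independent_count E Y \<le> 2 ^ card Y" by (rule independent_count_le)
  also have "\<dots> \<le> 2 ^ n" using Y card_mono[of "{..<n}" Y] by (intro power_increasing) auto
  finally show ?thesis .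
qed

text \<open>Registers 5, 7 and 8 have to survive as counters and limit of the enclosing loops, while
  register 6 is overwritten by the candidate.\<close>

lemma run_extend_list:
  assumes inv: "enum_inv (partial_list j i) s" and j: "j < n" and i: "i < length (residuals j)"
    and regs: "fst s 5 = i" "fst s 7 = j"
  shows "run width extend_list s (extend_list_time n)
    (\<lambda>s'. enum_inv (partial_list j (Suc i)) s' \<and> (\<forall>r. 4 < r \<and> r < 9 \<and> r \<noteq> 6 \<longrightarrow> fst s' r = fst s r))"
proof -
  define xs where "xs = partial_list j i"
  define Y where "Y = residuals j ! i"
  have "Y \<in> set (residuals j)" using i by (simp add: Y_def)
  then have Y: "Y \<in> residual {..<n} E" "Y \<subseteq> {..<j}" by (auto simp: set_residual_list)
  then have Yn: "Y \<subseteq> {..<n}" "insert j Y \<subseteq> {..<n}" and jY: "j \<notin> Y" and finY: "finite Y"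
    using j finite_subset by (auto simp: residual_def)
  have encY: "set_encode (insert j Y) = set_encode Y + 2 ^ j" using jY finY by simp
  let ?Z = "Y - {u. {j, u} \<in> E}"
  \<comment> \<open>By closure under subsets the second term of the recurrence belongs to the list
    too, so its count has been stored.\<close>
  have "?Z \<in> set (residuals j)"
    using Y residual_subset[OF Y(1), of ?Z] by (auto simp: set_residual_list)
  then have mem: "Y \<in> set xs" "?Z \<in> set xs"
    using \<open>Y \<in> set (residuals j)\<close> by (auto simp: xs_def partial_list_def)
  have len: "i < length xs" "xs ! i = Y" using i by (auto simp: xs_def partial_list_def Y_def nth_append)
  have inv': "ctx s" "fst s 4 = length xs" "stored_list (snd s) xs" "stored_values (snd s) xs (independent_count E)"
    using inv by (auto simp: enum_inv_def xs_def)
  have regs3: "fst s 3 = stride" using inv' by (simp add: ctx_def)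
  have load: "snd s (stride + i) = set_encode Y" using inv'(3) len by (auto simp: stored_list_def)
  define s1 where "s1 = ((fst s)(9 := set_encode Y), snd s)"
  define s2 where "s2 = ((fst s1)(6 := set_encode (insert j Y)), snd s1)"
  have inv2: "enum_inv xs s2" using inv by (simp add: s2_def s1_def xs_def)
  have regs2: "fst s2 5 = i" "fst s2 7 = j" "fst s2 9 = set_encode Y" "fst s2 6 = set_encode (insert j Y)"
    using regs by (simp_all add: s2_def s1_def)
  have "val (Load (pow_addr 7)) s1 = 2 ^ j"
    using inv' regs j by (intro val_pow) (auto simp: s1_def)
  then have val6: "val (Add (Reg 9) (Load (pow_addr 7))) s1 = set_encode (insert j Y)"
    using encY by (simp add: s1_def del: val.simps(3))
  have step: "run width (If (Reg 11)
      (Seq (Store (list_cell 4) (Reg 6))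
      (Seq (Store (value_cell (Reg 6)) (Add (Load (value_cell (Reg 9))) (Load (value_cell (Reg 10)))))
      (Assign 4 (Add (Reg 4) (Const 1)))))
      Skip) s4 (1 + (1 + (1 + 1)))
      (\<lambda>s'. enum_inv (partial_list j (Suc i)) s' \<and> (\<forall>r. 4 < r \<and> r < 9 \<and> r \<noteq> 6 \<longrightarrow> fst s' r = fst s r))"
    if s4: "frame 10 s2 s4" "fst s4 10 = set_encode ?Z" "fst s4 11 = of_bool (insert j Y \<in> residual {..<n} E)" for s4
  proof -
    have inv4: "enum_inv xs s4" using inv2 s4(1) by (rule enum_inv_frame) simp
    then have c4: "ctx s4" "fst s4 4 = length xs" "stored_list (snd s4) xs" "stored_values (snd s4) xs (independent_count E)"
      by (auto simp: enum_inv_def)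
    have r4: "fst s4 3 = stride" "fst s4 9 = set_encode Y" "fst s4 6 = set_encode (insert j Y)"
      using c4(1) s4(1) regs2 by (auto simp: ctx_def frame_def)
    have fr: "\<forall>r. 4 < r \<and> r < 9 \<and> r \<noteq> 6 \<longrightarrow> fst s4 r = fst s r"
      using s4(1) by (simp add: frame_def s2_def s1_def)
    show ?thesis
    proof (rule run_If)
      assume "val (Reg 11) s4 \<noteq> 0"
      then have res: "insert j Y \<in> residual {..<n} E" using s4(3) by (simp split: if_splits)
      then have ext: "partial_list j (Suc i) = xs @ [insert j Y]"
        using i by (simp add: partial_list_Suc xs_def Y_def)
      have famx: "family (xs @ [insert j Y])" using family_partial_list[of j "Suc i"] ext by simp
      have lt: "length xs < 2 ^ n" using family_length[OF famx] by simp
      define M where "M = (snd s4)(stride + length xs := set_encode (insert j Y))"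
      have ld: "snd s4 (2 * stride + set_encode Y) = independent_count E Y"
        "snd s4 (2 * stride + set_encode ?Z) = independent_count E ?Z"
        using c4(4) mem by (auto simp: stored_values_def)
      \<comment> \<open>Appending to the list does not destroy a count: with fewer than
        \<open>2 ^ n < stride\<close> entries the list stays inside its block.\<close>
      have ne: "2 * stride + x \<noteq> stride + length xs" for x using lt power_less_stride by linarith
      have cnt: "independent_count E (insert j Y) = independent_count E Y + independent_count E ?Z"
        using finY jY no_loop[OF graph] by (rule independent_count_insert)
      define s5 where "s5 = (fst s4, M)"
      define s6 where "s6 = (fst s4, M(2 * stride + set_encode (insert j Y) := independent_count E (insert j Y)))"
      have v5: "val (Add (Load (value_cell (Reg 9))) (Load (value_cell (Reg 10)))) s5 = independent_count E (insert j Y)"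
        using ld ne cnt r4 s4(2) by (simp add: s5_def M_def)
      have fin: "enum_inv (xs @ [insert j Y]) ((fst s4)(4 := Suc (length xs)), snd s6)"
      proof -
        have "stored_list (snd s6) (xs @ [insert j Y])"
          using stored_list_append[of "snd s4" xs "insert j Y"] c4(3) famx by (simp add: s6_def M_def)
        moreover have "stored_values (snd s6) (xs @ [insert j Y]) (independent_count E)"
          using stored_values_append[OF famx, of M "independent_count E"] c4(4) lt power_less_stride
          by (simp add: s6_def M_def)
        moreover have "ctx ((fst s4)(4 := Suc (length xs)), snd s6)"
          using c4(1) by (simp add: s6_def M_def)
        ultimately show ?thesis by (simp add: enum_inv_def)
      qed
      show "run width (Seq (Store (list_cell 4) (Reg 6))
        (Seq (Store (value_cell (Reg 6)) (Add (Load (value_cell (Reg 9))) (Load (value_cell (Reg 10)))))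
        (Assign 4 (Add (Reg 4) (Const 1))))) s4 (1 + (1 + 1))
        (\<lambda>s'. enum_inv (partial_list j (Suc i)) s' \<and> (\<forall>r. 4 < r \<and> r < 9 \<and> r \<noteq> 6 \<longrightarrow> fst s' r = fst s r))"
      proof (rule run_Seq, rule run_Store)
        have "(fst s4, (snd s4)(val (list_cell 4) s4 := val (Reg 6) s4)) = s5"
          using r4 c4(2) by (simp add: s5_def M_def)
        moreover have "run width (Seq (Store (value_cell (Reg 6)) (Add (Load (value_cell (Reg 9))) (Load (value_cell (Reg 10)))))
          (Assign 4 (Add (Reg 4) (Const 1)))) s5 (1 + 1)
          (\<lambda>s'. enum_inv (partial_list j (Suc i)) s' \<and> (\<forall>r. 4 < r \<and> r < 9 \<and> r \<noteq> 6 \<longrightarrow> fst s' r = fst s r))"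
        proof (rule run_Seq, rule run_Store)
          have "(fst s5, (snd s5)(val (value_cell (Reg 6)) s5 :=
              val (Add (Load (value_cell (Reg 9))) (Load (value_cell (Reg 10)))) s5)) = s6"
            unfolding v5 using r4 by (simp add: s5_def s6_def)
          moreover have "run width (Assign 4 (Add (Reg 4) (Const 1))) s6 1
            (\<lambda>s'. enum_inv (partial_list j (Suc i)) s' \<and> (\<forall>r. 4 < r \<and> r < 9 \<and> r \<noteq> 6 \<longrightarrow> fst s' r = fst s r))"
          proof (rule run_Assign)
            have "val (Add (Reg 4) (Const 1)) s6 = Suc (length xs)" using c4(2) by (simp add: s6_def)
            moreover have "Suc (length xs) < 2 ^ width"
              using lt by (intro less_width_pow) simp
            ultimately show "val (Add (Reg 4) (Const 1)) s6 < 2 ^ width" by simp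
            show "enum_inv (partial_list j (Suc i)) ((fst s6)(4 := val (Add (Reg 4) (Const 1)) s6), snd s6) \<and>
              (\<forall>r. 4 < r \<and> r < 9 \<and> r \<noteq> 6 \<longrightarrow> fst ((fst s6)(4 := val (Add (Reg 4) (Const 1)) s6), snd s6) r = fst s r)"
              using fin fr \<open>val (Add (Reg 4) (Const 1)) s6 = Suc (length xs)\<close> by (simp add: ext s6_def)
          qed (simp add: simple_expr_def)
          ultimately show "run width (Assign 4 (Add (Reg 4) (Const 1)))
            (fst s5, (snd s5)(val (value_cell (Reg 6)) s5 :=
              val (Add (Load (value_cell (Reg 9))) (Load (value_cell (Reg 10)))) s5)) 1
            (\<lambda>s'. enum_inv (partial_list j (Suc i)) s' \<and> (\<forall>r. 4 < r \<and> r < 9 \<and> r \<noteq> 6 \<longrightarrow> fst s' r = fst s r))"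
            by simp
          show "val (Add (Load (value_cell (Reg 9))) (Load (value_cell (Reg 10)))) s5 < 2 ^ width"
            unfolding v5 using independent_count_less[OF Yn(2)] by (rule less_width_pow)
        qed (simp_all add: simple_expr_def)
        ultimately show "run width (Seq (Store (value_cell (Reg 6)) (Add (Load (value_cell (Reg 9))) (Load (value_cell (Reg 10)))))
          (Assign 4 (Add (Reg 4) (Const 1)))) (fst s4, (snd s4)(val (list_cell 4) s4 := val (Reg 6) s4)) (1 + 1)
          (\<lambda>s'. enum_inv (partial_list j (Suc i)) s' \<and> (\<forall>r. 4 < r \<and> r < 9 \<and> r \<noteq> 6 \<longrightarrow> fst s' r = fst s r))"
          by simp
        show "val (Reg 6) s4 < 2 ^ width" using r4 set_encode_less[OF Yn(2)] by (simp add: less_width_set)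
      qed (simp_all add: simple_expr_def)
    next
      assume "val (Reg 11) s4 = 0"
      then have "insert j Y \<notin> residual {..<n} E" using s4(3) by simp
      then have "partial_list j (Suc i) = xs" using i by (simp add: partial_list_Suc xs_def Y_def)
      then show "run width Skip s4 (1 + (1 + 1))
        (\<lambda>s'. enum_inv (partial_list j (Suc i)) s' \<and> (\<forall>r. 4 < r \<and> r < 9 \<and> r \<noteq> 6 \<longrightarrow> fst s' r = fst s r))"
        using inv4 fr by (intro run_Skip) auto
    qed (simp add: simple_expr_def)
  qed
  have part: "run width (Seq remove_neighbours (Seq residual_test (If (Reg 11)
      (Seq (Store (list_cell 4) (Reg 6))
      (Seq (Store (value_cell (Reg 6)) (Add (Load (value_cell (Reg 9))) (Load (value_cell (Reg 10)))))
      (Assign 4 (Add (Reg 4) (Const 1)))))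
      Skip))) s2 (remove_neighbours_time n + (residual_test_time n + (1 + (1 + (1 + 1)))))
      (\<lambda>s'. enum_inv (partial_list j (Suc i)) s' \<and> (\<forall>r. 4 < r \<and> r < 9 \<and> r \<noteq> 6 \<longrightarrow> fst s' r = fst s r))"
  proof (rule run_Seq, rule run_mono[OF run_remove_neighbours[of s2 Y j] order.refl], goal_cases)
    case 1
    then show ?case using inv2 by (simp add: enum_inv_def)
  next
    case (6 s3)
    then have s3: "frame 10 s2 s3" "fst s3 10 = set_encode ?Z" by auto
    show ?case
    proof (rule run_Seq, rule run_mono[OF run_residual_test[of s3 "insert j Y"] order.refl], goal_cases)
      case 1
      then show ?case using enum_inv_frame[OF inv2 s3(1)] by (simp add: enum_inv_def)
    next
      case 2
      then show ?case using frame_reg[OF s3(1), of 6] regs2 by simp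
    next
      case (4 s4)
      then have "frame 10 s2 s4" "fst s4 10 = set_encode ?Z" using s3 by (auto simp: frame_def)
      then show ?case using 4 step by blast
    qed (use Yn in auto)
  qed (use regs2 Yn j in auto)
  show ?thesis
    unfolding extend_list_def extend_list_time_def
  proof (rule run_Seq, rule run_Assign)
    have v: "val (Load (list_cell 5)) s = set_encode Y" using regs regs3 load by simp
    show "val (Load (list_cell 5)) s < 2 ^ width" unfolding v using set_encode_less[OF Yn(1)] by (rule less_width_set)
    show "run width (Seq (Assign 6 (Add (Reg 9) (Load (pow_addr 7)))) (Seq remove_neighbours (Seq residual_test (If (Reg 11)
        (Seq (Store (list_cell 4) (Reg 6))
        (Seq (Store (value_cell (Reg 6)) (Add (Load (value_cell (Reg 9))) (Load (value_cell (Reg 10)))))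
        (Assign 4 (Add (Reg 4) (Const 1)))))
        Skip)))) ((fst s)(9 := val (Load (list_cell 5)) s), snd s)
        (1 + (remove_neighbours_time n + (residual_test_time n + (1 + (1 + (1 + 1))))))
        (\<lambda>s'. enum_inv (partial_list j (Suc i)) s' \<and> (\<forall>r. 4 < r \<and> r < 9 \<and> r \<noteq> 6 \<longrightarrow> fst s' r = fst s r))"
      unfolding v s1_def[symmetric]
    proof (rule run_Seq, rule run_Assign)
      show "val (Add (Reg 9) (Load (pow_addr 7))) s1 < 2 ^ width"
        unfolding val6 using set_encode_less[OF Yn(2)] by (rule less_width_set)
    qed (use part in \<open>simp_all add: simple_expr_def val6 s2_def[symmetric] del: val.simps\<close>)
  qed (simp add: simple_expr_def)
qed


definition D :: nat where "D = card (residual {..<n} E)"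

lemma length_residuals: "j \<le> n \<Longrightarrow> length (residuals j) \<le> D"
  unfolding D_def by (rule length_residual_list)

definition list_ctx :: "state \<Rightarrow> bool" where
  "list_ctx s \<longleftrightarrow> ctx s \<and> fst s 4 = length (residuals n) \<and> stored_list (snd s) (residuals n)"

lemma run_enumerate_residual:
  assumes s: "ctx s"
  shows "run width enumerate_residual s (enumerate_residual_time n D)
    (\<lambda>s'. list_ctx s' \<and> stored_values (snd s') (residuals n) (independent_count E))"
proof -
  \<comment> \<open>Length 1, code 0 and count 1: the list starts with the empty set alone.\<close>
  define s1 where "s1 = ((fst s)(4 := 1), snd s)"
  define s2 where "s2 = (fst s1, (snd s1)(stride := 0))"
  define s3 where "s3 = (fst s2, (snd s2)(2 * stride := 1))"
  have r: "fst s1 3 = stride" "fst s2 3 = stride" using s by (simp_all add: ctx_def s1_def s2_def)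
  have "stride > 0" using power_less_stride by linarith
  then have inv3: "enum_inv (residuals 0) s3"
    using s by (simp add: enum_inv_def s3_def s2_def s1_def stored_list_def stored_values_def independent_count_empty)
  have loop: "run width (For 7 1 (Seq (Assign 8 (Reg 4)) (For 5 8 extend_list))) s3
    (n * ((1 + (D * (extend_list_time n + 2) + 2)) + 2) + 2)
    (\<lambda>s'. list_ctx s' \<and> stored_values (snd s') (residuals n) (independent_count E))"
  proof (rule run_For[where I = "\<lambda>j. enum_inv (residuals j)"])
    fix j s4 assume j: "j < n" "enum_inv (residuals j) s4" "fst s4 7 = j"
    define s5 where "s5 = ((fst s4)(8 := length (residuals j)), snd s4)"
    have inner: "run width (For 5 8 extend_list) s5 (length (residuals j) * (extend_list_time n + 2) + 2)
      (\<lambda>s'. enum_inv (residuals (Suc j)) s' \<and> fst s' 7 = j)"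
    proof (rule run_For[where I = "\<lambda>i s'. enum_inv (partial_list j i) s' \<and> fst s' 7 = j \<and> fst s' 8 = length (residuals j)"])
      fix i s6 assume i: "i < length (residuals j)"
        and "enum_inv (partial_list j i) s6 \<and> fst s6 7 = j \<and> fst s6 8 = length (residuals j)" "fst s6 5 = i"
      then have s6: "enum_inv (partial_list j i) s6" "fst s6 7 = j" "fst s6 8 = length (residuals j)" "fst s6 5 = i"
        by auto
      show "run width extend_list s6 (extend_list_time n)
        (\<lambda>s'. fst s' 5 = i \<and> enum_inv (partial_list j (Suc i)) ((fst s')(5 := Suc i), snd s') \<and>
           fst ((fst s')(5 := Suc i), snd s') 7 = j \<and> fst ((fst s')(5 := Suc i), snd s') 8 = length (residuals j))"
        by (rule run_mono[OF run_extend_list[OF s6(1) j(1) i s6(4) s6(2)] order.refl]) (use s6 in auto)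
    next
      show "length (residuals j) < 2 ^ width"
        using family_length[OF family_residuals] by (rule less_width_pow)
    qed (use j in \<open>auto simp: partial_list_0 partial_list_length s5_def\<close>)
    have "run width (Seq (Assign 8 (Reg 4)) (For 5 8 extend_list)) s4
        (1 + (length (residuals j) * (extend_list_time n + 2) + 2))
        (\<lambda>s'. enum_inv (residuals (Suc j)) s' \<and> fst s' 7 = j)"
    proof (rule run_Seq, rule run_Assign)
      have v: "val (Reg 4) s4 = length (residuals j)" using j by (simp add: enum_inv_def)
      show "val (Reg 4) s4 < 2 ^ width"
        unfolding v using family_length[OF family_residuals] by (rule less_width_pow)
      show "run width (For 5 8 extend_list) ((fst s4)(8 := val (Reg 4) s4), snd s4)
        (length (residuals j) * (extend_list_time n + 2) + 2)
        (\<lambda>s'. enum_inv (residuals (Suc j)) s' \<and> fst s' 7 = j)"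
        unfolding v using inner by (simp add: s5_def)
    qed (simp add: simple_expr_def)
    moreover have "1 + (length (residuals j) * (extend_list_time n + 2) + 2) \<le> 1 + (D * (extend_list_time n + 2) + 2)"
      using length_residuals[of j] j by (intro add_mono mult_right_mono) auto
    ultimately show "run width (Seq (Assign 8 (Reg 4)) (For 5 8 extend_list)) s4
        (1 + (D * (extend_list_time n + 2) + 2))
        (\<lambda>s'. fst s' 7 = j \<and> enum_inv (residuals (Suc j)) ((fst s')(7 := Suc j), snd s'))"
      by (rule run_mono) (auto simp: enum_inv_def simp del: residual_list.simps)
  next
    show "n < 2 ^ width" by (rule less_width_n) simp
  qed (use inv3 in \<open>auto simp: enum_inv_def list_ctx_def ctx_def\<close>)
  show ?thesis
    unfolding enumerate_residual_def enumerate_residual_time_def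
  proof (rule run_Seq, rule run_Assign)
    have v1: "((fst s)(4 := val (Const 1) s), snd s) = s1" by (simp add: s1_def)
    show "run width (Seq (Store (Reg 3) (Const 0)) (Seq (Store (value_cell (Const 0)) (Const 1))
        (For 7 1 (Seq (Assign 8 (Reg 4)) (For 5 8 extend_list))))) ((fst s)(4 := val (Const 1) s), snd s)
        (1 + (1 + (n * ((1 + (D * (extend_list_time n + 2) + 2)) + 2) + 2)))
        (\<lambda>s'. list_ctx s' \<and> stored_values (snd s') (residuals n) (independent_count E))"
      unfolding v1
    proof (rule run_Seq, rule run_Store)
      have v2: "(fst s1, (snd s1)(val (Reg 3) s1 := val (Const 0) s1)) = s2" using r by (simp add: s2_def)
      show "run width (Seq (Store (value_cell (Const 0)) (Const 1))
        (For 7 1 (Seq (Assign 8 (Reg 4)) (For 5 8 extend_list)))) (fst s1, (snd s1)(val (Reg 3) s1 := val (Const 0) s1))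
        (1 + (n * ((1 + (D * (extend_list_time n + 2) + 2)) + 2) + 2))
        (\<lambda>s'. list_ctx s' \<and> stored_values (snd s') (residuals n) (independent_count E))"
        unfolding v2
      proof (rule run_Seq, rule run_Store)
        have v3: "(fst s2, (snd s2)(val (value_cell (Const 0)) s2 := val (Const 1) s2)) = s3"
          using r by (simp add: s3_def)
        show "run width (For 7 1 (Seq (Assign 8 (Reg 4)) (For 5 8 extend_list)))
          (fst s2, (snd s2)(val (value_cell (Const 0)) s2 := val (Const 1) s2))
          (n * ((1 + (D * (extend_list_time n + 2) + 2)) + 2) + 2)
          (\<lambda>s'. list_ctx s' \<and> stored_values (snd s') (residuals n) (independent_count E))"
          unfolding v3 by (rule loop)
      qed (auto simp: simple_expr_def intro: less_width_n)
    qed (auto simp: simple_expr_def intro: less_width_n)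
  qed (auto simp: simple_expr_def intro: less_width_n)
qed

text \<open>A pass that replaces the values \<open>f\<close> by \<open>g\<close>, interrupted after
  \<open>i\<close> sets. It is phrased by positions, as these tell which values are already
  new.\<close>

definition stored_update :: "(nat \<Rightarrow> nat) \<Rightarrow> (nat set \<Rightarrow> nat) \<Rightarrow> (nat set \<Rightarrow> nat) \<Rightarrow> nat \<Rightarrow> bool" where
  "stored_update M f g i \<longleftrightarrow> (\<forall>l<length (residuals n).
     M (2 * stride + set_encode (residuals n ! l)) = (if l < i then g else f) (residuals n ! l))"

lemma stored_update_0: "stored_update M f g 0 \<longleftrightarrow> stored_values M (residuals n) f"
  by (auto simp: stored_update_def stored_values_def set_conv_nth)

lemma stored_update_length: "stored_update M f g (length (residuals n)) \<longleftrightarrow> stored_values M (residuals n) g"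
  by (auto simp: stored_update_def stored_values_def set_conv_nth)

lemma stored_update_Suc:
  assumes "stored_update M f g i" "i < length (residuals n)" "Y = residuals n ! i"
  shows "stored_update (M(2 * stride + set_encode Y := g Y)) f g (Suc i)"
proof -
  have "set_encode (residuals n ! l) \<noteq> set_encode (residuals n ! i)"
    if "l < length (residuals n)" "l \<noteq> i" for l
  proof -
    have "residuals n ! l \<noteq> residuals n ! i"
      using that assms(2) family_residuals[of n] by (simp add: family_def nth_eq_iff_index_eq)
    moreover have "residuals n ! l \<subseteq> {..<n}" "residuals n ! i \<subseteq> {..<n}"
      using family_residuals[of n] that assms(2) nth_mem unfolding family_def by blast+
    ultimately show ?thesis by (simp add: set_encode_eq_iff)
  qed
  then show ?thesis using assms by (auto simp: stored_update_def less_Suc_eq)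
qed

lemma residuals_nth:
  assumes "i < length (residuals n)"
  shows "residuals n ! i \<in> residual {..<n} E" "residuals n ! i \<subseteq> {..<n}"
  using nth_mem[OF assms] by (auto simp: set_residual_list)

lemma list_ctx_upd [simp]: "4 < r \<Longrightarrow> list_ctx (f(r := x), M) \<longleftrightarrow> list_ctx (f, M)"
  by (simp add: list_ctx_def)

lemma list_ctx_store [simp]: "2 * stride \<le> a \<Longrightarrow> list_ctx (f, M(a := x)) \<longleftrightarrow> list_ctx (f, M)"
  by (simp add: list_ctx_def family_residuals)

lemma list_ctx_regs:
  "list_ctx s \<Longrightarrow> fst s 1 = n \<and> fst s 2 = k \<and> fst s 3 = stride \<and> fst s 4 = length (residuals n)"
  by (simp add: list_ctx_def ctx_def)

lemma list_ctx_cell: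
  assumes "list_ctx s" "fst s 5 = i" "i < length (residuals n)"
  shows "val (Load (list_cell 5)) s = set_encode (residuals n ! i)"
  using assms by (simp add: list_ctx_def ctx_def stored_list_def)

lemma run_load_set:
  assumes "list_ctx s" "fst s 5 = i" "i < length (residuals n)"
    and "run width c ((fst s)(6 := set_encode (residuals n ! i)), snd s) T P"
  shows "run width (Seq (Assign 6 (Load (list_cell 5))) c) s (1 + T) P"
proof (rule run_Seq, rule run_Assign)
  show "val (Load (list_cell 5)) s < 2 ^ width"
    unfolding list_ctx_cell[OF assms(1-3)] using set_encode_less[OF residuals_nth(2)[OF assms(3)]]
    by (rule less_width_set)
  show "run width c ((fst s)(6 := val (Load (list_cell 5)) s), snd s) T P"
    unfolding list_ctx_cell[OF assms(1-3)] by (rule assms(4))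
qed (simp add: simple_expr_def)

lemma length_residuals_less: "length (residuals j) < 2 ^ width"
  using family_length[OF family_residuals] by (rule less_width_pow)

lemma run_take_powers:
  assumes k_less: "k < n"
    and s: "list_ctx s" "stored_values (snd s) (residuals n) f" and f: "\<And>Y. Y \<subseteq> {..<n} \<Longrightarrow> f Y \<le> 2 ^ n"
  shows "run width take_powers s (take_powers_time n D)
    (\<lambda>s'. list_ctx s' \<and> stored_values (snd s') (residuals n) (\<lambda>Y. f Y ^ (k - 2)))"
proof -
  let ?g = "\<lambda>Y. f Y ^ (k - 2)" and ?N = "length (residuals n)"
  have f_power: "f Y ^ i < 2 ^ width" if "Y \<subseteq> {..<n}" "i \<le> n" for Y i
  proof (rule less_width)
    have "f Y ^ i \<le> (2 ^ n) ^ i" using f[OF that(1)] by (rule power_mono) simp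
    also have "\<dots> = 2 ^ (n * i)" by (simp add: power_mult)
    also have "\<dots> \<le> 2 ^ (n * n + n + 2)"
      using mult_le_mono2[OF that(2), of n] by (intro power_increasing) linarith+
    finally show "f Y ^ i \<le> 2 ^ (n * n + n + 2)" .
  qed
  have "run width take_powers s (1 + (?N * ((1 + (1 + (((k - 2) * (1 + 2) + 2) + 1))) + 2) + 2))
    (\<lambda>s'. list_ctx s' \<and> stored_values (snd s') (residuals n) ?g)"
    unfolding take_powers_def
  proof (rule run_Seq, rule run_Assign)
    have v: "val (Sub (Reg 2) (Const 2)) s = k - 2" using list_ctx_regs[OF s(1)] by simp
    then show "val (Sub (Reg 2) (Const 2)) s < 2 ^ width" using k_less by (simp add: less_width_n)
    let ?c = "Seq (Assign 14 (Const 1)) (Seq (For 13 9 (Assign 14 (Mul (Reg 14) (Load (value_cell (Reg 6))))))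
      (Store (value_cell (Reg 6)) (Reg 14)))"
    show "run width (For 5 4 (Seq (Assign 6 (Load (list_cell 5))) ?c))
      ((fst s)(9 := val (Sub (Reg 2) (Const 2)) s), snd s)
      (?N * ((1 + (1 + (((k - 2) * (1 + 2) + 2) + 1))) + 2) + 2)
      (\<lambda>s'. list_ctx s' \<and> stored_values (snd s') (residuals n) ?g)"
      unfolding v
    proof (rule run_For[where I = "\<lambda>i s'. list_ctx s' \<and> fst s' 9 = k - 2 \<and> stored_update (snd s') f ?g i"])
      fix i s1 assume i: "i < ?N" and "list_ctx s1 \<and> fst s1 9 = k - 2 \<and> stored_update (snd s1) f ?g i" "fst s1 5 = i"
      then have s1: "list_ctx s1" "fst s1 9 = k - 2" "stored_update (snd s1) f ?g i" "fst s1 5 = i" by auto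
      define Y where "Y = residuals n ! i"
      have Y: "Y \<subseteq> {..<n}" using residuals_nth[OF i] by (simp add: Y_def)
      have M: "snd s1 (2 * stride + set_encode Y) = f Y"
        using s1(3) i by (simp add: stored_update_def Y_def)
      let ?Q = "\<lambda>s'. fst s' 5 = i \<and> list_ctx ((fst s')(5 := Suc i), snd s') \<and>
            fst ((fst s')(5 := Suc i), snd s') 9 = k - 2 \<and>
            stored_update (snd ((fst s')(5 := Suc i), snd s')) f ?g (Suc i)"
      define s2 where "s2 = ((fst s1)(6 := set_encode Y, 14 := 1), snd s1)"
      have step: "run width (Seq (For 13 9 (Assign 14 (Mul (Reg 14) (Load (value_cell (Reg 6))))))
          (Store (value_cell (Reg 6)) (Reg 14))) s2 (((k - 2) * (1 + 2) + 2) + 1) ?Q"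
      proof (rule run_Seq, rule run_For[where I = "\<lambda>l s'. snd s' = snd s1 \<and> (\<forall>r<10. fst s' r = fst s2 r) \<and> fst s' 14 = f Y ^ l"])
        fix l s3 assume l: "l < k - 2" and "snd s3 = snd s1 \<and> (\<forall>r<10. fst s3 r = fst s2 r) \<and> fst s3 14 = f Y ^ l" "fst s3 13 = l"
        then have s3: "snd s3 = snd s1" "\<And>r. r < 10 \<Longrightarrow> fst s3 r = fst s2 r" "fst s3 14 = f Y ^ l" "fst s3 13 = l" by auto
        have v: "val (Mul (Reg 14) (Load (value_cell (Reg 6)))) s3 = f Y ^ Suc l"
          using s3 M list_ctx_regs[OF s1(1)] by (simp add: s2_def)
        show "run width (Assign 14 (Mul (Reg 14) (Load (value_cell (Reg 6))))) s3 1
          (\<lambda>s'. fst s' 13 = l \<and> snd ((fst s')(13 := Suc l), snd s') = snd s1 \<and>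
             (\<forall>r<10. fst ((fst s')(13 := Suc l), snd s') r = fst s2 r) \<and>
             fst ((fst s')(13 := Suc l), snd s') 14 = f Y ^ Suc l)"
        proof (rule run_Assign)
          show "val (Mul (Reg 14) (Load (value_cell (Reg 6)))) s3 < 2 ^ width"
            unfolding v using l k_less Y by (intro f_power) auto
        qed (use s3 v in \<open>auto simp: simple_expr_def\<close>)
      next
        show "k - 2 < 2 ^ width" using k_less by (intro less_width_n) simp
      next
        fix s3 assume "snd s3 = snd s1 \<and> (\<forall>r<10. fst s3 r = fst s2 r) \<and> fst s3 14 = f Y ^ (k - 2)"
        then have s3: "snd s3 = snd s1" "\<And>r. r < 10 \<Longrightarrow> fst s3 r = fst s2 r" "fst s3 14 = ?g Y" by auto
        have v: "val (value_cell (Reg 6)) s3 = 2 * stride + set_encode Y"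
          using s3 list_ctx_regs[OF s1(1)] by (simp add: s2_def)
        have c3: "list_ctx (fst s3, snd s1)" using s1(1) s3(2) by (auto simp: list_ctx_def ctx_def s2_def)
        show "run width (Store (value_cell (Reg 6)) (Reg 14)) s3 1 ?Q"
        proof (rule run_Store)
          show "val (Reg 14) s3 < 2 ^ width" using s3 k_less Y by (simp add: f_power)
          have "stored_update ((snd s1)(2 * stride + set_encode Y := ?g Y)) f ?g (Suc i)"
            using s1(3) i Y_def by (rule stored_update_Suc)
          then show "?Q (fst s3, (snd s3)(val (value_cell (Reg 6)) s3 := val (Reg 14) s3))"
            unfolding v using s1 s3 c3 by (simp add: s2_def)
        qed (simp_all add: simple_expr_def)
      qed (use s1 in \<open>auto simp: s2_def\<close>)
      show "run width (Seq (Assign 6 (Load (list_cell 5))) ?c) s1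
        (1 + (1 + (((k - 2) * (1 + 2) + 2) + 1))) ?Q"
      proof (rule run_load_set[OF s1(1) s1(4) i], rule run_Seq, rule run_Assign)
        show "run width (Seq (For 13 9 (Assign 14 (Mul (Reg 14) (Load (value_cell (Reg 6))))))
          (Store (value_cell (Reg 6)) (Reg 14)))
          ((fst ((fst s1)(6 := set_encode (residuals n ! i)), snd s1))
            (14 := val (Const 1) ((fst s1)(6 := set_encode (residuals n ! i)), snd s1)),
           snd ((fst s1)(6 := set_encode (residuals n ! i)), snd s1)) (((k - 2) * (1 + 2) + 2) + 1) ?Q"
          using step by (simp add: s2_def Y_def)
      qed (auto simp: simple_expr_def intro: less_width_n)
    next
      show "?N < 2 ^ width" by (rule length_residuals_less)
    qed (use s list_ctx_regs in \<open>auto simp: stored_update_0 stored_update_length\<close>)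
  qed (simp add: simple_expr_def)
  \<comment> \<open>\<open>k < n\<close> turns the number of multiplications into a bound in
    \<open>n\<close> alone.\<close>
  moreover have "1 + (?N * ((1 + (1 + (((k - 2) * (1 + 2) + 2) + 1))) + 2) + 2) \<le> take_powers_time n D"
    unfolding take_powers_time_def using length_residuals[of n] k_less
    by (intro add_mono mult_mono) auto
  ultimately show ?thesis by (rule run_mono)
qed

lemma run_moebius:
  assumes s: "list_ctx s" "stored_values (snd s) (residuals n) (\<lambda>Y. card (covering_tuples E m {} Y))"
  shows "run width moebius s (moebius_time n D)
    (\<lambda>s'. list_ctx s' \<and> stored_values (snd s') (residuals n) (\<lambda>Y. card (covering_tuples E m {..<n} Y)))"
proof -
  let ?f = "\<lambda>j Y. card (covering_tuples E m {..<j} Y)" and ?N = "length (residuals n)"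
  let ?e = "Sub (Load (value_cell (Reg 6)))
      (Mul (bit_expr 6 7) (Load (value_cell (Sub (Reg 6) (Mul (bit_expr 6 7) (Load (pow_addr 7)))))))"
  have "run width moebius s (n * ((?N * ((1 + 1) + 2) + 2) + 2) + 2)
    (\<lambda>s'. list_ctx s' \<and> stored_values (snd s') (residuals n) (?f n))"
    unfolding moebius_def
  proof (rule run_For[where I = "\<lambda>j s'. list_ctx s' \<and> stored_values (snd s') (residuals n) (?f j)"])
    fix j s1 assume j: "j < n" and "list_ctx s1 \<and> stored_values (snd s1) (residuals n) (?f j)" "fst s1 7 = j"
    then have s1: "list_ctx s1" "stored_values (snd s1) (residuals n) (?f j)" "fst s1 7 = j" by auto
    show "run width (For 5 4 (Seq (Assign 6 (Load (list_cell 5))) (Store (value_cell (Reg 6)) ?e))) s1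
      (?N * ((1 + 1) + 2) + 2)
      (\<lambda>s'. fst s' 7 = j \<and> list_ctx ((fst s')(7 := Suc j), snd s') \<and>
         stored_values (snd ((fst s')(7 := Suc j), snd s')) (residuals n) (?f (Suc j)))"
    proof (rule run_For[where I = "\<lambda>i s'. list_ctx s' \<and> fst s' 7 = j \<and> stored_update (snd s') (?f j) (?f (Suc j)) i"])
      fix i s2 assume i: "i < ?N" and "list_ctx s2 \<and> fst s2 7 = j \<and> stored_update (snd s2) (?f j) (?f (Suc j)) i" "fst s2 5 = i"
      then have s2: "list_ctx s2" "fst s2 7 = j" "stored_update (snd s2) (?f j) (?f (Suc j)) i" "fst s2 5 = i" by auto
      define Y where "Y = residuals n ! i"
      have Y: "Y \<subseteq> {..<n}" "Y \<in> residual {..<n} E" using residuals_nth[OF i] by (auto simp: Y_def)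
      then have finY: "finite Y" using finite_subset by blast
      define s3 where "s3 = ((fst s2)(6 := set_encode Y), snd s2)"
      have c3: "ctx s3" "fst s3 3 = stride" using s2(1) by (simp_all add: s3_def list_ctx_def ctx_def)
      have r3: "fst s3 6 = set_encode Y" "fst s3 7 = j" using s2 by (simp_all add: s3_def)
      have bit: "val (bit_expr 6 7) s3 = of_bool (j \<in> Y)"
        using c3(1) r3(2) j r3(1) Y(1) by (rule val_bit)
      have pow: "val (Load (pow_addr 7)) s3 = 2 ^ j"
        using c3(1) r3(2) j by (rule val_pow)
      have MY: "snd s3 (2 * stride + set_encode Y) = ?f j Y"
        using s2(3) i by (simp add: stored_update_def Y_def s3_def)
      \<comment> \<open>\<open>Y - {j}\<close> may or may not have been treated in this round. It
        does not contain \<open>j\<close>, so its old and new values coincide; hence the transform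
        works in place, whatever the order of the list.\<close>
      have MYj: "snd s3 (2 * stride + set_encode (Y - {j})) = ?f j (Y - {j})"
      proof -
        have "Y - {j} \<in> set (residuals n)"
          using Y residual_subset[OF Y(2), of "Y - {j}"] by (auto simp: set_residual_list)
        then obtain l where l: "l < ?N" "residuals n ! l = Y - {j}" by (auto simp: in_set_conv_nth)
        then show ?thesis
          using s2(3) by (auto simp: stored_update_def s3_def lessThan_Suc covering_tuples_insert_notin)
      qed
      have v: "val ?e s3 = ?f (Suc j) Y"
      proof (cases "j \<in> Y")
        case True
        have "set_encode Y = 2 ^ j + set_encode (Y - {j})"
          using set_encode_insert[of "Y - {j}" j] finY True by (simp add: insert_absorb)
        then have "val (Sub (Reg 6) (Mul (bit_expr 6 7) (Load (pow_addr 7)))) s3 = set_encode (Y - {j})"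
          using bit pow r3 True by (simp del: val.simps(3))
        then have "val ?e s3 = ?f j Y - ?f j (Y - {j})"
          using bit MY MYj True c3(2) r3(1) by simp
        then show ?thesis
          using card_covering_tuples_insert[OF finY True, of "{..<j}" E m] by (simp add: lessThan_Suc)
      next
        case False
        then show ?thesis
          using bit MY c3(2) r3(1) by (simp add: lessThan_Suc covering_tuples_insert_notin)
      qed
      have upd: "stored_update ((snd s2)(2 * stride + set_encode Y := ?f (Suc j) Y)) (?f j) (?f (Suc j)) (Suc i)"
        using s2(3) i Y_def by (rule stored_update_Suc)
      show "run width (Seq (Assign 6 (Load (list_cell 5))) (Store (value_cell (Reg 6)) ?e)) s2 (1 + 1)
        (\<lambda>s'. fst s' 5 = i \<and> list_ctx ((fst s')(5 := Suc i), snd s') \<and> fst ((fst s')(5 := Suc i), snd s') 7 = j \<and>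
           stored_update (snd ((fst s')(5 := Suc i), snd s')) (?f j) (?f (Suc j)) (Suc i))"
      proof (rule run_load_set[OF s2(1) s2(4) i], unfold Y_def[symmetric] s3_def[symmetric], rule run_bounded, rule run_Store)
        \<comment> \<open>The size bound is inherited from the old value, which the truncated
          difference cannot exceed.\<close>
        assume "bounded_state width s3"
        then have "snd s3 (2 * stride + set_encode Y) < 2 ^ width" by (simp add: bounded_state_def)
        moreover have "val ?e s3 \<le> snd s3 (2 * stride + set_encode Y)" using c3(2) r3(1) by simp
        ultimately show "val ?e s3 < 2 ^ width" by (rule le_less_trans[rotated])
        have "val (value_cell (Reg 6)) s3 = 2 * stride + set_encode Y" using c3(2) r3(1) by simp
        then show "fst (fst s3, (snd s3)(val (value_cell (Reg 6)) s3 := val ?e s3)) 5 = i \<and>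
          list_ctx ((fst (fst s3, (snd s3)(val (value_cell (Reg 6)) s3 := val ?e s3)))(5 := Suc i),
            snd (fst s3, (snd s3)(val (value_cell (Reg 6)) s3 := val ?e s3))) \<and>
          fst ((fst (fst s3, (snd s3)(val (value_cell (Reg 6)) s3 := val ?e s3)))(5 := Suc i),
            snd (fst s3, (snd s3)(val (value_cell (Reg 6)) s3 := val ?e s3))) 7 = j \<and>
          stored_update (snd ((fst (fst s3, (snd s3)(val (value_cell (Reg 6)) s3 := val ?e s3)))(5 := Suc i),
            snd (fst s3, (snd s3)(val (value_cell (Reg 6)) s3 := val ?e s3)))) (?f j) (?f (Suc j)) (Suc i)"
          unfolding v using s2 upd by (simp add: s3_def)
      qed (simp_all add: simple_expr_def)
    next
      show "?N < 2 ^ width" by (rule length_residuals_less)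
    qed (use s1 list_ctx_regs in \<open>auto simp: stored_update_0 stored_update_length\<close>)
  next
    show "n < 2 ^ width" by (rule less_width_n) simp
  qed (use s list_ctx_regs in auto)
  moreover have "n * ((?N * ((1 + 1) + 2) + 2) + 2) + 2 \<le> moebius_time n D"
    unfolding moebius_time_def using length_residuals[of n] by (intro add_mono mult_mono) auto
  ultimately show ?thesis by (rule run_mono)
qed

end

section \<open>Bipartiteness, search and the whole program\<close>

definition merge_labels :: prog where
  "merge_labels = Seq (Assign 15 (Load (label_cell 12))) (Seq (Assign 16 (Load (label_cell 13)))
    (Seq (Assign 11 (Mul (Mul (Reg 11) (not_expr (not_expr (Sub (Reg 2) (Const 1)))))
      (not_expr (not_expr (diff_expr (Reg 15) (Reg 16))))))
    (For 17 1 (If (diff_expr (Load (label_cell 17)) (Reg 16))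
      (If (diff_expr (Add (Load (label_cell 17)) (Reg 16)) (Mul (Const 2) (Reg 1))) Skip
        (Store (label_cell 17) (Reg 15)))
      (Store (label_cell 17) (Sub (Mul (Const 2) (Reg 1)) (Reg 15)))))))"

definition merge_labels_time :: "nat \<Rightarrow> nat" where
  "merge_labels_time n = 1 + (1 + (1 + (n * ((1 + (1 + 1)) + 2) + 2)))"

definition bipartite_test :: prog where
  "bipartite_test = Seq (Assign 11 (Const 1)) (Seq (For 12 1 (Store (label_cell 12) (Reg 12)))
    (For 12 1 (For 13 1
      (If (Mul (adj_expr 12 13) (Mul (not_expr (bit_expr 6 12)) (not_expr (bit_expr 6 13)))) merge_labels Skip))))"

definition bipartite_test_time :: "nat \<Rightarrow> nat" where
  "bipartite_test_time n = 1 + ((n * (1 + 2) + 2) + (n * ((n * ((1 + merge_labels_time n) + 2) + 2) + 2) + 2))"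

text \<open>Using \<open>k\<close> itself as the positive answer makes \<open>k = 0\<close> come out
  as no, the one case in which the verdict of \<open>bipartite_test\<close> carries no
  guarantee.\<close>

definition search :: prog where
  "search = Seq (Assign 0 (Const 0)) (For 5 4 (Seq (Assign 6 (Load (list_cell 5)))
    (Seq bipartite_test (If (Mul (Reg 11) (Load (value_cell (Reg 6)))) (Assign 0 (Reg 2)) Skip))))"

definition search_time :: "nat \<Rightarrow> nat \<Rightarrow> nat" where
  "search_time n D = 1 + (D * ((1 + (bipartite_test_time n + (1 + 1))) + 2) + 2)"

definition colour :: prog where
  "colour = Seq (Assign 3 (Add (Add (Reg 8) (Mul (Reg 1) (Reg 1))) (Add (Reg 1) (Const 2))))
    (Seq enumerate_residual (Seq take_powers (Seq moebius search)))"

definition colour_time :: "nat \<Rightarrow> nat \<Rightarrow> nat" where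
  "colour_time n D = 1 + (enumerate_residual_time n D + (take_powers_time n D + (moebius_time n D + search_time n D)))"

text \<open>A missing digit is 0 and the digit 0 is stored as 1; truncated subtraction of 1 sends
  both to 0. So \<open>n\<close> rounds also read a short \<open>k\<close> correctly.\<close>

definition read_input :: prog where
  "read_input = Seq (Assign 1 (Load (Const 0))) (Seq (Assign 8 (Const 1))
    (For 5 1 (Seq (Assign 2 (Add (Reg 2) (Mul (Reg 8) (Sub (Load (pow_addr 5)) (Const 1)))))
      (Seq (Store (pow_addr 5) (Reg 8)) (Assign 8 (Mul (Const 2) (Reg 8)))))))"

definition read_input_time :: "nat \<Rightarrow> nat" where
  "read_input_time n = 1 + (1 + (n * ((1 + (1 + 1)) + 2) + 2))"

text \<open>
  The branch that accepts at once is taken if the digit of weight \<open>2 ^ n\<close> is present or if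
  the number given by the \<open>n\<close> lower digits is at least \<open>n\<close>.
\<close>

definition colouring_prog :: prog where
  "colouring_prog = Seq read_input
    (If (Add (Load (pow_addr 1)) (Sub (Add (Reg 2) (Const 1)) (Reg 1))) (Assign 0 (Const 1)) colour)"

definition colouring_time :: "nat \<Rightarrow> nat \<Rightarrow> nat" where
  "colouring_time n D = read_input_time n + (1 + colour_time n D)"

lemma labelling_cong:
  assumes "labelling n k P L b" "\<And>w. w < n \<Longrightarrow> L' w = L w" "P \<subseteq> {..<n} \<times> {..<n}"
  shows "labelling n k P L' b"
proof -
  have "L' u + L' v = L u + L v" if "(u, v) \<in> P" for u v using that assms(2,3) by auto
  then show ?thesis using assms(1,2) unfolding labelling_def by simp
qed

context counting
begin

text \<open>What the bipartiteness test leaves alone: it writes only to the label block and to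
  registers from 11 on.\<close>

definition low_frame :: "state \<Rightarrow> state \<Rightarrow> bool" where
  "low_frame s s' \<longleftrightarrow> (\<forall>r<11. fst s' r = fst s r) \<and> (\<forall>a<3 * stride. snd s' a = snd s a)"

lemma low_frame_refl [simp]: "low_frame s s"
  by (simp add: low_frame_def)

lemma low_frame_trans: "low_frame s s' \<Longrightarrow> low_frame s' s'' \<Longrightarrow> low_frame s s''"
  by (simp add: low_frame_def)

lemma low_frame_upd [simp]: "10 < r \<Longrightarrow> low_frame s (f(r := x), M) \<longleftrightarrow> low_frame s (f, M)"
  by (auto simp: low_frame_def)

lemma low_frame_store [simp]: "3 * stride \<le> a \<Longrightarrow> low_frame s (f, M(a := x)) \<longleftrightarrow> low_frame s (f, M)"
  by (auto simp: low_frame_def)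

lemma low_frame_regs: "low_frame s s' \<Longrightarrow> r < 11 \<Longrightarrow> fst s' r = fst s r"
  by (simp add: low_frame_def)

lemma ctx_low: "ctx s \<Longrightarrow> low_frame s s' \<Longrightarrow> ctx s'"
  using tables_low[of "snd s" "snd s'"] by (auto simp: ctx_def low_frame_def)

lemma list_ctx_low:
  assumes "list_ctx s" "low_frame s s'"
  shows "list_ctx s'"
proof -
  have "stride + i < 3 * stride" if "i < length (residuals n)" for i
    using that family_length[OF family_residuals[of n]] power_less_stride by linarith
  then show ?thesis
    using assms ctx_low[of s s'] by (simp add: list_ctx_def low_frame_def stored_list_def)
qed

lemma stored_values_low:
  assumes "stored_values (snd s) (residuals n) f" "low_frame s s'"
  shows "stored_values (snd s') (residuals n) f"
proof -
  have "2 * stride + set_encode Y < 3 * stride" if "Y \<in> set (residuals n)" for Y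
    using that family_residuals[of n] set_encode_less_stride[of Y] by (auto simp: family_def)
  then show ?thesis using assms by (simp add: low_frame_def stored_values_def)
qed

lemma run_merge_labels:
  assumes s: "ctx s" and uv: "fst s 12 = u" "fst s 13 = v" "u < n" "v < n"
    and b: "fst s 11 = of_bool b"
  defines "L \<equiv> \<lambda>w. snd s (3 * stride + w)"
  shows "run width merge_labels s (merge_labels_time n)
    (\<lambda>s'. low_frame s s' \<and> fst s' 12 = u \<and> fst s' 13 = v
      \<and> (\<forall>w<n. snd s' (3 * stride + w) = merge_label n (L u) (L v) (L w))
      \<and> fst s' 11 = of_bool (b \<and> 2 \<le> k \<and> L u \<noteq> L v))"
    (is "run _ _ _ _ ?Q")
proof (rule run_bounded)
  assume bs: "bounded_state width s"
  have L_less: "L w < 2 ^ width" for w using bs by (simp add: L_def bounded_state_def)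
  have regs: "fst s 1 = n" "fst s 2 = k" "fst s 3 = stride" using s by (simp_all add: ctx_def)
  let ?b = "b \<and> 2 \<le> k \<and> L u \<noteq> L v"
  \<comment> \<open>The labels of \<open>u\<close> and \<open>v\<close> are saved in registers,
    since the loop overwrites their cells as well.\<close>
  define s1 where "s1 = ((fst s)(15 := L u), snd s)"
  define s2 where "s2 = ((fst s1)(16 := L v), snd s1)"
  define s3 where "s3 = ((fst s2)(11 := of_bool ?b), snd s2)"
  have v1: "val (Load (label_cell 12)) s = L u" using regs uv by (simp add: L_def)
  have v2: "val (Load (label_cell 13)) s1 = L v" using regs uv by (simp add: L_def s1_def)
  have v3: "val (Mul (Mul (Reg 11) (not_expr (not_expr (Sub (Reg 2) (Const 1)))))
      (not_expr (not_expr (diff_expr (Reg 15) (Reg 16))))) s2 = of_bool ?b"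
    using regs b by (auto simp: s2_def s1_def)
  have loop: "run width (For 17 1 (If (diff_expr (Load (label_cell 17)) (Reg 16))
      (If (diff_expr (Add (Load (label_cell 17)) (Reg 16)) (Mul (Const 2) (Reg 1))) Skip
        (Store (label_cell 17) (Reg 15)))
      (Store (label_cell 17) (Sub (Mul (Const 2) (Reg 1)) (Reg 15))))) s3 (n * ((1 + (1 + 1)) + 2) + 2) ?Q"
  proof (rule run_For[where I = "\<lambda>i s'. low_frame s s' \<and> fst s' 12 = u \<and> fst s' 13 = v
      \<and> fst s' 11 = of_bool ?b \<and> fst s' 15 = L u \<and> fst s' 16 = L v
      \<and> (\<forall>w<n. snd s' (3 * stride + w) = (if w < i then merge_label n (L u) (L v) (L w) else L w))"])
    fix i s4 assume i: "i < n" and "low_frame s s4 \<and> fst s4 12 = u \<and> fst s4 13 = v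
      \<and> fst s4 11 = of_bool ?b \<and> fst s4 15 = L u \<and> fst s4 16 = L v
      \<and> (\<forall>w<n. snd s4 (3 * stride + w) = (if w < i then merge_label n (L u) (L v) (L w) else L w))"
      and i4: "fst s4 17 = i"
    then have s4: "low_frame s s4" "fst s4 12 = u" "fst s4 13 = v" "fst s4 11 = of_bool ?b"
        "fst s4 15 = L u" "fst s4 16 = L v"
      and M: "\<forall>w<n. snd s4 (3 * stride + w) = (if w < i then merge_label n (L u) (L v) (L w) else L w)"
      by auto
    let ?R = "\<lambda>s'. fst s' 17 = i \<and> low_frame s ((fst s')(17 := Suc i), snd s') \<and> fst ((fst s')(17 := Suc i), snd s') 12 = u
      \<and> fst ((fst s')(17 := Suc i), snd s') 13 = v
      \<and> fst ((fst s')(17 := Suc i), snd s') 11 = of_bool ?b \<and> fst ((fst s')(17 := Suc i), snd s') 15 = L u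
      \<and> fst ((fst s')(17 := Suc i), snd s') 16 = L v
      \<and> (\<forall>w<n. snd ((fst s')(17 := Suc i), snd s') (3 * stride + w)
          = (if w < Suc i then merge_label n (L u) (L v) (L w) else L w))"
    have r: "fst s4 1 = n" "fst s4 3 = stride"
      using low_frame_regs[OF s4(1)] regs by simp_all
    have Mi: "snd s4 (3 * stride + i) = L i" using M i by simp
    have store: "?R (fst s4, (snd s4)(3 * stride + i := x))" if "x = merge_label n (L u) (L v) (L i)" for x
      using s4 M i4 that by (auto simp: less_Suc_eq)
    have stay: "?R s4" if "L i = merge_label n (L u) (L v) (L i)"
      using store[OF that] Mi by (metis fun_upd_triv prod.collapse)
    have addr: "val (label_cell 17) s4 = 3 * stride + i" using r i4 by simp
    show "run width (If (diff_expr (Load (label_cell 17)) (Reg 16))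
      (If (diff_expr (Add (Load (label_cell 17)) (Reg 16)) (Mul (Const 2) (Reg 1))) Skip
        (Store (label_cell 17) (Reg 15)))
      (Store (label_cell 17) (Sub (Mul (Const 2) (Reg 1)) (Reg 15)))) s4 (1 + (1 + 1)) ?R"
    proof (rule run_If)
      assume "val (diff_expr (Load (label_cell 17)) (Reg 16)) s4 \<noteq> 0"
      then have ne: "L i \<noteq> L v" using r i4 Mi s4 by simp
      show "run width (If (diff_expr (Add (Load (label_cell 17)) (Reg 16)) (Mul (Const 2) (Reg 1))) Skip
        (Store (label_cell 17) (Reg 15))) s4 (1 + 1) ?R"
      proof (rule run_If)
        assume "val (diff_expr (Add (Load (label_cell 17)) (Reg 16)) (Mul (Const 2) (Reg 1))) s4 \<noteq> 0"
        then have "L i + L v \<noteq> 2 * n" using r i4 Mi s4 by simp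
        then show "run width Skip s4 1 ?R" using stay ne by (intro run_Skip) (simp_all add: merge_label_def)
      next
        assume "val (diff_expr (Add (Load (label_cell 17)) (Reg 16)) (Mul (Const 2) (Reg 1))) s4 = 0"
        then have "L i + L v = 2 * n" using r i4 Mi s4 by simp
        then have "?R (fst s4, (snd s4)(3 * stride + i := L u))" using ne by (intro store) (simp add: merge_label_def)
        then show "run width (Store (label_cell 17) (Reg 15)) s4 1 ?R"
          using L_less[of u] s4(5) addr by (intro run_Store) (simp_all add: simple_expr_def)
      qed (simp add: simple_expr_def)
    next
      assume "val (diff_expr (Load (label_cell 17)) (Reg 16)) s4 = 0"
      then have "L i = L v" using r i4 Mi s4 by simp
      then have R: "?R (fst s4, (snd s4)(3 * stride + i := 2 * n - L u))" by (intro store) (simp add: merge_label_def)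
      have x: "val (Sub (Mul (Const 2) (Reg 1)) (Reg 15)) s4 = 2 * n - L u" using r s4(5) by simp
      have "run width (Store (label_cell 17) (Sub (Mul (Const 2) (Reg 1)) (Reg 15))) s4 1 ?R"
      proof (rule run_Store)
        show "val (Sub (Mul (Const 2) (Reg 1)) (Reg 15)) s4 < 2 ^ width" unfolding x by (rule less_width_n) simp
        show "?R (fst s4, (snd s4)(val (label_cell 17) s4 := val (Sub (Mul (Const 2) (Reg 1)) (Reg 15)) s4))"
          unfolding x addr by (rule R)
      qed (simp_all add: simple_expr_def)
      then show "run width (Store (label_cell 17) (Sub (Mul (Const 2) (Reg 1)) (Reg 15))) s4 (1 + 1) ?R"
        by (rule run_mono) auto
    qed (simp add: simple_expr_def)
  next
    fix i s' assume "low_frame s s' \<and> fst s' 12 = u \<and> fst s' 13 = v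
      \<and> fst s' 11 = of_bool ?b \<and> fst s' 15 = L u \<and> fst s' 16 = L v
      \<and> (\<forall>w<n. snd s' (3 * stride + w) = (if w < i then merge_label n (L u) (L v) (L w) else L w))"
    then show "fst s' 1 = n" using low_frame_regs[of s s' 1] regs by simp
  next
    show "n < 2 ^ width" by (rule less_width_n) simp
  qed (use uv in \<open>auto simp: s3_def s2_def s1_def L_def\<close>)
  show "run width merge_labels s (merge_labels_time n) ?Q"
    unfolding merge_labels_def merge_labels_time_def
    apply (rule run_Seq, rule run_Assign, simp add: simple_expr_def, unfold v1, rule L_less, unfold s1_def[symmetric])
    apply (rule run_Seq, rule run_Assign, simp add: simple_expr_def, unfold v2, rule L_less, unfold s2_def[symmetric])
    apply (rule run_Seq, rule run_Assign, simp add: simple_expr_def, unfold v3, rule less_width_n, simp, unfold s3_def[symmetric])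
    apply (rule loop)
    done
qed

lemma run_bipartite_test:
  assumes s: "ctx s" "fst s 6 = set_encode Y" and Y: "Y \<subseteq> {..<n}"
  shows "run width bipartite_test s (bipartite_test_time n)
    (\<lambda>s'. low_frame s s' \<and> (k > 0 \<longrightarrow> fst s' 11 = of_bool (coverable ({..<n} - Y) E (min k 2))))"
    (is "run _ _ _ _ ?Q")
proof -
  \<comment> \<open>The adjacent pairs outside \<open>Y\<close> that lie lexicographically before
    \<open>(u, v)\<close>, which is the order of the two loops.\<close>
  define P where "P u v = {(x, y). x \<in> {..<n} - Y \<and> y \<in> {..<n} - Y \<and> {x, y} \<in> E \<and> (x < u \<or> x = u \<and> y < v)}"
    for u v
  have P_sub: "P u v \<subseteq> {..<n} \<times> {..<n}" for u v by (auto simp: P_def)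
  have P_Suc: "P u (Suc v) = (if {u, v} \<in> E \<and> u \<notin> Y \<and> v \<notin> Y then insert (u, v) (P u v) else P u v)"
    if "u < n" "v < n" for u v
    using that by (auto simp: P_def less_Suc_eq)
  have P_row: "P u n = P (Suc u) 0" for u by (auto simp: P_def less_Suc_eq)
  have P_0: "P 0 0 = {}" by (auto simp: P_def)
  have P_n: "P n 0 = {(u, v). u \<in> {..<n} - Y \<and> v \<in> {..<n} - Y \<and> {u, v} \<in> E}" by (auto simp: P_def)
  define ok where "ok u v s' \<longleftrightarrow> (\<exists>b. fst s' 11 = of_bool b \<and> labelling n k (P u v) (\<lambda>w. snd s' (3 * stride + w)) b)"
    for u v and s' :: state
  have ok_upd: "ok u v (f(r := x), M) \<longleftrightarrow> ok u v (f, M)" if "11 < r" for u v r x f M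
    using that by (simp add: ok_def)
  have ok_final: "fst s' 11 = of_bool (coverable ({..<n} - Y) E (min k 2))" if fin: "ok n 0 s'" and "k > 0" for s'
  proof -
    obtain b where b: "fst s' 11 = of_bool b" "labelling n k (P n 0) (\<lambda>w. snd s' (3 * stride + w)) b"
      using fin unfolding ok_def by blast
    have "b \<longleftrightarrow> coverable ({..<n} - Y) E (min k 2)"
      by (rule labelling_two_colourable[OF b(2)[unfolded P_n]]) (use \<open>k > 0\<close> in auto)
    then show ?thesis using b(1) by simp
  qed
  have regs: "fst s 1 = n" "fst s 3 = stride" using s(1) by (simp_all add: ctx_def)
  have n_less: "n < 2 ^ width" by (rule less_width_n) simp
  let ?e = "Mul (adj_expr 12 13) (Mul (not_expr (bit_expr 6 12)) (not_expr (bit_expr 6 13)))"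
  have pair: "run width (If ?e merge_labels Skip) s1 (1 + merge_labels_time n)
      (\<lambda>s'. low_frame s s' \<and> fst s' 12 = u \<and> fst s' 13 = v \<and> ok u (Suc v) s')"
    if s1: "low_frame s s1" "fst s1 12 = u" "fst s1 13 = v" "ok u v s1" and uv: "u < n" "v < n" for s1 u v
  proof -
    have c1: "ctx s1" using s(1) s1(1) by (rule ctx_low)
    have r6: "fst s1 6 = set_encode Y" using low_frame_regs[OF s1(1), of 6] s(2) by simp
    have vals: "val (adj_expr 12 13) s1 = of_bool ({u, v} \<in> E)" "val (bit_expr 6 12) s1 = of_bool (u \<in> Y)"
        "val (bit_expr 6 13) s1 = of_bool (v \<in> Y)"
      using val_adj[OF c1 s1(2,3) uv] val_bit[OF c1 s1(2) uv(1) r6 Y] val_bit[OF c1 s1(3) uv(2) r6 Y] by auto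
    obtain b where b: "fst s1 11 = of_bool b" "labelling n k (P u v) (\<lambda>w. snd s1 (3 * stride + w)) b"
      using s1(4) unfolding ok_def by blast
    show ?thesis
    proof (rule run_If)
      assume "val ?e s1 \<noteq> 0"
      then have edge: "{u, v} \<in> E" "u \<notin> Y" "v \<notin> Y" using vals by (auto split: if_splits)
      show "run width merge_labels s1 (merge_labels_time n)
          (\<lambda>s'. low_frame s s' \<and> fst s' 12 = u \<and> fst s' 13 = v \<and> ok u (Suc v) s')"
      proof (rule run_mono[OF run_merge_labels[OF c1 s1(2,3) uv b(1)] order.refl])
        fix s' assume s': "low_frame s1 s' \<and> fst s' 12 = u \<and> fst s' 13 = v
          \<and> (\<forall>w<n. snd s' (3 * stride + w) = merge_label n (snd s1 (3 * stride + u)) (snd s1 (3 * stride + v)) (snd s1 (3 * stride + w)))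
          \<and> fst s' 11 = of_bool (b \<and> 2 \<le> k \<and> snd s1 (3 * stride + u) \<noteq> snd s1 (3 * stride + v))"
        have "labelling n k (P u (Suc v)) (\<lambda>w. snd s' (3 * stride + w))
            (b \<and> 2 \<le> k \<and> snd s1 (3 * stride + u) \<noteq> snd s1 (3 * stride + v))"
          using labelling_cong[OF labelling_insert[OF b(2) uv P_sub]] s' P_sub[of u v] uv edge
          by (simp add: P_Suc)
        then have "ok u (Suc v) s'" unfolding ok_def using s' by blast
        then show "low_frame s s' \<and> fst s' 12 = u \<and> fst s' 13 = v \<and> ok u (Suc v) s'"
          using s' low_frame_trans[OF s1(1)] by blast
      qed
    next
      assume "val ?e s1 = 0"
      then have "P u (Suc v) = P u v" using vals P_Suc[OF uv] by (auto split: if_splits)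
      then have "ok u (Suc v) s1" using s1(4) by (simp add: ok_def)
      then show "run width Skip s1 (merge_labels_time n)
          (\<lambda>s'. low_frame s s' \<and> fst s' 12 = u \<and> fst s' 13 = v \<and> ok u (Suc v) s')"
        using s1 by (intro run_Skip) (auto simp: merge_labels_time_def)
    qed (simp add: simple_expr_def)
  qed
  have row: "run width (For 13 1 (If ?e merge_labels Skip)) s1 (n * ((1 + merge_labels_time n) + 2) + 2)
      (\<lambda>s'. low_frame s s' \<and> fst s' 12 = u \<and> ok (Suc u) 0 s')"
    if s1: "low_frame s s1" "fst s1 12 = u" "ok u 0 s1" and u: "u < n" for s1 u
  proof (rule run_For[where I = "\<lambda>v s'. low_frame s s' \<and> fst s' 12 = u \<and> ok u v s'"])
    fix v s2 assume v: "v < n" and s2: "low_frame s s2 \<and> fst s2 12 = u \<and> ok u v s2" "fst s2 13 = v"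
    show "run width (If ?e merge_labels Skip) s2 (1 + merge_labels_time n)
      (\<lambda>s'. fst s' 13 = v \<and> low_frame s ((fst s')(13 := Suc v), snd s') \<and>
         fst ((fst s')(13 := Suc v), snd s') 12 = u \<and> ok u (Suc v) ((fst s')(13 := Suc v), snd s'))"
      by (rule run_mono[OF pair[of s2 u v] order.refl]) (use s2 u v in \<open>auto simp: ok_upd\<close>)
  next
    fix v s2 assume "low_frame s s2 \<and> fst s2 12 = u \<and> ok u v s2"
    then show "fst s2 1 = n" using low_frame_regs[of s s2 1] regs by simp
  next
    fix s2 assume "low_frame s s2 \<and> fst s2 12 = u \<and> ok u n s2"
    then show "low_frame s s2 \<and> fst s2 12 = u \<and> ok (Suc u) 0 s2" using P_row by (simp add: ok_def)
  qed (use s1 n_less in \<open>auto simp: ok_upd\<close>)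
  have rows: "run width (For 12 1 (For 13 1 (If ?e merge_labels Skip))) s1
      (n * ((n * ((1 + merge_labels_time n) + 2) + 2) + 2) + 2) ?Q"
    if s1: "low_frame s s1" "ok 0 0 s1" for s1
  proof (rule run_For[where I = "\<lambda>u s'. low_frame s s' \<and> ok u 0 s'"])
    fix u s2 assume u: "u < n" and s2: "low_frame s s2 \<and> ok u 0 s2" "fst s2 12 = u"
    show "run width (For 13 1 (If ?e merge_labels Skip)) s2 (n * ((1 + merge_labels_time n) + 2) + 2)
      (\<lambda>s'. fst s' 12 = u \<and> low_frame s ((fst s')(12 := Suc u), snd s') \<and> ok (Suc u) 0 ((fst s')(12 := Suc u), snd s'))"
      by (rule run_mono[OF row[of s2 u] order.refl]) (use s2 u in \<open>auto simp: ok_upd\<close>)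
  next
    fix u s2 assume "low_frame s s2 \<and> ok u 0 s2"
    then show "fst s2 1 = n" using low_frame_regs[of s s2 1] regs by simp
  qed (use s1 n_less ok_final in \<open>auto simp: ok_upd\<close>)
  define s1 where "s1 = ((fst s)(11 := 1), snd s)"
  have init: "run width (For 12 1 (Store (label_cell 12) (Reg 12))) s1 (n * (1 + 2) + 2)
      (\<lambda>s'. low_frame s s' \<and> ok 0 0 s')"
  proof (rule run_For[where I = "\<lambda>i s'. low_frame s s' \<and> fst s' 11 = 1 \<and> (\<forall>w<i. snd s' (3 * stride + w) = w)"])
    fix i s2 assume i: "i < n" and s2: "low_frame s s2 \<and> fst s2 11 = 1 \<and> (\<forall>w<i. snd s2 (3 * stride + w) = w)" "fst s2 12 = i"
    have r: "fst s2 3 = stride" using low_frame_regs[of s s2 3] s2 regs by simp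
    show "run width (Store (label_cell 12) (Reg 12)) s2 1
      (\<lambda>s'. fst s' 12 = i \<and> low_frame s ((fst s')(12 := Suc i), snd s') \<and> fst ((fst s')(12 := Suc i), snd s') 11 = 1 \<and>
        (\<forall>w<Suc i. snd ((fst s')(12 := Suc i), snd s') (3 * stride + w) = w))"
      using s2 r i by (intro run_Store) (auto simp: simple_expr_def less_Suc_eq intro: less_width_n)
  next
    fix i s2 assume "low_frame s s2 \<and> fst s2 11 = 1 \<and> (\<forall>w<i. snd s2 (3 * stride + w) = w)"
    then show "fst s2 1 = n" using low_frame_regs[of s s2 1] regs by simp
  next
    fix s2 assume s2: "low_frame s s2 \<and> fst s2 11 = 1 \<and> (\<forall>w<n. snd s2 (3 * stride + w) = w)"
    then have "labelling n k (P 0 0) (\<lambda>w. snd s2 (3 * stride + w)) True"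
      unfolding P_0 by (intro labelling_cong[OF labelling_empty]) auto
    then show "low_frame s s2 \<and> ok 0 0 s2" using s2 unfolding ok_def by (auto intro: exI[of _ True])
  qed (use n_less in \<open>auto simp: s1_def\<close>)
  show ?thesis
    unfolding bipartite_test_def bipartite_test_time_def
  proof (rule run_Seq, rule run_Assign)
    have v: "val (Const 1) s = 1" by simp
    show "run width (Seq (For 12 1 (Store (label_cell 12) (Reg 12))) (For 12 1 (For 13 1 (If ?e merge_labels Skip))))
        ((fst s)(11 := val (Const 1) s), snd s)
        ((n * (1 + 2) + 2) + (n * ((n * ((1 + merge_labels_time n) + 2) + 2) + 2) + 2)) ?Q"
      unfolding v s1_def[symmetric]
      by (rule run_Seq, rule run_mono[OF init order.refl]) (use rows in blast)
  qed (auto simp: simple_expr_def intro: less_width_n)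
qed


lemma run_search:
  assumes k_less: "k < n" and s: "list_ctx s"
    and vals: "stored_values (snd s) (residuals n) (\<lambda>Y. card (covering_tuples E (k - 2) {..<n} Y))"
  shows "run width search s (search_time n D) (\<lambda>s'. fst s' 0 \<noteq> 0 \<longleftrightarrow> coverable {..<n} E k)"
proof -
  let ?N = "length (residuals n)" and ?f = "\<lambda>Y. card (covering_tuples E (k - 2) {..<n} Y)"
  define good where "good Y \<longleftrightarrow> coverable Y E (k - 2) \<and> coverable ({..<n} - Y) E (min k 2)" for Y
  have good_iff: "k \<noteq> 0 \<and> (\<exists>l<?N. good (residuals n ! l)) \<longleftrightarrow> coverable {..<n} E k"
  proof -
    have "(\<exists>l<?N. good (residuals n ! l)) \<longleftrightarrow> (\<exists>Y\<in>set (residuals n). good Y)"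
      by (auto simp: set_conv_nth)
    also have "\<dots> \<longleftrightarrow> (\<exists>Y\<in>residual {..<n} E. good Y)"
      by (auto simp: set_residual_list residual_def)
    also have "\<dots> \<longleftrightarrow> coverable {..<n} E k"
      using coverable_iff_residual[OF graph, of k] by (simp add: good_def)
    finally have iff: "(\<exists>l<?N. good (residuals n ! l)) \<longleftrightarrow> coverable {..<n} E k" .
    \<comment> \<open>By \<open>k < n\<close> there is a vertex, so rejecting \<open>k = 0\<close>
      is correct.\<close>
    have "\<not> coverable {..<n} E 0" using k_less by (auto simp: coverable_def lessThan_empty_iff)
    then show ?thesis using iff by (cases "k = 0") auto
  qed
  let ?c = "Seq bipartite_test (If (Mul (Reg 11) (Load (value_cell (Reg 6)))) (Assign 0 (Reg 2)) Skip)"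
  have "run width search s (1 + (?N * ((1 + (bipartite_test_time n + (1 + 1))) + 2) + 2))
    (\<lambda>s'. fst s' 0 \<noteq> 0 \<longleftrightarrow> coverable {..<n} E k)"
    unfolding search_def
  proof (rule run_Seq, rule run_Assign)
    have v: "val (Const 0) s = 0" by simp
    show "run width (For 5 4 (Seq (Assign 6 (Load (list_cell 5))) ?c)) ((fst s)(0 := val (Const 0) s), snd s)
      (?N * ((1 + (bipartite_test_time n + (1 + 1))) + 2) + 2)
      (\<lambda>s'. fst s' 0 \<noteq> 0 \<longleftrightarrow> coverable {..<n} E k)"
      unfolding v
    proof (rule run_For[where I = "\<lambda>i s'. list_ctx s' \<and> stored_values (snd s') (residuals n) ?f
        \<and> (fst s' 0 \<noteq> 0 \<longleftrightarrow> k \<noteq> 0 \<and> (\<exists>l<i. good (residuals n ! l)))"])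
      fix i s1 assume i: "i < ?N" and "list_ctx s1 \<and> stored_values (snd s1) (residuals n) ?f
        \<and> (fst s1 0 \<noteq> 0 \<longleftrightarrow> k \<noteq> 0 \<and> (\<exists>l<i. good (residuals n ! l)))" "fst s1 5 = i"
      then have s1: "list_ctx s1" "stored_values (snd s1) (residuals n) ?f"
          "fst s1 0 \<noteq> 0 \<longleftrightarrow> k \<noteq> 0 \<and> (\<exists>l<i. good (residuals n ! l))" "fst s1 5 = i" by auto
      let ?R = "\<lambda>s'. fst s' 5 = i \<and> list_ctx ((fst s')(5 := Suc i), snd s')
        \<and> stored_values (snd ((fst s')(5 := Suc i), snd s')) (residuals n) ?f
        \<and> (fst ((fst s')(5 := Suc i), snd s') 0 \<noteq> 0 \<longleftrightarrow> k \<noteq> 0 \<and> (\<exists>l<Suc i. good (residuals n ! l)))"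
      define Y where "Y = residuals n ! i"
      have Y: "Y \<subseteq> {..<n}" using residuals_nth[OF i] by (simp add: Y_def)
      then have finY: "finite Y" using finite_subset by blast
      define s2 where "s2 = ((fst s1)(6 := set_encode Y), snd s1)"
      have c2: "list_ctx s2" "stored_values (snd s2) (residuals n) ?f" "fst s2 5 = i" "fst s2 6 = set_encode Y"
        using s1 by (simp_all add: s2_def)
      then have ctx2: "ctx s2" by (simp add: list_ctx_def)
      have "run width ?c s2 (bipartite_test_time n + (1 + 1)) ?R"
      proof (rule run_Seq, rule run_mono[OF run_bipartite_test[OF ctx2 c2(4) Y] order.refl])
        fix s3 assume "low_frame s2 s3 \<and> (k > 0 \<longrightarrow> fst s3 11 = of_bool (coverable ({..<n} - Y) E (min k 2)))"
        then have s3: "low_frame s2 s3" "k > 0 \<Longrightarrow> fst s3 11 = of_bool (coverable ({..<n} - Y) E (min k 2))" by auto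
        have c3: "list_ctx s3" "stored_values (snd s3) (residuals n) ?f" "fst s3 5 = i" "fst s3 6 = set_encode Y"
            "fst s3 0 = fst s1 0"
          using list_ctx_low[OF c2(1) s3(1)] stored_values_low[OF c2(2) s3(1)] low_frame_regs[OF s3(1)] c2(3,4)
          by (auto simp: s2_def)
        have r3: "fst s3 2 = k" "fst s3 3 = stride" using c3(1) by (simp_all add: list_ctx_def ctx_def)
        have "snd s3 (2 * stride + set_encode Y) = ?f Y"
          using c3(2) nth_mem[OF i] by (simp add: stored_values_def Y_def)
        then have v3: "val (Mul (Reg 11) (Load (value_cell (Reg 6)))) s3 \<noteq> 0 \<longleftrightarrow> good Y" if "k > 0"
          using s3(2)[OF that] r3 c3(4) card_covering_tuples_neq_0_iff[OF finY Y, of E "k - 2"]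
          by (auto simp: good_def)
        have ex: "(\<exists>l<Suc i. good (residuals n ! l)) \<longleftrightarrow> (\<exists>l<i. good (residuals n ! l)) \<or> good Y"
          by (auto simp: less_Suc_eq Y_def)
        show "run width (If (Mul (Reg 11) (Load (value_cell (Reg 6)))) (Assign 0 (Reg 2)) Skip) s3 (1 + 1) ?R"
        proof (rule run_If)
          assume nz: "val (Mul (Reg 11) (Load (value_cell (Reg 6)))) s3 \<noteq> 0"
          then have "?R ((fst s3)(0 := k), snd s3)"
            using c3 v3 by (auto simp: ex list_ctx_def ctx_def)
          then show "run width (Assign 0 (Reg 2)) s3 1 ?R"
            using r3 k_less by (intro run_Assign) (auto simp: simple_expr_def less_width_n)
        next
          assume z: "val (Mul (Reg 11) (Load (value_cell (Reg 6)))) s3 = 0"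
          then have "?R s3" using c3 v3 s1(3) by (auto simp: ex)
          then show "run width Skip s3 1 ?R" by (rule run_Skip) simp
        qed (simp add: simple_expr_def)
      qed
      then show "run width (Seq (Assign 6 (Load (list_cell 5))) ?c) s1 (1 + (bipartite_test_time n + (1 + 1))) ?R"
        unfolding s2_def Y_def by (rule run_load_set[OF s1(1) s1(4) i])
    next
      show "?N < 2 ^ width" by (rule length_residuals_less)
    next
      show "list_ctx ((fst ((fst s)(0 := 0), snd s))(5 := 0), snd ((fst s)(0 := 0), snd s)) \<and>
        stored_values (snd ((fst ((fst s)(0 := 0), snd s))(5 := 0), snd ((fst s)(0 := 0), snd s))) (residuals n) ?f \<and>
        (fst ((fst ((fst s)(0 := 0), snd s))(5 := 0), snd ((fst s)(0 := 0), snd s)) 0 \<noteq> 0 \<longleftrightarrow>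
          k \<noteq> 0 \<and> (\<exists>l<0. good (residuals n ! l)))"
        using s vals by (simp add: list_ctx_def ctx_def)
    qed (use list_ctx_regs good_iff in auto)
  qed (simp_all add: simple_expr_def)
  moreover have "1 + (?N * ((1 + (bipartite_test_time n + (1 + 1))) + 2) + 2) \<le> search_time n D"
    unfolding search_time_def using length_residuals[of n] by (intro add_mono mult_mono) auto
  ultimately show ?thesis by (rule run_mono)
qed

lemma run_colour:
  assumes k_less: "k < n" and s: "fst s 1 = n" "fst s 2 = k" "fst s 8 = 2 ^ n" "tables (snd s)"
  shows "run width colour s (colour_time n D) (\<lambda>s'. fst s' 0 \<noteq> 0 \<longleftrightarrow> coverable {..<n} E k)"
  unfolding colour_def colour_time_def
proof (rule run_Seq, rule run_Assign)
  let ?e = "Add (Add (Reg 8) (Mul (Reg 1) (Reg 1))) (Add (Reg 1) (Const 2))"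
  have v: "val ?e s = stride" using s by (simp add: stride_def)
  show "val ?e s < 2 ^ width" unfolding v by (rule stride_less)
  have ctx: "ctx ((fst s)(3 := val ?e s), snd s)" unfolding v using s by (simp add: ctx_def)
  show "run width (Seq enumerate_residual (Seq take_powers (Seq moebius search))) ((fst s)(3 := val ?e s), snd s)
    (enumerate_residual_time n D + (take_powers_time n D + (moebius_time n D + search_time n D)))
    (\<lambda>s'. fst s' 0 \<noteq> 0 \<longleftrightarrow> coverable {..<n} E k)"
  proof (rule run_Seq, rule run_mono[OF run_enumerate_residual[OF ctx] order.refl])
    fix s1 assume s1: "list_ctx s1 \<and> stored_values (snd s1) (residuals n) (independent_count E)"
    show "run width (Seq take_powers (Seq moebius search)) s1
      (take_powers_time n D + (moebius_time n D + search_time n D))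
      (\<lambda>s'. fst s' 0 \<noteq> 0 \<longleftrightarrow> coverable {..<n} E k)"
    proof (rule run_Seq, rule run_mono[OF run_take_powers[OF k_less conjunct1[OF s1] conjunct2[OF s1] independent_count_less] order.refl])
      fix s2 assume s2: "list_ctx s2 \<and> stored_values (snd s2) (residuals n) (\<lambda>Y. independent_count E Y ^ (k - 2))"
      have "finite Y" if "Y \<in> set (residuals n)" for Y
        using that by (auto simp: set_residual_list intro: finite_subset)
      \<comment> \<open>The powers count tuples without any covering condition, which is where the
        Moebius transform starts.\<close>
      then have vals: "stored_values (snd s2) (residuals n) (\<lambda>Y. card (covering_tuples E (k - 2) {} Y))"
        using s2 by (simp add: stored_values_def card_covering_tuples_empty)
      show "run width (Seq moebius search) s2 (moebius_time n D + search_time n D)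
        (\<lambda>s'. fst s' 0 \<noteq> 0 \<longleftrightarrow> coverable {..<n} E k)"
        by (rule run_Seq, rule run_mono[OF run_moebius[OF conjunct1[OF s2] vals] order.refl])
          (use run_search[OF k_less] in blast)
    qed
  qed
qed (simp add: simple_expr_def)

end

section \<open>Reading the input and correctness of the program\<close>

lemma instance_memory:
  fixes n k :: nat and E :: "nat set set"
  defines "M \<equiv> snd (initial_state (instance_word n E k))"
  shows "M 0 = n"
    and "u < n \<Longrightarrow> v < n \<Longrightarrow> M (1 + (n * u + v)) = of_bool ({u, v} \<in> E)"
    and "M (n * n + 1 + i) = (if i < floorlog 2 k then if bit k i then 2 else 1 else 0)"
    and "M a \<le> n + 2"
proof -
  have len: "length (instance_word n E k) = 1 + n * n + floorlog 2 k"
    by (simp add: instance_word_def adjacency_word_def binary_word_def)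
  show "M 0 = n" by (simp add: M_def initial_state_def instance_word_def)
  show "M (1 + (n * u + v)) = of_bool ({u, v} \<in> E)" if "u < n" "v < n"
  proof -
    have "n * u + v < n * Suc u" using that by simp
    also have "\<dots> \<le> n * n" using that by (intro mult_left_mono) auto
    finally have lt: "n * u + v < n * n" .
    have "(n * u + v) div n = u" "(n * u + v) mod n = v" using that by simp_all
    then show ?thesis using lt
      by (simp add: M_def initial_state_def len instance_word_def nth_append adjacency_word_def)
  qed
  show "M (n * n + 1 + i) = (if i < floorlog 2 k then if bit k i then 2 else 1 else 0)"
    by (simp add: M_def initial_state_def len instance_word_def nth_append adjacency_word_def binary_word_def)
  show "M a \<le> n + 2"
  proof (cases "a < length (instance_word n E k)")
    case True
    then have "instance_word n E k ! a \<in> set (instance_word n E k)" by (rule nth_mem)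
    then have "instance_word n E k ! a \<le> n + 2"
      by (auto simp: instance_word_def adjacency_word_def binary_word_def)
    then show ?thesis using True by (simp add: M_def initial_state_def)
  next
    case False
    then show ?thesis by (simp add: M_def initial_state_def)
  qed
qed

context counting
begin

lemma initial_bounded: "bounded_state width (initial_state (instance_word n E k))"
proof -
  have "snd (initial_state (instance_word n E k)) a < 2 ^ width" for a
  proof (rule le_less_trans[OF instance_memory(4)])
    have "n + 2 \<le> 2 ^ (n + 2)" using less_exp[of "n + 2"] by linarith
    also have "\<dots> \<le> 2 ^ (n * n + n + 2)" by (rule power_increasing) auto
    finally show "n + 2 < 2 ^ width" by (rule less_width)
  qed
  then show ?thesis by (simp add: bounded_state_def width_def initial_state_def)
qed

lemma run_read_input:
  defines "s \<equiv> initial_state (instance_word n E k)"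
  shows "run width read_input s (read_input_time n)
    (\<lambda>s'. fst s' 1 = n \<and> fst s' 2 = take_bit n k \<and> fst s' 8 = 2 ^ n \<and> tables (snd s')
       \<and> (snd s' (n * n + 1 + n) \<noteq> 0 \<longleftrightarrow> 2 ^ n \<le> k))"
proof -
  define M where "M = snd s"
  note mem = instance_memory[where n = n and k = k and E = E, folded s_def, folded M_def]
  have reg0: "fst s r = 0" for r by (simp add: s_def initial_state_def)
  \<comment> \<open>The digit cells already read hold powers of two, while those still to be read
    are as in the input.\<close>
  define I where "I i s' \<longleftrightarrow> fst s' 1 = n \<and> fst s' 2 = take_bit i k \<and> fst s' 8 = 2 ^ i
      \<and> (\<forall>u<i. snd s' (n * n + 1 + u) = 2 ^ u) \<and> (\<forall>a. a < n * n + 1 \<or> n * n + 1 + i \<le> a \<longrightarrow> snd s' a = M a)"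
    for i and s' :: state
  have step: "run width (Seq (Assign 2 (Add (Reg 2) (Mul (Reg 8) (Sub (Load (pow_addr 5)) (Const 1)))))
      (Seq (Store (pow_addr 5) (Reg 8)) (Assign 8 (Mul (Const 2) (Reg 8))))) s1 (1 + (1 + 1))
      (\<lambda>s'. fst s' 5 = i \<and> I (Suc i) ((fst s')(5 := Suc i), snd s'))"
    if i: "i < n" and s1: "I i s1" "fst s1 5 = i" for i s1
  proof -
    have pow: "(2 :: nat) ^ Suc i \<le> 2 ^ n" using i by (intro power_increasing) auto
    have addr: "val (pow_addr 5) s1 = n * n + 1 + i" using s1 by (simp add: pow_addr_def I_def)
    have "snd s1 (n * n + 1 + i) - 1 = of_bool (bit k i)"
    proof -
      have "snd s1 (n * n + 1 + i) = M (n * n + 1 + i)" using s1 by (simp add: I_def)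
      moreover have "\<not> bit k i" if "\<not> i < floorlog 2 k"
      proof -
        have "k < 2 ^ i" using that by (intro floorlog_leD) auto
        then show ?thesis by (simp add: bit_iff_odd)
      qed
      ultimately show ?thesis unfolding mem(3) by auto
    qed
    then have v1: "val (Add (Reg 2) (Mul (Reg 8) (Sub (Load (pow_addr 5)) (Const 1)))) s1 = take_bit (Suc i) k"
      using s1 addr by (simp add: I_def take_bit_Suc_from_most)
    define s2 where "s2 = ((fst s1)(2 := take_bit (Suc i) k), snd s1)"
    define s3 where "s3 = (fst s2, (snd s2)(n * n + 1 + i := 2 ^ i))"
    have addr2: "val (pow_addr 5) s2 = n * n + 1 + i" using s1 by (simp add: pow_addr_def I_def s2_def)
    have v2: "val (Reg 8) s2 = 2 ^ i" using s1 by (simp add: I_def s2_def)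
    have v3: "val (Mul (Const 2) (Reg 8)) s3 = 2 ^ Suc i" using s1 by (simp add: I_def s3_def s2_def)
    have fin: "I (Suc i) ((fst s3)(8 := 2 ^ Suc i, 5 := Suc i), snd s3)" "fst s3 5 = i"
      using s1 by (auto simp: I_def s3_def s2_def less_Suc_eq)
    show ?thesis
    proof (rule run_Seq, rule run_Assign, simp add: simple_expr_def, unfold v1, unfold s2_def[symmetric])
      have "take_bit (Suc i) k < 2 ^ Suc i" by (rule take_bit_nat_less_exp)
      then show "take_bit (Suc i) k < 2 ^ width" using pow by (intro less_width_pow) simp
      show "run width (Seq (Store (pow_addr 5) (Reg 8)) (Assign 8 (Mul (Const 2) (Reg 8)))) s2 (1 + 1)
        (\<lambda>s'. fst s' 5 = i \<and> I (Suc i) ((fst s')(5 := Suc i), snd s'))"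
      proof (rule run_Seq, rule run_Store, simp add: simple_expr_def, simp add: simple_expr_def, unfold v2 addr2,
          unfold s3_def[symmetric])
        show "(2 :: nat) ^ i < 2 ^ width" using i by (intro less_width_pow) simp
        show "run width (Assign 8 (Mul (Const 2) (Reg 8))) s3 1
          (\<lambda>s'. fst s' 5 = i \<and> I (Suc i) ((fst s')(5 := Suc i), snd s'))"
        proof (rule run_Assign, simp add: simple_expr_def, unfold v3)
          show "(2 :: nat) ^ Suc i < 2 ^ width" using pow by (rule less_width_pow)
        qed (use fin in auto)
      qed
    qed
  qed
  define s1 where "s1 = ((fst s)(1 := n), snd s)"
  define s2 where "s2 = ((fst s1)(8 := 1), snd s1)"
  have I0: "I 0 ((fst s2)(5 := 0), snd s2)"
    by (simp add: I_def s2_def s1_def reg0 M_def)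
  have final: "fst s' 1 = n \<and> fst s' 2 = take_bit n k \<and> fst s' 8 = 2 ^ n \<and> tables (snd s')
      \<and> (snd s' (n * n + 1 + n) \<noteq> 0 \<longleftrightarrow> 2 ^ n \<le> k)" if "I n s'" for s'
  proof -
    have "snd s' (1 + (n * u + v)) = of_bool ({u, v} \<in> E)" if uv: "u < n" "v < n" for u v
    proof -
      have "n * u + v < n * Suc u" using uv by simp
      also have "\<dots> \<le> n * n" using uv by (intro mult_left_mono) auto
      finally have "1 + (n * u + v) < n * n + 1" by simp
      then have "snd s' (1 + (n * u + v)) = M (1 + (n * u + v))" using \<open>I n s'\<close> unfolding I_def by blast
      then show ?thesis using mem(2)[OF uv] by simp
    qed
    then have "tables (snd s')" using that unfolding tables_def I_def by blast
    moreover have "snd s' (n * n + 1 + n) = M (n * n + 1 + n)" using that unfolding I_def by blast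
    \<comment> \<open>The digit of weight \<open>2 ^ n\<close> is present exactly if
      \<open>k\<close> is at least \<open>2 ^ n\<close>, so a single cell reveals whether
      \<open>k\<close> is too long.\<close>
    moreover have "n < floorlog 2 k \<longleftrightarrow> 2 ^ n \<le> k"
      using floorlog_le_iff[of 2 k n] by linarith
    ultimately show ?thesis using that unfolding mem(3) I_def by simp
  qed
  have loop: "run width (For 5 1 (Seq (Assign 2 (Add (Reg 2) (Mul (Reg 8) (Sub (Load (pow_addr 5)) (Const 1)))))
      (Seq (Store (pow_addr 5) (Reg 8)) (Assign 8 (Mul (Const 2) (Reg 8)))))) s2 (n * ((1 + (1 + 1)) + 2) + 2)
      (\<lambda>s'. fst s' 1 = n \<and> fst s' 2 = take_bit n k \<and> fst s' 8 = 2 ^ n \<and> tables (snd s')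
        \<and> (snd s' (n * n + 1 + n) \<noteq> 0 \<longleftrightarrow> 2 ^ n \<le> k))"
  proof (rule run_For[where I = I])
    show "n < 2 ^ width" by (rule less_width_n) simp
  next
    fix i s' assume "I i s'"
    then show "fst s' 1 = n" by (simp add: I_def)
  next
    show "I 0 ((fst s2)(5 := 0), snd s2)" by (rule I0)
  qed (rule step final; assumption)+
  have v1: "val (Load (Const 0)) s = n" using mem(1) by (simp add: M_def)
  have v2: "val (Const 1) s1 = 1" by simp
  show ?thesis
    unfolding read_input_def read_input_time_def
    apply (rule run_Seq, rule run_Assign, simp add: simple_expr_def, unfold v1, rule less_width_n, simp, unfold s1_def[symmetric])
    apply (rule run_Seq, rule run_Assign, simp add: simple_expr_def, unfold v2, rule less_width_n, simp, unfold s2_def[symmetric])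
    apply (rule loop)
    done
qed

lemma run_colouring_prog:
  "run width colouring_prog (initial_state (instance_word n E k)) (colouring_time n D)
    (\<lambda>s. fst s 0 \<noteq> 0 \<longleftrightarrow> coverable {..<n} E k)"
proof -
  let ?e = "Add (Load (pow_addr 1)) (Sub (Add (Reg 2) (Const 1)) (Reg 1))"
  show ?thesis
    unfolding colouring_prog_def colouring_time_def
  proof (rule run_Seq, rule run_mono[OF run_read_input order.refl])
    fix s :: state assume s: "fst s 1 = n \<and> fst s 2 = take_bit n k \<and> fst s 8 = 2 ^ n \<and> tables (snd s)
       \<and> (snd s (n * n + 1 + n) \<noteq> 0 \<longleftrightarrow> 2 ^ n \<le> k)"
    \<comment> \<open>A \<open>k\<close> that is too long is in particular at least
      \<open>n\<close>, so both reasons for accepting at once amount to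
      \<open>n \<le> k\<close>.\<close>
    have large: "2 ^ n \<le> k \<Longrightarrow> n \<le> k" using less_exp[of n] by linarith
    have small: "take_bit n k = k" if "\<not> 2 ^ n \<le> k" using that by (simp add: take_bit_nat_eq_self)
    have "val ?e s \<noteq> 0 \<longleftrightarrow> 2 ^ n \<le> k \<or> n \<le> take_bit n k" using s by (auto simp: pow_addr_def)
    then have v: "val ?e s \<noteq> 0 \<longleftrightarrow> n \<le> k" using large small by (cases "2 ^ n \<le> k") auto
    show "run width (If ?e (Assign 0 (Const 1)) colour) s (1 + colour_time n D)
      (\<lambda>s. fst s 0 \<noteq> 0 \<longleftrightarrow> coverable {..<n} E k)"
    proof (rule run_If)
      assume "val ?e s \<noteq> 0"
      then have "coverable {..<n} E k" using v coverable_mono[OF coverable_card[OF graph]] by blast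
      then have "run width (Assign 0 (Const 1)) s 1 (\<lambda>s. fst s 0 \<noteq> 0 \<longleftrightarrow> coverable {..<n} E k)"
        by (intro run_Assign) (auto simp: simple_expr_def intro: less_width_n)
      then show "run width (Assign 0 (Const 1)) s (colour_time n D) (\<lambda>s. fst s 0 \<noteq> 0 \<longleftrightarrow> coverable {..<n} E k)"
        by (rule run_mono) (simp_all add: colour_time_def)
    next
      assume "val ?e s = 0"
      then have "k < n" using v by simp
      then have "take_bit n k = k" using large small by fastforce
      then show "run width colour s (colour_time n D) (\<lambda>s. fst s 0 \<noteq> 0 \<longleftrightarrow> coverable {..<n} E k)"
        using s \<open>k < n\<close> by (intro run_colour) auto
    qed (simp add: simple_expr_def)
  qed
qed

end

section \<open>The total running time\<close>

lemma colouring_time_le: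
  assumes "1 \<le> D"
  shows "colouring_time n D \<le> colouring_time n 1 * D"
proof -
  \<comment> \<open>Loops over the list are never nested in each other, so the time is affine in
    \<open>D\<close>; for \<open>D \<ge> 1\<close> this gives
    \<open>a + b * D \<le> (a + b) * D\<close>.\<close>
  obtain a b where "\<And>D. colouring_time n D = a + b * D"
  proof
    show "colouring_time n D = colouring_time n 0 + (colouring_time n 1 - colouring_time n 0) * D" for D
      by (simp add: colouring_time_def colour_time_def enumerate_residual_time_def take_powers_time_def
          moebius_time_def search_time_def algebra_simps)
  qed
  then show ?thesis using assms by (simp add: algebra_simps)
qed

lemma polynomial_colouring_time:
  "polynomial_fun (\<lambda>n. colouring_time n 1 * step_cost (n * n + n + 10))"
  unfolding colouring_time_def colour_time_def read_input_time_def enumerate_residual_time_def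
    extend_list_time_def remove_neighbours_time_def residual_test_time_def take_powers_time_def
    moebius_time_def search_time_def bipartite_test_time_def merge_labels_time_def step_cost_def
  by (intro polynomial_fun_intros)

theorem theorem3p9:
  "\<exists>(c :: prog) (p :: real poly). \<forall>(n :: nat) (E :: nat set set) (\<Delta> :: nat) (k :: nat).
     simple_graph {..<n} E \<longrightarrow> max_degree {..<n} E = \<Delta> \<longrightarrow>
       decides_within c (instance_word n E k) (coverable {..<n} E k)
         (poly p (real n) * (2 ^ (\<Delta> + 1) - real \<Delta> - 1) powr (real n / (real \<Delta> + 1)))
       \<and> (coverable {..<n} E k \<longleftrightarrow> chromatic_number {..<n} E \<le> k)"
proof -
  obtain p :: "real poly" where p: "\<And>n. real (colouring_time n 1 * step_cost (n * n + n + 10)) = poly p (real n)"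
    using polynomial_colouring_time unfolding polynomial_fun_def by blast
  have "decides_within colouring_prog (instance_word n E k) (coverable {..<n} E k)
      (poly p (real n) * (2 ^ (\<Delta> + 1) - real \<Delta> - 1) powr (real n / (real \<Delta> + 1)))"
    if G: "simple_graph {..<n} E" "max_degree {..<n} E = \<Delta>" for n k E \<Delta>
  proof -
    interpret counting n k E using G(1) by (rule counting.intro)
    \<comment> \<open>The empty set is always residual. So \<open>D\<close> is positive, and the
      time is at most a polynomial in \<open>n\<close> times \<open>D\<close>.\<close>
    have "{} \<in> residual {..<n} E" by (simp add: residual_def)
    then have D: "1 \<le> D"
      using finite_residual[of "{..<n}" E] by (auto simp: D_def Suc_le_eq card_gt_0_iff)
    have p: "real (colouring_time n 1 * step_cost width) = poly p (real n)"
      using p[of n] by (simp only: width_def)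
    obtain t s where ex: "exec colouring_prog (initial_state (instance_word n E k)) t s"
      and t: "t \<le> colouring_time n D * step_cost width" and ans: "fst s 0 \<noteq> 0 \<longleftrightarrow> coverable {..<n} E k"
      using run_colouring_prog initial_bounded unfolding run_def by blast
    have "t \<le> colouring_time n 1 * step_cost width * D"
      using order_trans[OF t mult_right_mono[OF colouring_time_le[OF D]]] by (simp add: ac_simps)
    then have "real t \<le> real (colouring_time n 1 * step_cost width) * real D"
      by (metis of_nat_le_iff of_nat_mult)
    also have "\<dots> = poly p (real n) * real D" by (simp only: p)
    also have "\<dots> \<le> poly p (real n) * (2 ^ (\<Delta> + 1) - real \<Delta> - 1) powr (real n / (real \<Delta> + 1))"
      using card_residual_le[OF G] by (intro mult_left_mono) (simp_all add: D_def flip: p)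
    finally show ?thesis using ex ans unfolding decides_within_def by blast
  qed
  then show ?thesis using coverable_iff_chromatic_number by blast
qed

end
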